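(* For every nonempty transitive sofic subshift $\Sigma\subseteq Q^{\mathbb{Z}}$ over a finite alphabet $Q$, there exists a cellular automaton $\mathcal{A}$ whose $\mu$-limit set $\Lambda_\mu(\mathcal{A})$, where $\mu$ is the uniform Bernoulli measure, is exactly $\Sigma$.
   Context: For a finite alphabet $Q$, $Q^*=\bigcup_{n\in\mathbb{N}}Q^n$ is the set of finite words, and configurations are elements of $Q^{\mathbb{Z}}$. For $c\in Q^{\mathbb{Z}}$ and $i\le j$, $c_{[i,j]}=c_ic_{i+1}\cdots c_j$. The language $\mathcal{L}(S)$ of $S\subseteq Q^{\mathbb{Z}}$ is the set of finite words $u$ occurring as $u=c_{[i,i+|u|-1]}$ for some $c\in S$, $i\in\mathbb{Z}$. A subshift is a closed, shift-invariant subset of $Q^{\mathbb{Z}}$ (product topology). A subshift is sofic if it can be defined by a rational (regular) language of forbidden words, i.e. one given by a finite automaton. A subshift $\Sigma$ is transitive if for all $u,v\in\mathcal{L}(\Sigma)$ there exists a word $w$ such that $uwv\in\mathcal{L}(\Sigma)$. A cellular automaton $\mathcal{A}=(Q_{\mathcal{A}},r,\delta)$ consists of a finite alphabet $Q_{\mathcal{A}}$, a radius $r$ and a local rule $\delta:Q_{\mathcal{A}}^{2r+1}\to Q_{\mathcal{A}}$; it acts on $Q_{\mathcal{A}}^{\mathbb{Z}}$ by $\mathcal{A}(c)_z=\delta(c_{z-r},\dots,c_z,\dots,c_{z+r})$. The uniform Bernoulli measure $\mu$ on $Q_{\mathcal{A}}^{\mathbb{Z}}$ is given by $\mu([u]_i)=|Q_{\mathcal{A}}|^{-|u|}$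 for all $u\in Q_{\mathcal{A}}^*$, $i\in\mathbb{Z}$, where $[u]_i=\{c: c_{[i,i+|u|-1]}=u\}$. Write $\mathcal{A}^n\mu([u]_0)=\mu(\mathcal{A}^{-n}([u]_0))$. The persistent set $L_\mu(\mathcal{A})\subseteq Q_{\mathcal{A}}^*$ is defined by: $u\notin L_\mu(\mathcal{A})$ if and only if $\lim_{n\to\infty}\mathcal{A}^n\mu([u]_0)=0$. The $\mu$-limit set is $\Lambda_\mu(\mathcal{A})=\{c\in Q_{\mathcal{A}}^{\mathbb{Z}}:\mathcal{L}(\{c\})\subseteq L_\mu(\mathcal{A})\}$. The alphabet $Q_{\mathcal{A}}$ of the cellular automaton may be larger than $Q$: one has $Q\subseteq Q_{\mathcal{A}}$, and $\Sigma\subseteq Q^{\mathbb{Z}}$ is viewed as a subset of $Q_{\mathcal{A}}^{\mathbb{Z}}$. *)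

theory Defs
  imports "HOL-Probability.Probability"
begin

definition configs :: "'a set \<Rightarrow> (int \<Rightarrow> 'a) set" where
  "configs Q = UNIV \<rightarrow>\<^sub>E Q"

definition factor :: "(int \<Rightarrow> 'a) \<Rightarrow> int \<Rightarrow> int \<Rightarrow> 'a list" where
  "factor c i j = map c [i..j]"

definition language :: "(int \<Rightarrow> 'a) set \<Rightarrow> 'a list set" where
  "language S = {u. \<exists>c\<in>S. \<exists>i. u = factor c i (i + int (length u) - 1)}"

definition shift :: "(int \<Rightarrow> 'a) \<Rightarrow> int \<Rightarrow> 'a" where
  "shift c = (\<lambda>z. c (z + 1))"

definition config_topology :: "'a set \<Rightarrow> (int \<Rightarrow> 'a) topology" where
  "config_topology Q = product_topology (\<lambda>_. discrete_topology Q) UNIV"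

definition subshift :: "'a set \<Rightarrow> (int \<Rightarrow> 'a) set \<Rightarrow> bool" where
  "subshift Q S \<longleftrightarrow> closedin (config_topology Q) S \<and> shift ` S = S"

definition transitive_subshift :: "(int \<Rightarrow> 'a) set \<Rightarrow> bool" where
  "transitive_subshift S \<longleftrightarrow>
     (\<forall>u\<in>language S. \<forall>v\<in>language S. \<exists>w. u @ w @ v \<in> language S)"

record ('s, 'a) automaton =
  states :: "'s set"
  initial :: "'s set"
  final :: "'s set"
  transitions :: "('s \<times> 'a \<times> 's) set"

definition finite_automaton :: "'a set \<Rightarrow> ('s, 'a) automaton \<Rightarrow> bool" where
  "finite_automaton Q M \<longleftrightarrow> finite (states M) \<and> initial M \<subseteq> states M \<and> final M \<subseteq> states M \<and>
     transitions M \<subseteq> states M \<times> Q \<times> states M"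

primrec reaches :: "('s, 'a) automaton \<Rightarrow> 's \<Rightarrow> 'a list \<Rightarrow> 's \<Rightarrow> bool" where
  "reaches M p [] q \<longleftrightarrow> p = q"
| "reaches M p (a # w) q \<longleftrightarrow> (\<exists>p'. (p, a, p') \<in> transitions M \<and> reaches M p' w q)"

definition accepted :: "('s, 'a) automaton \<Rightarrow> 'a list set" where
  "accepted M = {w. \<exists>p\<in>initial M. \<exists>q\<in>final M. reaches M p w q}"

text \<open>Drawing the states from \<^typ>\<open>nat\<close> loses nothing, as the state set is finite. A word over
  \<^term>\<open>Q\<close> includes the empty word, which is forbidden only if the subshift is empty.\<close>

definition regular_language :: "'a set \<Rightarrow> 'a list set \<Rightarrow> bool" where
  "regular_language Q F \<longleftrightarrow>
     F \<subseteq> lists Q \<and> (\<exists>M :: (nat, 'a) automaton. finite_automaton Q M \<and> accepted M = F)"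

definition avoiding :: "'a set \<Rightarrow> 'a list set \<Rightarrow> (int \<Rightarrow> 'a) set" where
  "avoiding Q F = {c \<in> configs Q. language {c} \<inter> F = {}}"

definition sofic :: "'a set \<Rightarrow> (int \<Rightarrow> 'a) set \<Rightarrow> bool" where
  "sofic Q S \<longleftrightarrow> subshift Q S \<and> (\<exists>F. regular_language Q F \<and> S = avoiding Q F)"

record 'a cellular_automaton =
  alphabet :: "'a set"
  radius :: nat
  local_rule :: "'a list \<Rightarrow> 'a"

definition cellular_automaton :: "'a cellular_automaton \<Rightarrow> bool" where
  "cellular_automaton A \<longleftrightarrow> finite (alphabet A) \<and> alphabet A \<noteq> {} \<and>
     (\<forall>w\<in>lists (alphabet A). length w = 2 * radius A + 1 \<longrightarrow> local_rule A w \<in> alphabet A)"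

definition global_map :: "'a cellular_automaton \<Rightarrow> (int \<Rightarrow> 'a) \<Rightarrow> int \<Rightarrow> 'a" where
  "global_map A c =
     (\<lambda>z. local_rule A (factor c (z - int (radius A)) (z + int (radius A))))"

definition cylinder :: "'a set \<Rightarrow> 'a list \<Rightarrow> int \<Rightarrow> (int \<Rightarrow> 'a) set" where
  "cylinder Q u i = {c \<in> configs Q. factor c i (i + int (length u) - 1) = u}"

definition bernoulli :: "'a set \<Rightarrow> (int \<Rightarrow> 'a) measure" where
  "bernoulli Q = (\<Pi>\<^sub>M z\<in>UNIV. uniform_count_measure Q)"

definition persistent_set :: "'a cellular_automaton \<Rightarrow> 'a list set" where
  "persistent_set A = {u \<in> lists (alphabet A).
     \<not> (\<lambda>n. measure (bernoulli (alphabet A))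
            ((global_map A ^^ n) -` cylinder (alphabet A) u 0 \<inter> configs (alphabet A)))
         \<longlonglongrightarrow> 0}"

definition mu_limit_set :: "'a cellular_automaton \<Rightarrow> (int \<Rightarrow> 'a) set" where
  "mu_limit_set A = {c \<in> configs (alphabet A). language {c} \<subseteq> persistent_set A}"

text \<open>\<^const>\<open>measure\<close> is 0 outside the sigma-algebra, so \<^const>\<open>persistent_set\<close> is meaningful only
  because the sets it measures are measurable (last lemma below).\<close>

lemma length_factor: "length (factor c i j) = nat (j - i + 1)"
  by (simp add: factor_def)

lemma factor_nth: "k < nat (j - i + 1) \<Longrightarrow> factor c i j ! k = c (i + int k)"
  by (simp add: factor_def)

lemma space_bernoulli: "space (bernoulli Q) = configs Q"
  by (simp add: bernoulli_def space_PiM configs_def space_uniform_count_measure)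

lemma cylinder_eq_prod_emb:
  fixes i :: int
  assumes "u \<in> lists Q"
  shows "cylinder Q u i = prod_emb UNIV (\<lambda>_. uniform_count_measure Q) {i..<i + int (length u)}
           (\<Pi>\<^sub>E z\<in>{i..<i + int (length u)}. {u ! nat (z - i)})"
proof (rule set_eqI)
  fix c
  have "factor c i (i + int (length u) - 1) = u \<longleftrightarrow>
        (\<forall>k<length u. c (i + int k) = u ! k)"
    by (simp add: list_eq_iff_nth_eq length_factor factor_nth)
  also have "\<dots> \<longleftrightarrow> (\<forall>z\<in>{i..<i + int (length u)}. c z = u ! nat (z - i))" (is "?L = ?R")
  proof
    assume L: ?L
    show ?R
    proof
      fix z assume z: "z \<in> {i..<i + int (length u)}"
      then have "nat (z - i) < length u" "i + int (nat (z - i)) = z" by auto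
      with L show "c z = u ! nat (z - i)" by metis
    qed
  next
    assume R: ?R
    show ?L
    proof (intro allI impI)
      fix k assume "k < length u"
      then have "i + int k \<in> {i..<i + int (length u)}" by auto
      with R have "c (i + int k) = u ! nat (i + int k - i)" by blast
      then show "c (i + int k) = u ! k" by simp
    qed
  qed
  finally show "c \<in> cylinder Q u i \<longleftrightarrow> c \<in> prod_emb UNIV (\<lambda>_. uniform_count_measure Q)
      {i..<i + int (length u)} (\<Pi>\<^sub>E z\<in>{i..<i + int (length u)}. {u ! nat (z - i)})"
    by (auto simp: cylinder_def configs_def prod_emb_def PiE_iff space_uniform_count_measure)
qed

lemma sets_cylinder:
  assumes "u \<in> lists Q"
  shows "cylinder Q u i \<in> sets (bernoulli Q)"
  unfolding cylinder_eq_prod_emb[OF assms] bernoulli_def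
proof (rule sets_PiM_I, simp, simp, rule ballI)
  fix z assume z: "z \<in> {i..<i + int (length u)}"
  then have "nat (z - i) < length u" by auto
  with assms have "u ! nat (z - i) \<in> Q" by (meson in_listsD nth_mem)
  then show "{u ! nat (z - i)} \<in> sets (uniform_count_measure Q)"
    by (simp add: sets_uniform_count_measure)
qed

lemma measure_bernoulli_cylinder:
  assumes "finite Q" "Q \<noteq> {}" "u \<in> lists Q"
  shows "measure (bernoulli Q) (cylinder Q u i) = 1 / real (card Q) ^ length u"
proof -
  let ?J = "{i..<i + int (length u)}"
  interpret U: prob_space "uniform_count_measure Q"
    using assms by (intro prob_space_uniform_count_measure)
  interpret product_prob_space "\<lambda>_::int. uniform_count_measure Q" UNIV ..
  have mem: "u ! nat (z - i) \<in> Q" if z: "z \<in> ?J" for z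
  proof -
    from z have "nat (z - i) < length u" by auto
    with assms(3) show ?thesis by (meson in_listsD nth_mem)
  qed
  have "measure (bernoulli Q) (cylinder Q u i) =
        (\<Prod>z\<in>?J. measure (uniform_count_measure Q) {u ! nat (z - i)})"
    unfolding cylinder_eq_prod_emb[OF assms(3)] bernoulli_def
    by (rule measure_PiM_emb) (auto simp: sets_uniform_count_measure mem)
  also have "\<dots> = (\<Prod>z\<in>?J. 1 / real (card Q))"
    using assms mem by (intro prod.cong) (auto simp: measure_uniform_count_measure)
  finally show ?thesis by (simp add: power_divide)
qed

lemma global_map_configs:
  assumes "cellular_automaton A" "c \<in> configs (alphabet A)"
  shows "global_map A c \<in> configs (alphabet A)"
proof -
  have "local_rule A (factor c (z - int (radius A)) (z + int (radius A))) \<in> alphabet A" for z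
  proof -
    have "factor c (z - int (radius A)) (z + int (radius A)) \<in> lists (alphabet A)"
      using assms(2) by (auto simp: factor_def configs_def PiE_iff)
    moreover have "length (factor c (z - int (radius A)) (z + int (radius A))) = 2 * radius A + 1"
      by (simp add: length_factor)
    ultimately show ?thesis
      using assms(1) unfolding cellular_automaton_def by blast
  qed
  then show ?thesis
    by (simp add: global_map_def configs_def PiE_iff)
qed

lemma measurable_global_map:
  assumes A: "cellular_automaton A"
  shows "global_map A \<in> measurable (bernoulli (alphabet A)) (bernoulli (alphabet A))"
proof -
  let ?Q = "alphabet A"
  have fin: "finite {u \<in> lists ?Q. length u = 2 * radius A + 1}"
    using finite_lists_length_eq[of ?Q "2 * radius A + 1"] A
    by (simp add: cellular_automaton_def lists_eq_set)
  have coord: "(\<lambda>c. global_map A c z) \<in> measurable (bernoulli ?Q) (uniform_count_measure ?Q)" for z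
  proof (rule measurableI)
    fix c assume "c \<in> space (bernoulli ?Q)"
    then show "global_map A c z \<in> space (uniform_count_measure ?Q)"
      using global_map_configs[OF A, of c]
      by (auto simp: space_bernoulli configs_def space_uniform_count_measure PiE_iff)
  next
    fix X assume "X \<in> sets (uniform_count_measure ?Q)"
    have "(\<lambda>c. global_map A c z) -` X \<inter> space (bernoulli ?Q) =
      (\<Union>u\<in>{u \<in> {u \<in> lists ?Q. length u = 2 * radius A + 1}. local_rule A u \<in> X}.
          cylinder ?Q u (z - int (radius A)))" (is "?L = ?R")
    proof (intro set_eqI iffI)
      fix c assume c: "c \<in> ?L"
      let ?u = "factor c (z - int (radius A)) (z + int (radius A))"
      have len: "length ?u = 2 * radius A + 1" by (simp add: length_factor)
      have "?u \<in> lists ?Q"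
        using c by (auto simp: factor_def space_bernoulli configs_def PiE_iff)
      moreover have "local_rule A ?u \<in> X" using c by (simp add: global_map_def)
      moreover have end_eq: "z - int (radius A) + int (length ?u) - 1 = z + int (radius A)"
        unfolding len by simp
      have "c \<in> cylinder ?Q ?u (z - int (radius A))"
        using c by (simp only: cylinder_def space_bernoulli end_eq) simp
      ultimately show "c \<in> ?R" using len by blast
    next
      fix c assume "c \<in> ?R"
      then obtain u where u: "length u = 2 * radius A + 1" "local_rule A u \<in> X"
        and c: "c \<in> cylinder ?Q u (z - int (radius A))" by blast
      have "z - int (radius A) + int (length u) - 1 = z + int (radius A)"
        unfolding u by simp
      with u c show "c \<in> ?L"
        by (auto simp: cylinder_def global_map_def space_bernoulli)
    qed
    also have "\<dots> \<in> sets (bernoulli ?Q)"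
      by (intro sets.finite_UN sets_cylinder finite_subset[OF _ fin]) auto
    finally show "(\<lambda>c. global_map A c z) -` X \<inter> space (bernoulli ?Q) \<in> sets (bernoulli ?Q)" .
  qed
  show ?thesis
    unfolding bernoulli_def[of ?Q]
    by (rule measurable_PiM_single')
      (use coord global_map_configs[OF A] in
        \<open>auto simp: bernoulli_def[symmetric] space_bernoulli configs_def space_uniform_count_measure\<close>)
qed

lemma sets_preimage_cylinder:
  assumes "cellular_automaton A" "u \<in> lists (alphabet A)"
  shows "(global_map A ^^ n) -` cylinder (alphabet A) u i \<inter> configs (alphabet A)
           \<in> sets (bernoulli (alphabet A))"
proof -
  have "(global_map A ^^ n) \<in> measurable (bernoulli (alphabet A)) (bernoulli (alphabet A))"
    by (rule measurable_compose_n[OF measurable_global_map[OF assms(1)]])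
  from measurable_sets[OF this sets_cylinder[OF assms(2)]] show ?thesis
    by (simp add: space_bernoulli)
qed

end

(* A word w0 of the language with a minimal follower set yields, by transitivity, a finite strongly
connected graph presenting Sigma. Beside the letters, the automaton has particles: right-moving
ones write behind them a path of the graph, left-moving ones write a path backwards, and two
particles that meet annihilate, leaving a defect that disappears when it is next overrun. The
uniform measure makes both kinds of particles equally frequent; as a right-moving and a
left-moving particle facing each other cannot both survive, the density of particles tends to 0,
and so do the densities of defects and of cells that were never overrun. What remains is labels of
paths, so words outside the language vanish.

Conversely the written words must stay rich although every cell is rewritten infinitely often. A
train of m adjacent right-moving particles acts as a linear one-sided automaton: each member adds
the memory of the one to its right to its own. If m is a power of two, every sequence of period m
can be fed in this way to the last member, in particular one that makes it write a given word from
any starting vertex. Inserting such a train just behind the last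
right-moving particle to reach the origin costs a factor independent of the time, and by reflection
symmetry the last particle to reach the origin comes from the left with probability at least one
half. *)

theory Submission
  imports Defs
begin

section \<open>Presentation of a transitive sofic shift\<close>

text \<open>The obstacle is richness. A particle with no \<open>Rgt\<close> cell in front of it
  keeps its memory, so alone it settles on one cycle of the graph; yet the particle that decides
  what stands at the origin may come from arbitrarily far away. The memories of a train form a
  linear system that keeps a prescribed periodic sequence going for as long as the train survives.
  Strong connectedness makes one such sequence good for every starting vertex, so nothing has to be
  known about the state in which the last member arrives. Survival is not tracked through the
  dynamics: matching opposite charges like brackets turns it into inequalities between partial sums
  of the initial charges. Each event at a finite time depends on finitely many cells, so
  probabilities come from counting and from bijections between windows. Inserting cells is such a
  bijection; it serves both to plant a train and to show that the maxima of the partial sums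
  grow.\<close>

lemma factor_append:
  assumes "i \<le> j" "j \<le> k + 1"
  shows "factor c i k = factor c i (j - 1) @ factor c j k"
proof (cases "j \<le> k")
  case True
  then show ?thesis using assms by (simp add: factor_def upto_split1[of i j k])
next
  case False
  then have "j = k + 1" using assms by simp
  then show ?thesis by (simp add: factor_def)
qed

lemma factor_cong:
  assumes "\<And>z. i \<le> z \<Longrightarrow> z \<le> j \<Longrightarrow> c z = c' z"
  shows "factor c i j = factor c' i j"
  using assms by (simp add: factor_def)

lemma factor_eq_iff:
  "u = factor c i (i + int (length u) - 1) \<longleftrightarrow> (\<forall>k<length u. c (i + int k) = u ! k)"
  by (auto simp: list_eq_iff_nth_eq length_factor factor_nth)

lemma language_iff: "u \<in> language S \<longleftrightarrow> (\<exists>c\<in>S. \<exists>i. \<forall>k<length u. c (i + int k) = u ! k)"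
  unfolding language_def mem_Collect_eq factor_eq_iff ..

lemma factor_in_language: "c \<in> S \<Longrightarrow> factor c i j \<in> language S"
proof -
  assume "c \<in> S"
  then show ?thesis
    by (auto simp: language_iff length_factor factor_nth intro!: bexI[of _ c] exI[of _ i])
qed

lemma language_append:
  assumes "u @ v \<in> language S"
  shows "u \<in> language S" "v \<in> language S"
proof -
  from assms obtain c i where c: "c \<in> S" "\<forall>k<length (u @ v). c (i + int k) = (u @ v) ! k"
    unfolding language_iff by blast
  have "\<forall>k<length u. c (i + int k) = u ! k"
    using c(2) by (auto simp: nth_append)
  then show "u \<in> language S" using c(1) unfolding language_iff by blast
  have "\<forall>k<length v. c ((i + int (length u)) + int k) = v ! k"
  proof (intro allI impI)
    fix k assume "k < length v"
    then show "c ((i + int (length u)) + int k) = v ! k"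
      using c(2)[rule_format, of "length u + k"] by (simp add: nth_append add.assoc)
  qed
  then show "v \<in> language S" using c(1) unfolding language_iff by blast
qed

lemma avoiding_shift:
  assumes "c \<in> avoiding Q F"
  shows "(\<lambda>z. c (z + d)) \<in> avoiding Q F"
proof -
  have "language {\<lambda>z. c (z + d)} \<subseteq> language {c}"
  proof
    fix u assume "u \<in> language {\<lambda>z. c (z + d)}"
    then obtain i where "\<forall>k<length u. c (i + int k + d) = u ! k"
      unfolding language_iff by blast
    then have "\<forall>k<length u. c (i + d + int k) = u ! k" by (simp add: algebra_simps)
    then show "u \<in> language {c}" unfolding language_iff by blast
  qed
  then show ?thesis using assms by (auto simp: avoiding_def configs_def PiE_iff)
qed

lemma reaches_append:
  "reaches M p (u @ v) q \<longleftrightarrow> (\<exists>r. reaches M p u r \<and> reaches M r v q)"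
  by (induction u arbitrary: p) auto

lemma reaches_states:
  assumes "finite_automaton Q M" "reaches M p w q" "p \<in> states M"
  shows "q \<in> states M"
  using assms(2,3)
proof (induction w arbitrary: p)
  case (Cons a w)
  then obtain p' where "(p, a, p') \<in> transitions M" "reaches M p' w q" by auto
  moreover have "p' \<in> states M" using assms(1) calculation(1) by (auto simp: finite_automaton_def)
  ultimately show ?case using Cons.IH by blast
qed simp

definition follower :: "'a list set \<Rightarrow> 'a list \<Rightarrow> 'a list set" where
  "follower L w = {v. w @ v \<in> L}"

text \<open>Only the forbidden words are known to be regular, so sets of states are formed twice.
  The left half of a configuration constrains the right half only through the set of states that
  words ending at the origin can reach; a word constrains its continuations only through the
  collection of these sets over all configurations in which it ends at the origin.\<close>

lemma finite_followers:
  assumes "sofic Q \<Sigma>"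
  shows "finite (range (follower (language \<Sigma>)))"
proof -
  from assms obtain F and M :: "(nat, 'a) automaton" where S: "\<Sigma> = avoiding Q F"
    and M: "finite_automaton Q M" "accepted M = F"
    by (auto simp: sofic_def regular_language_def)
  \<comment> \<open>The states a forbidden word begun anywhere on the left may have reached at the
    origin; \<open>i = 0\<close>, with an empty factor, contributes the initial states.\<close>
  define T where "T c = {q \<in> states M. \<exists>p\<in>initial M. \<exists>i\<le>0. reaches M p (factor c i (-1)) q}"
    for c
  have splice: "(\<lambda>z. if z < 0 then c z else c' z) \<in> \<Sigma>" (is "?s \<in> _")
    if c: "c \<in> \<Sigma>" and c': "c' \<in> \<Sigma>" and eq: "T c = T c'" for c c'
  proof -
    have conf: "?s \<in> configs Q"
      using c c' by (auto simp: S avoiding_def configs_def PiE_iff)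
    have "f \<notin> F" if "f \<in> language {?s}" for f
    proof
      assume f: "f \<in> F"
      from that obtain i j where i: "f = factor ?s i j" by (auto simp: language_def)
      have no: "f \<notin> language {c}" "f \<notin> language {c'}"
        using c c' f by (auto simp: S avoiding_def)
      consider "i \<ge> 0" | "j < 0" | "i < 0" "j \<ge> 0" by linarith
      then show False
      proof cases
        case 1
        then have "factor ?s i j = factor c' i j" by (intro factor_cong) simp
        then show False using i no factor_in_language[of c' "{c'}" i j] by simp
      next
        case 2
        then have "factor ?s i j = factor c i j" by (intro factor_cong) simp
        then show False using i no factor_in_language[of c "{c}" i j] by simp
      next
        case 3
        have "f = factor ?s i (-1) @ factor ?s 0 j"
          using i factor_append[of i 0 j ?s] 3 by simp
        also have "factor ?s i (-1) = factor c i (-1)" by (intro factor_cong) simp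
        also have "factor ?s 0 j = factor c' 0 j" by (intro factor_cong) simp
        finally have fe: "f = factor c i (-1) @ factor c' 0 j" .
        \<comment> \<open>A forbidden word across the origin is cut at the state \<open>r\<close>
          reached there. As \<open>r\<close> also belongs to \<open>T c'\<close>, another beginning
          leads to it inside \<open>c'\<close>, which would then contain a forbidden word
          itself.\<close>
        from f M(2) obtain p q where pq: "p \<in> initial M" "q \<in> final M" "reaches M p f q"
          by (auto simp: accepted_def)
        from pq(3) fe obtain r where r: "reaches M p (factor c i (-1)) r" "reaches M r (factor c' 0 j) q"
          using reaches_append by metis
        have "r \<in> states M" using reaches_states[OF M(1) r(1)] pq(1) M(1)
          by (auto simp: finite_automaton_def)
        then have "r \<in> T c" using r(1) pq(1) 3 by (auto simp: T_def intro!: bexI[of _ p] exI[of _ i])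
        then have "r \<in> T c'" using eq by simp
        then obtain p' i' where p': "p' \<in> initial M" "i' \<le> 0" "reaches M p' (factor c' i' (-1)) r"
          by (auto simp: T_def)
        have "reaches M p' (factor c' i' (-1) @ factor c' 0 j) q"
          using p'(3) r(2) reaches_append by metis
        moreover have "factor c' i' (-1) @ factor c' 0 j = factor c' i' j"
          using factor_append[of i' 0 j c'] p'(2) 3 by simp
        ultimately have "factor c' i' j \<in> F" using p'(1) pq(2) M(2) by (auto simp: accepted_def)
        moreover have "factor c' i' j \<in> language {c'}" by (rule factor_in_language) simp
        ultimately show False using c' by (auto simp: S avoiding_def)
      qed
    qed
    then show ?thesis using conf by (auto simp: S avoiding_def)
  qed
  define TT where "TT w = {T c | c. c \<in> \<Sigma> \<and> (\<forall>k<length w. c (int k - int (length w)) = w ! k)}" for w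
  have sub: "follower (language \<Sigma>) w \<subseteq> follower (language \<Sigma>) w'" if "TT w = TT w'" for w w'
  proof
    fix v assume "v \<in> follower (language \<Sigma>) w"
    then have "w @ v \<in> language \<Sigma>" by (simp add: follower_def)
    then obtain c i where c: "c \<in> \<Sigma>" "\<forall>k<length (w @ v). c (i + int k) = (w @ v) ! k"
      unfolding language_iff by blast
    define d where "d = (\<lambda>z. c (z + (i + int (length w))))"
    have d: "d \<in> \<Sigma>" using c(1) avoiding_shift unfolding d_def S by blast
    have "\<forall>k<length w. d (int k - int (length w)) = w ! k"
      using c(2) by (auto simp: d_def nth_append algebra_simps)
    then have "T d \<in> TT w" using d by (auto simp: TT_def)
    then have "T d \<in> TT w'" using that by simp
    then have "\<exists>c'. T d = T c' \<and> c' \<in> \<Sigma> \<and> (\<forall>k<length w'. c' (int k - int (length w')) = w' ! k)"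
      unfolding TT_def mem_Collect_eq .
    then obtain c' where c'0: "T d = T c' \<and> c' \<in> \<Sigma> \<and> (\<forall>k<length w'. c' (int k - int (length w')) = w' ! k)" ..
    then have c': "c' \<in> \<Sigma>" "\<forall>k<length w'. c' (int k - int (length w')) = w' ! k"
      and eq: "T c' = T d"
      by auto
    have dv: "d (int k) = v ! k" if "k < length v" for k
      using c(2)[rule_format, of "length w + k"] that by (simp add: d_def nth_append algebra_simps)
    let ?s = "\<lambda>z. if z < 0 then c' z else d z"
    have s: "?s \<in> \<Sigma>" using splice[OF c'(1) d eq] .
    have "\<forall>k<length (w' @ v). ?s (- int (length w') + int k) = (w' @ v) ! k"
    proof (intro allI impI)
      fix k assume k: "k < length (w' @ v)"
      show "?s (- int (length w') + int k) = (w' @ v) ! k"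
      proof (cases "k < length w'")
        case True
        then show ?thesis using c'(2) by (simp add: nth_append algebra_simps)
      next
        case False
        then show ?thesis using dv[of "k - length w'"] k by (simp add: nth_append of_nat_diff algebra_simps)
      qed
    qed
    then have "w' @ v \<in> language \<Sigma>"
      unfolding language_iff by (intro bexI[OF _ s] exI)
    then show "v \<in> follower (language \<Sigma>) w'" by (simp add: follower_def)
  qed
  define h where "h t = follower (language \<Sigma>) (SOME w. TT w = t)" for t
  have "follower (language \<Sigma>) w = h (TT w)" for w
  proof -
    have "TT (SOME w'. TT w' = TT w) = TT w" by (rule someI) simp
    then show ?thesis unfolding h_def using sub by (metis subset_antisym)
  qed
  then have "range (follower (language \<Sigma>)) \<subseteq> h ` Pow (Pow (states M))"
    by (auto simp: TT_def T_def)
  moreover have "finite (states M)" using M(1) by (simp add: finite_automaton_def)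
  ultimately show ?thesis by (meson finite_Pow_iff finite_imageI finite_subset)
qed

section \<open>Labelled graphs presenting a language\<close>

type_synonym ('s, 'a) edge = "'s \<times> 'a \<times> 's"

abbreviation src :: "('s, 'a) edge \<Rightarrow> 's" where "src \<equiv> fst"
abbreviation lab :: "('s, 'a) edge \<Rightarrow> 'a" where "lab e \<equiv> fst (snd e)"
abbreviation tgt :: "('s, 'a) edge \<Rightarrow> 's" where "tgt e \<equiv> snd (snd e)"

primrec walk :: "('s, 'a) edge set \<Rightarrow> 's \<Rightarrow> ('s, 'a) edge list \<Rightarrow> 's \<Rightarrow> bool" where
  "walk E s [] t \<longleftrightarrow> s = t"
| "walk E s (e # es) t \<longleftrightarrow> e \<in> E \<and> src e = s \<and> walk E (tgt e) es t"

lemma walk_append: "walk E s (es @ fs) t \<longleftrightarrow> (\<exists>r. walk E s es r \<and> walk E r fs t)"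
  by (induction es arbitrary: s) auto

text \<open>Asking for nonempty walks in \<open>connected\<close> also gives every vertex an
  incoming and an outgoing edge, so that particles of both kinds can always move on.\<close>

locale presentation =
  fixes V :: "'s set" and E :: "('s, 'a) edge set" and Q :: "'a set" and L :: "'a list set"
  assumes finite_V: "finite V" and V_nonempty: "V \<noteq> {}"
    and E_subset: "E \<subseteq> V \<times> Q \<times> V" and finite_Q: "finite Q"
    and connected: "s \<in> V \<Longrightarrow> t \<in> V \<Longrightarrow> \<exists>es. es \<noteq> [] \<and> walk E s es t"
    and walk_label: "s \<in> V \<Longrightarrow> walk E s es t \<Longrightarrow> map lab es \<in> L"
    and label_walk: "u \<in> L \<Longrightarrow> \<exists>s\<in>V. \<exists>es t. walk E s es t \<and> map lab es = u"

lemma sofic_presentation: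
  fixes Q :: "'a set"
  assumes "finite Q" "sofic Q \<Sigma>" "transitive_subshift \<Sigma>" "\<Sigma> \<noteq> {}"
  shows "\<exists>(V :: 'a list set set) E. presentation V E Q (language \<Sigma>)"
proof -
  let ?L = "language \<Sigma>" and ?F = "follower (language \<Sigma>)"
  have fin: "finite (range ?F)" using assms(2) by (rule finite_followers)
  have conf: "\<Sigma> \<subseteq> configs Q" using assms(2) by (auto simp: sofic_def avoiding_def)
  have nil: "[] \<in> ?L" using assms(4) by (auto simp: language_iff)
  then have "?F ` ?L \<noteq> {}" by blast
  moreover have "finite (?F ` ?L)" by (rule finite_subset[OF _ fin]) auto
  ultimately obtain m where "m \<in> ?F ` ?L" "\<forall>b\<in>?F ` ?L. b \<le> m \<longrightarrow> m = b"
    using finite_has_minimal[of "?F ` ?L"] by blast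
  then obtain w0 where w0: "w0 \<in> ?L" and min: "\<And>w. w \<in> ?L \<Longrightarrow> ?F w \<subseteq> ?F w0 \<Longrightarrow> ?F w = ?F w0"
    by blast
  have F_append: "?F (w @ v) = {x. v @ x \<in> ?F w}" for w v by (simp add: follower_def)
  (* By minimality of the follower set of w0, any word leading from w0 back to w0 returns to the same
     vertex; this gives strong connectedness. *)
  define V where "V = {?F (w0 @ v) | v. w0 @ v \<in> ?L}"
  define E where "E = {(?F (w0 @ v), a, ?F (w0 @ v @ [a])) | v a. w0 @ v @ [a] \<in> ?L}"
  have QL: "set u \<subseteq> Q" if "u \<in> ?L" for u
  proof -
    from that obtain c i where c: "c \<in> \<Sigma>" "\<forall>k<length u. c (i + int k) = u ! k"
      unfolding language_iff by blast
    have "c z \<in> Q" for z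
      using conf c(1) by (auto simp: configs_def PiE_iff)
    have "u ! k \<in> Q" if k: "k < length u" for k
      using c(2)[rule_format, OF k] \<open>c (i + int k) \<in> Q\<close> by simp
    then show ?thesis by (auto simp: in_set_conv_nth)
  qed
  have EV: "E \<subseteq> V \<times> Q \<times> V"
  proof
    fix e assume "e \<in> E"
    then obtain v a where e: "e = (?F (w0 @ v), a, ?F (w0 @ v @ [a]))" "w0 @ v @ [a] \<in> ?L"
      by (auto simp: E_def)
    then have "w0 @ v \<in> ?L" using language_append(1)[of "w0 @ v" "[a]"] by simp
    then show "e \<in> V \<times> Q \<times> V" using e QL[OF e(2)] by (auto simp: V_def)
  qed
  have mk: "\<exists>es. length es = length x \<and> map lab es = x \<and> walk E (?F (w0 @ v)) es (?F (w0 @ v @ x))"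
    if "w0 @ v @ x \<in> ?L" for v x
    using that
  proof (induction x arbitrary: v)
    case (Cons a x)
    then have "w0 @ (v @ [a]) @ x \<in> ?L" by simp
    from Cons.IH[OF this] obtain es where es: "length es = length x" "map lab es = x"
      "walk E (?F (w0 @ v @ [a])) es (?F (w0 @ (v @ [a]) @ x))" by auto
    have "w0 @ v @ [a] \<in> ?L" using language_append(1)[of "w0 @ v @ [a]" x] Cons.prems by simp
    then have "(?F (w0 @ v), a, ?F (w0 @ v @ [a])) \<in> E" by (auto simp: E_def)
    then show ?case using es
      by (intro exI[of _ "(?F (w0 @ v), a, ?F (w0 @ v @ [a])) # es"]) auto
  qed auto
  have conn: "\<exists>es. es \<noteq> [] \<and> walk E s es t" if s: "s \<in> V" and t: "t \<in> V" for s t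
  proof -
    from s t obtain v v' where v: "s = ?F (w0 @ v)" "w0 @ v \<in> ?L" "t = ?F (w0 @ v')" "w0 @ v' \<in> ?L"
      by (auto simp: V_def)
    have ext: "\<exists>a. w @ [a] \<in> ?L" if "w \<in> ?L" for w
    proof -
      from that obtain c i where c: "c \<in> \<Sigma>" "\<forall>k<length w. c (i + int k) = w ! k"
        unfolding language_iff by blast
      then have "\<forall>k<length (w @ [c (i + int (length w))]).
          c (i + int k) = (w @ [c (i + int (length w))]) ! k"
        by (auto simp: nth_append less_Suc_eq)
      then show ?thesis using c(1) unfolding language_iff by blast
    qed
    \<comment> \<open>The extra letter makes the walk nonempty; \<open>z\<close>, \<open>w0\<close>
      and \<open>v'\<close> may all be empty.\<close>
    obtain a where a: "(w0 @ v) @ [a] \<in> ?L" using ext v(2) by blast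
    obtain z where z: "((w0 @ v) @ [a]) @ z @ w0 @ v' \<in> ?L"
      using assms(3) a v(4) unfolding transitive_subshift_def by blast
    let ?x = "a # z @ w0 @ v'"
    have zz: "w0 @ v @ ?x \<in> ?L" using z by simp
    have "(w0 @ v @ a # z @ w0) \<in> ?L" using language_append(1)[of "w0 @ v @ a # z @ w0" v'] zz by simp
    moreover have "?F (w0 @ v @ a # z @ w0) \<subseteq> ?F w0"
      using language_append(2)[of "w0 @ v @ a # z" _ \<Sigma>] by (auto simp: follower_def)
    ultimately have "?F (w0 @ v @ a # z @ w0) = ?F w0" by (rule min)
    then have "?F (w0 @ v @ ?x) = t" using F_append[of "w0 @ v @ a # z @ w0" v'] F_append[of w0 v'] v
      by simp
    moreover obtain es where "length es = length ?x" "walk E s es (?F (w0 @ v @ ?x))"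
      using mk[OF zz] v by auto
    ultimately show ?thesis by (intro exI[of _ es]) auto
  qed
  \<comment> \<open>A vertex is itself a set of words, those that may follow; passing an edge strips
    its label from their front.\<close>
  have lab_follow: "map lab es \<in> s" if "s \<in> V" "walk E s es t" for s es t
    using that
  proof (induction es arbitrary: s)
    case Nil
    then show ?case by (auto simp: V_def follower_def)
  next
    case (Cons e es)
    then have e: "e \<in> E" "src e = s" "walk E (tgt e) es t" by auto
    then obtain v a where va: "e = (?F (w0 @ v), a, ?F (w0 @ v @ [a]))" by (auto simp: E_def)
    have "map lab es \<in> tgt e" using Cons.IH e EV by auto
    then show ?case using va e by (auto simp: follower_def)
  qed
  have "presentation V E Q ?L"
  proof
    show "finite V" by (rule finite_subset[OF _ fin]) (auto simp: V_def)
    show "V \<noteq> {}" using w0 by (auto simp: V_def intro!: exI[of _ "[]"])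
    show "E \<subseteq> V \<times> Q \<times> V" by (rule EV)
    show "finite Q" by fact
    show "\<exists>es. es \<noteq> [] \<and> walk E s es t" if "s \<in> V" "t \<in> V" for s t
      using conn that by blast
    show "map lab es \<in> ?L" if "s \<in> V" "walk E s es t" for s es t
    proof -
      have "map lab es \<in> s" using lab_follow that by blast
      moreover obtain v where "s = ?F (w0 @ v)" using \<open>s \<in> V\<close> by (auto simp: V_def)
      ultimately show ?thesis using language_append(2)[of "w0 @ v" "map lab es"]
        by (simp add: follower_def)
    qed
    show "\<exists>s\<in>V. \<exists>es t. walk E s es t \<and> map lab es = u" if u: "u \<in> ?L" for u
    proof -
      obtain z where z: "w0 @ z @ u \<in> ?L"
        using assms(3) w0 u unfolding transitive_subshift_def by blast
      then have "?F (w0 @ z) \<in> V" using language_append(1)[of "w0 @ z" u] by (auto simp: V_def)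
      with mk[OF z] show ?thesis by blast
    qed
  qed
  then show ?thesis by blast
qed

section \<open>Events depending on finitely many cells\<close>

definition depends_on :: "int set \<Rightarrow> ((int \<Rightarrow> 'a) \<Rightarrow> bool) \<Rightarrow> bool" where
  "depends_on I P \<longleftrightarrow> (\<forall>c c'. (\<forall>z\<in>I. c z = c' z) \<longrightarrow> P c = P c')"

lemma depends_onD: "depends_on I P \<Longrightarrow> (\<And>z. z \<in> I \<Longrightarrow> c z = c' z) \<Longrightarrow> P c = P c'"
  by (simp add: depends_on_def)

text \<open>Locality replaces measurability throughout: on a finite window the Bernoulli measure is
  a normalised count.\<close>

definition loc :: "((int \<Rightarrow> 'a) \<Rightarrow> bool) \<Rightarrow> bool" where
  "loc P \<longleftrightarrow> (\<exists>I. finite I \<and> depends_on I P)"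

lemma depends_on_loc: "finite I \<Longrightarrow> depends_on I P \<Longrightarrow> loc P"
  unfolding loc_def by (intro exI[of _ I] conjI)

lemma locI: "finite I \<Longrightarrow> (\<And>c c'. (\<And>z. z \<in> I \<Longrightarrow> c z = c' z) \<Longrightarrow> P c \<Longrightarrow> P c') \<Longrightarrow> loc P"
  unfolding loc_def depends_on_def by (intro exI[of _ I] conjI allI impI iffI) auto

lemma loc_not: "loc P \<Longrightarrow> loc (\<lambda>c. \<not> P c)"
  by (simp add: loc_def depends_on_def)

lemma loc_conj:
  assumes "loc P" "loc R"
  shows "loc (\<lambda>c. P c \<and> R c)"
proof -
  from assms obtain I J where "finite I" "depends_on I P" "finite J" "depends_on J R"
    unfolding loc_def by blast
  moreover have "depends_on (I \<union> J) (\<lambda>c. P c \<and> R c)"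
    using \<open>depends_on I P\<close> \<open>depends_on J R\<close> unfolding depends_on_def by (metis UnCI)
  moreover have "finite (I \<union> J)" using \<open>finite I\<close> \<open>finite J\<close> by simp
  ultimately show ?thesis by (intro depends_on_loc)
qed

lemma loc_disj: "loc P \<Longrightarrow> loc R \<Longrightarrow> loc (\<lambda>c. P c \<or> R c)"
  using loc_not[OF loc_conj[OF loc_not loc_not, of P R]] by simp

lemma loc_const: "loc (\<lambda>c. B)"
  by (rule locI[of "{}"]) auto

lemma loc_imp: "loc P \<Longrightarrow> loc R \<Longrightarrow> loc (\<lambda>c. P c \<longrightarrow> R c)"
  unfolding imp_conv_disj by (intro loc_disj loc_not)

lemma loc_ball:
  assumes "finite S" "\<And>s. s \<in> S \<Longrightarrow> loc (P s)"
  shows "loc (\<lambda>c. \<forall>s\<in>S. P s c)"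
  using assms by (induction S rule: finite_induct) (simp_all add: loc_conj loc_const)

lemma loc_bex:
  assumes "finite S" "\<And>s. s \<in> S \<Longrightarrow> loc (P s)"
  shows "loc (\<lambda>c. \<exists>s\<in>S. P s c)"
  using loc_not[OF loc_ball[OF assms(1), of "\<lambda>s c. \<not> P s c", OF loc_not[OF assms(2)]]] by simp

lemma loc_comp:
  assumes "loc P"
  shows "loc (\<lambda>c. P (\<lambda>z. \<tau> (c (\<sigma> z))))"
proof -
  from assms obtain I where I: "finite I" "depends_on I P" unfolding loc_def by blast
  have "depends_on (\<sigma> ` I) (\<lambda>c. P (\<lambda>z. \<tau> (c (\<sigma> z))))"
    unfolding depends_on_def by (intro allI impI depends_onD[OF I(2)]) simp
  with I(1) show ?thesis by (intro depends_on_loc) simp_all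
qed

lemmas loc_intros = loc_not loc_conj loc_disj loc_const loc_imp loc_ball loc_bex

lemma loc_shift: "loc P \<Longrightarrow> loc (\<lambda>c. P (\<lambda>z. c (z + d)))"
  using loc_comp[of P "\<lambda>x. x" "\<lambda>z. z + d"] by simp

section \<open>Probabilities of local events\<close>

locale finite_alphabet =
  fixes A :: "'a set"
  assumes fin_A: "finite A" and A_ne: "A \<noteq> {}"
begin

definition Pr :: "((int \<Rightarrow> 'a) \<Rightarrow> bool) \<Rightarrow> real" where
  "Pr P = measure (bernoulli A) {c \<in> configs A. P c}"

lemma prob_space_bernoulli: "prob_space (bernoulli A)"
proof -
  interpret U: prob_space "uniform_count_measure A"
    using fin_A A_ne by (intro prob_space_uniform_count_measure)
  interpret product_prob_space "\<lambda>_::int. uniform_count_measure A" UNIV ..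
  show ?thesis unfolding bernoulli_def by (rule prob_space_axioms)
qed

lemma configs_window:
  assumes "depends_on I P"
  shows "{c \<in> configs A. P c} = (\<Union>f\<in>{f \<in> I \<rightarrow>\<^sub>E A. P f}.
    prod_emb UNIV (\<lambda>_. uniform_count_measure A) I (\<Pi>\<^sub>E z\<in>I. {f z}))" (is "?L = ?R")
proof (intro set_eqI iffI)
  fix c assume c: "c \<in> ?L"
  then have "P (restrict c I) = P c" by (intro depends_onD[OF assms]) auto
  then have "restrict c I \<in> {f \<in> I \<rightarrow>\<^sub>E A. P f}" using c by (auto simp: configs_def)
  moreover have "c \<in> prod_emb UNIV (\<lambda>_. uniform_count_measure A) I (\<Pi>\<^sub>E z\<in>I. {restrict c I z})"
    using c by (auto simp: prod_emb_def configs_def space_uniform_count_measure)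
  ultimately show "c \<in> ?R" by blast
next
  fix c assume "c \<in> ?R"
  then obtain f where f: "f \<in> I \<rightarrow>\<^sub>E A" "P f"
    and c: "c \<in> prod_emb UNIV (\<lambda>_. uniform_count_measure A) I (\<Pi>\<^sub>E z\<in>I. {f z})" by blast
  have "c z = f z" if "z \<in> I" for z
    using c that by (auto simp: prod_emb_def PiE_iff)
  then have "P c = P f" by (intro depends_onD[OF assms])
  then show "c \<in> ?L" using c f by (auto simp: prod_emb_def configs_def space_uniform_count_measure)
qed

text \<open>The event is a disjoint union of cylinders of equal measure, one for each admissible
  content of the window.\<close>

lemma window_measure:
  assumes I: "finite I" and dep: "depends_on I P"
  shows sets_window: "{c \<in> configs A. P c} \<in> sets (bernoulli A)"
    and Pr_window: "Pr P = card {f \<in> I \<rightarrow>\<^sub>E A. P f} / card A ^ card I"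
proof -
  let ?X = "{f \<in> I \<rightarrow>\<^sub>E A. P f}"
  let ?B = "\<lambda>f. prod_emb UNIV (\<lambda>_. uniform_count_measure A) I (\<Pi>\<^sub>E z\<in>I. {f z})"
  interpret U: prob_space "uniform_count_measure A"
    using fin_A A_ne by (intro prob_space_uniform_count_measure)
  interpret product_prob_space "\<lambda>_::int. uniform_count_measure A" UNIV ..
  have fX: "finite ?X" using I fin_A by (auto intro!: finite_subset[OF _ finite_PiE[of I "\<lambda>_. A"]])
  have sB: "?B f \<in> sets (bernoulli A)" if "f \<in> ?X" for f
    unfolding bernoulli_def using that I
    by (intro sets_PiM_I) (auto simp: sets_uniform_count_measure PiE_iff)
  have mB: "measure (bernoulli A) (?B f) = 1 / card A ^ card I" if "f \<in> ?X" for f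
  proof -
    have "measure (bernoulli A) (?B f) = (\<Prod>z\<in>I. measure (uniform_count_measure A) {f z})"
      unfolding bernoulli_def
      by (rule measure_PiM_emb) (use that I in \<open>auto simp: sets_uniform_count_measure PiE_iff\<close>)
    also have "\<dots> = (\<Prod>z\<in>I. 1 / real (card A))"
      using that fin_A by (intro prod.cong) (auto simp: measure_uniform_count_measure PiE_iff)
    finally show ?thesis by (simp add: power_divide)
  qed
  show "{c \<in> configs A. P c} \<in> sets (bernoulli A)"
    unfolding configs_window[OF dep] by (intro sets.finite_UN fX sB)
  have disj: "disjoint_family_on ?B ?X"
    unfolding disjoint_family_on_def
  proof (intro ballI impI)
    fix f g assume fg: "f \<in> ?X" "g \<in> ?X" "f \<noteq> g"
    then obtain z where "z \<in> I" "f z \<noteq> g z" by (auto simp: PiE_iff extensional_def fun_eq_iff) metis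
    then show "?B f \<inter> ?B g = {}" by (auto simp: prod_emb_def PiE_iff)
  qed
  have "Pr P = (\<Sum>f\<in>?X. measure (bernoulli A) (?B f))"
    unfolding Pr_def configs_window[OF dep] bernoulli_def
    by (rule finite_measure_finite_Union[OF fX _ disj]) (use sB in \<open>auto simp: bernoulli_def\<close>)
  also have "\<dots> = card ?X * (1 / card A ^ card I)"
    using mB by simp
  finally show "Pr P = card ?X / card A ^ card I" by simp
qed

lemma loc_sets: "loc P \<Longrightarrow> {c \<in> configs A. P c} \<in> sets (bernoulli A)"
  unfolding loc_def using sets_window by blast

lemma Pr_nonneg: "0 \<le> Pr P" by (simp add: Pr_def)

lemma Pr_le_1: "Pr P \<le> 1"
  unfolding Pr_def by (rule prob_space.prob_le_1[OF prob_space_bernoulli])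

lemma Pr_mono:
  assumes "loc R" "\<And>c. c \<in> configs A \<Longrightarrow> P c \<Longrightarrow> R c"
  shows "Pr P \<le> Pr R"
proof -
  interpret prob_space "bernoulli A" by (rule prob_space_bernoulli)
  show ?thesis unfolding Pr_def
    by (rule finite_measure_mono) (use assms loc_sets in auto)
qed

lemma Pr_cong: "(\<And>c. c \<in> configs A \<Longrightarrow> P c = R c) \<Longrightarrow> Pr P = Pr R"
  unfolding Pr_def by (rule arg_cong[where f = "measure _"]) auto

lemma Pr_const: "Pr (\<lambda>c. B) = (if B then 1 else 0)"
  using prob_space.prob_space[OF prob_space_bernoulli]
  by (simp add: Pr_def space_bernoulli)

lemma Pr_disj_le:
  assumes "loc P" "loc R"
  shows "Pr (\<lambda>c. P c \<or> R c) \<le> Pr P + Pr R"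
proof -
  interpret prob_space "bernoulli A" by (rule prob_space_bernoulli)
  have "{c \<in> configs A. P c \<or> R c} = {c \<in> configs A. P c} \<union> {c \<in> configs A. R c}" by auto
  then show ?thesis unfolding Pr_def
    using measure_Un_le[OF loc_sets[OF assms(1)] loc_sets[OF assms(2)]] by simp
qed

lemma Pr_bex_le:
  assumes "finite S" "\<And>s. s \<in> S \<Longrightarrow> loc (P s)"
  shows "Pr (\<lambda>c. \<exists>s\<in>S. P s c) \<le> (\<Sum>s\<in>S. Pr (P s))"
  using assms
proof (induction S rule: finite_induct)
  case empty
  then show ?case using Pr_const[of False] by simp
next
  case (insert s S)
  have "Pr (\<lambda>c. \<exists>s'\<in>insert s S. P s' c) \<le> Pr (P s) + Pr (\<lambda>c. \<exists>s'\<in>S. P s' c)"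
    using Pr_disj_le[of "P s" "\<lambda>c. \<exists>s'\<in>S. P s' c"] loc_bex[of S P] insert by simp
  then show ?case using insert by fastforce
qed

lemma Pr_bex_disjoint:
  assumes "finite S" "\<And>s. s \<in> S \<Longrightarrow> loc (P s)"
    and "\<And>s t c. s \<in> S \<Longrightarrow> t \<in> S \<Longrightarrow> s \<noteq> t \<Longrightarrow> c \<in> configs A \<Longrightarrow> P s c \<Longrightarrow> P t c \<Longrightarrow> False"
  shows "Pr (\<lambda>c. \<exists>s\<in>S. P s c) = (\<Sum>s\<in>S. Pr (P s))"
proof -
  interpret prob_space "bernoulli A" by (rule prob_space_bernoulli)
  have "{c \<in> configs A. \<exists>s\<in>S. P s c} = (\<Union>s\<in>S. {c \<in> configs A. P s c})" by auto
  moreover have "disjoint_family_on (\<lambda>s. {c \<in> configs A. P s c}) S"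
    unfolding disjoint_family_on_def using assms(3) by blast
  ultimately show ?thesis unfolding Pr_def
    using finite_measure_finite_Union[OF assms(1), of "\<lambda>s. {c \<in> configs A. P s c}"] assms(2) loc_sets
    by (simp add: image_subset_iff)
qed

lemma Pr_diff:
  assumes "loc P" "loc R" "\<And>c. c \<in> configs A \<Longrightarrow> R c \<Longrightarrow> P c"
  shows "Pr (\<lambda>c. P c \<and> \<not> R c) = Pr P - Pr R"
proof -
  interpret prob_space "bernoulli A" by (rule prob_space_bernoulli)
  have "{c \<in> configs A. P c \<and> \<not> R c} = {c \<in> configs A. P c} - {c \<in> configs A. R c}" by auto
  then show ?thesis unfolding Pr_def
    using finite_measure_Diff[OF loc_sets[OF assms(1)] loc_sets[OF assms(2)]] assms(3) by auto
qed

text \<open>Windows of \<open>P\<close> correspond bijectively to windows in which \<open>G\<close>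
  is prescribed and the remaining cells are moved by \<sigma> and relabelled by \<tau>. For empty
  \<open>G\<close> this is invariance under shifts and reflections; for nonempty \<open>G\<close> it
  says that inserting cells costs a factor that depends on their number alone.\<close>

lemma Pr_insert:
  assumes "loc P" "inj \<sigma>" "bij_betw \<tau> A A" "finite G" "range \<sigma> \<inter> G = {}" "g \<in> G \<rightarrow> A"
  shows "Pr (\<lambda>c. P (\<lambda>z. \<tau> (c (\<sigma> z))) \<and> (\<forall>z\<in>G. c z = g z)) = Pr P / card A ^ card G"
proof -
  from assms(1) obtain I where I: "finite I" "depends_on I P" unfolding loc_def by blast
  let ?R = "\<lambda>c. P (\<lambda>z. \<tau> (c (\<sigma> z))) \<and> (\<forall>z\<in>G. c z = g z)"
  let ?J = "\<sigma> ` I \<union> G"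
  have J: "finite ?J" using I assms(4) by simp
  have "P (\<lambda>z. \<tau> (c (\<sigma> z))) = P (\<lambda>z. \<tau> (c' (\<sigma> z)))" if "\<forall>z\<in>?J. c z = c' z" for c c'
    using that by (intro depends_onD[OF I(2)]) auto
  then have dep: "depends_on ?J ?R" unfolding depends_on_def by auto
  let ?X = "{f \<in> I \<rightarrow>\<^sub>E A. P f}" and ?Y = "{f \<in> ?J \<rightarrow>\<^sub>E A. ?R f}"
  let ?\<tau>' = "inv_into A \<tau>"
  let ?up = "\<lambda>f. \<lambda>y\<in>?J. if y \<in> G then g y else ?\<tau>' (f (inv \<sigma> y))"
  let ?down = "\<lambda>f. \<lambda>z\<in>I. \<tau> (f (\<sigma> z))"
  have \<tau>A: "\<tau> a \<in> A" if "a \<in> A" for a using assms(3) that by (auto simp: bij_betw_def)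
  have \<tau>'A: "?\<tau>' a \<in> A" if "a \<in> A" for a
    using assms(3) that by (metis bij_betw_def inv_into_into)
  have \<tau>\<tau>': "\<tau> (?\<tau>' a) = a" if "a \<in> A" for a
    using assms(3) that by (simp add: bij_betw_inv_into_right)
  have \<tau>'\<tau>: "?\<tau>' (\<tau> a) = a" if "a \<in> A" for a
    using assms(3) that by (simp add: bij_betw_inv_into_left)
  have notG: "\<sigma> z \<notin> G" for z using assms(5) by auto
  have "bij_betw ?up ?X ?Y"
  proof (rule bij_betw_byWitness[where f' = ?down])
    show "\<forall>f\<in>?X. ?down (?up f) = f"
    proof
      fix f assume f: "f \<in> ?X"
      show "?down (?up f) = f"
        by (rule ext) (use f assms(2) notG in \<open>auto simp: \<tau>\<tau>' PiE_iff extensional_def restrict_def\<close>)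
    qed
    show "\<forall>f\<in>?Y. ?up (?down f) = f"
    proof
      fix f assume f: "f \<in> ?Y"
      show "?up (?down f) = f"
        by (rule ext) (use f assms(2) notG in \<open>auto simp: \<tau>'\<tau> PiE_iff extensional_def restrict_def\<close>)
    qed
    show "?up ` ?X \<subseteq> ?Y"
    proof
      fix h assume "h \<in> ?up ` ?X"
      then obtain f where f: "f \<in> ?X" and h: "h = ?up f" by blast
      have "P (\<lambda>z. \<tau> (?up f (\<sigma> z))) = P f"
        by (rule depends_onD[OF I(2)]) (use f assms(2) notG in \<open>auto simp: \<tau>\<tau>' PiE_iff\<close>)
      then show "h \<in> ?Y" using f h assms(2,6) notG
        by (auto simp: PiE_iff extensional_def Pi_iff intro!: \<tau>'A)
    qed
    show "?down ` ?Y \<subseteq> ?X"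
    proof
      fix h assume "h \<in> ?down ` ?Y"
      then obtain f where f: "f \<in> ?Y" and h: "h = ?down f" by blast
      have "P (?down f) = P (\<lambda>z. \<tau> (f (\<sigma> z)))"
        by (rule depends_onD[OF I(2)]) auto
      then show "h \<in> ?X" using f h by (auto simp: PiE_iff \<tau>A)
    qed
  qed
  then have "card ?X = card ?Y" by (rule bij_betw_same_card)
  moreover have "card ?J = card I + card G"
    using I assms(2,4,5) by (subst card_Un_disjoint) (auto simp: card_image inj_on_subset)
  ultimately show ?thesis
    using Pr_window[OF I] Pr_window[OF J dep] by (simp add: power_add)
qed

lemma Pr_comp:
  assumes "loc P" "inj \<sigma>" "bij_betw \<tau> A A"
  shows "Pr (\<lambda>c. P (\<lambda>z. \<tau> (c (\<sigma> z)))) = Pr P"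
  using Pr_insert[of P \<sigma> \<tau> "{}"] assms by simp

lemma Pr_shift: "loc P \<Longrightarrow> Pr (\<lambda>c. P (\<lambda>z. c (z + d))) = Pr P"
  using Pr_comp[of P "\<lambda>z. z + d" "\<lambda>x. x"] by (simp add: inj_def bij_betw_def)

lemma Pr_indep:
  assumes "finite I" "depends_on I P" "finite J" "depends_on J R" "I \<inter> J = {}"
  shows "Pr (\<lambda>c. P c \<and> R c) = Pr P * Pr R"
proof -
  have dep: "depends_on (I \<union> J) (\<lambda>c. P c \<and> R c)"
    using assms(2,4) unfolding depends_on_def by (metis UnCI)
  let ?X = "{f \<in> I \<rightarrow>\<^sub>E A. P f}" and ?Y = "{f \<in> J \<rightarrow>\<^sub>E A. R f}"
  let ?Z = "{f \<in> (I \<union> J) \<rightarrow>\<^sub>E A. P f \<and> R f}"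
  let ?up = "\<lambda>(f, g). \<lambda>z\<in>I \<union> J. if z \<in> I then f z else g z"
  let ?down = "\<lambda>f. (restrict f I, restrict f J)"
  have notI: "z \<notin> I" if "z \<in> J" for z using assms(5) that by auto
  have "bij_betw ?down ?Z (?X \<times> ?Y)"
  proof (rule bij_betw_byWitness[where f' = ?up])
    show "\<forall>f\<in>?Z. ?up (?down f) = f"
    proof
      fix f assume f: "f \<in> ?Z"
      show "?up (?down f) = f"
        by (rule ext) (use f in \<open>auto simp: PiE_iff extensional_def\<close>)
    qed
    show "\<forall>p\<in>?X \<times> ?Y. ?down (?up p) = p"
    proof
      fix p assume p: "p \<in> ?X \<times> ?Y"
      show "?down (?up p) = p"
        by (cases p) (use p notI in \<open>auto simp: PiE_iff extensional_def fun_eq_iff\<close>)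
    qed
    show "?down ` ?Z \<subseteq> ?X \<times> ?Y"
    proof
      fix p assume "p \<in> ?down ` ?Z"
      then obtain f where f: "f \<in> ?Z" and p: "p = ?down f" by blast
      have "P (restrict f I) = P f" "R (restrict f J) = R f"
        by (auto intro!: depends_onD[OF assms(2)] depends_onD[OF assms(4)])
      then show "p \<in> ?X \<times> ?Y" using f p by (auto simp: PiE_iff)
    qed
    show "?up ` (?X \<times> ?Y) \<subseteq> ?Z"
    proof
      fix h assume "h \<in> ?up ` (?X \<times> ?Y)"
      then obtain f g where fg: "f \<in> ?X" "g \<in> ?Y" and h: "h = ?up (f, g)" by blast
      have "P (?up (f, g)) = P f" "R (?up (f, g)) = R g"
        using notI by (auto intro!: depends_onD[OF assms(2)] depends_onD[OF assms(4)])
      then show "h \<in> ?Z" using fg h by (auto simp: PiE_iff)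
    qed
  qed
  from bij_betw_same_card[OF this] have "card ?Z = card ?X * card ?Y"
    by (simp only: card_cartesian_product)
  moreover have "card (I \<union> J) = card I + card J"
    using assms by (intro card_Un_disjoint)
  ultimately show ?thesis
    using Pr_window[OF assms(1,2)] Pr_window[OF assms(3,4)] Pr_window[OF _ dep] assms(1,3)
    by (simp add: power_add)
qed

end

section \<open>Ballistic annihilation\<close>

definition psum :: "(int \<Rightarrow> int) \<Rightarrow> int \<Rightarrow> int \<Rightarrow> int" where
  "psum f i j = (\<Sum>z\<in>{i..j}. f z)"

lemma psum_split: "i \<le> k + 1 \<Longrightarrow> k \<le> j \<Longrightarrow> psum f i j = psum f i k + psum f (k + 1) j"
proof -
  assume "i \<le> k + 1" "k \<le> j"
  then have "{i..j} = {i..k} \<union> {k + 1..j}" by auto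
  then show ?thesis unfolding psum_def by (simp add: sum.union_disjoint)
qed

lemma psum_empty: "j < i \<Longrightarrow> psum f i j = 0"
  by (simp add: psum_def)

lemma psum_one: "psum f i i = f i"
  by (simp add: psum_def)

lemma psum_first: "i \<le> j \<Longrightarrow> psum f i j = f i + psum f (i + 1) j"
  using psum_split[of i i j f] by (simp add: psum_one)

lemma psum_last: "i \<le> j \<Longrightarrow> psum f i j = psum f i (j - 1) + f j"
  using psum_split[of i "j - 1" j f] by (simp add: psum_one)

lemma psum_cong: "(\<And>z. i \<le> z \<Longrightarrow> z \<le> j \<Longrightarrow> f z = g z) \<Longrightarrow> psum f i j = psum g i j"
  unfolding psum_def by (intro sum.cong) auto

lemma psum_shift: "psum (\<lambda>z. f (z + d)) i j = psum f (i + d) (j + d)"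
  unfolding psum_def by (rule sum.reindex_bij_witness[of _ "\<lambda>z. z - d" "\<lambda>z. z + d"]) auto

lemma psum_reflect: "psum (\<lambda>z. - f (d - z)) i j = - psum f (d - j) (d - i)"
  unfolding psum_def sum_negf
  by (rule arg_cong[where f = uminus], rule sum.reindex_bij_witness[of _ "\<lambda>z. d - z" "\<lambda>z. d - z"]) auto

lemma psum_le_length: "(\<And>z. f z \<le> 1) \<Longrightarrow> i \<le> j + 1 \<Longrightarrow> psum f i j \<le> j - i + 1"
  unfolding psum_def using sum_bounded_above[of "{i..j}" f 1] by simp

lemma psum_ge_length: "(\<And>z. - 1 \<le> f z) \<Longrightarrow> i \<le> j + 1 \<Longrightarrow> - (j - i + 1) \<le> psum f i j"
  unfolding psum_def using sum_bounded_below[of "{i..j}" "-1" f] by simp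

text \<open>Charges \<open>1\<close> and \<open>-1\<close> are particles moving right and left at unit speed that annihilate when
  they meet: \<open>alive_right f x n\<close> (resp. \<open>alive_left f y n\<close>) says that the particle starting at \<open>x\<close> (resp. \<open>y\<close>)
  exists and is still alive at time \<open>n\<close>.\<close>

definition alive_right :: "(int \<Rightarrow> int) \<Rightarrow> int \<Rightarrow> nat \<Rightarrow> bool" where
  "alive_right f x n \<longleftrightarrow> (\<forall>j\<in>{x..x + 2 * int n}. 1 \<le> psum f x j)"

definition alive_left :: "(int \<Rightarrow> int) \<Rightarrow> int \<Rightarrow> nat \<Rightarrow> bool" where
  "alive_left f y n \<longleftrightarrow> (\<forall>i\<in>{y - 2 * int n..y}. psum f i y \<le> - 1)"

lemma alive_right_mono: "alive_right f x n \<Longrightarrow> m \<le> n \<Longrightarrow> alive_right f x m"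
  by (auto simp: alive_right_def)

lemma alive_left_mono: "alive_left f x n \<Longrightarrow> m \<le> n \<Longrightarrow> alive_left f x m"
  by (auto simp: alive_left_def)

lemma alive_left_reflect: "alive_left f y n \<longleftrightarrow> alive_right (\<lambda>z. - f (d - z)) (d - y) n"
proof
  assume L: "alive_left f y n"
  show "alive_right (\<lambda>z. - f (d - z)) (d - y) n"
    unfolding alive_right_def psum_reflect
  proof
    fix j assume "j \<in> {d - y..d - y + 2 * int n}"
    then show "1 \<le> - psum f (d - j) (d - (d - y))"
      using L[unfolded alive_left_def, rule_format, of "d - j"] by auto
  qed
next
  assume R: "alive_right (\<lambda>z. - f (d - z)) (d - y) n"
  show "alive_left f y n"
    unfolding alive_left_def
  proof
    fix i assume "i \<in> {y - 2 * int n..y}"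
    then show "psum f i y \<le> - 1"
      using R[unfolded alive_right_def psum_reflect, rule_format, of "d - i"] by auto
  qed
qed

text \<open>The total charge from \<open>x\<close> to \<open>y\<close> would have to be both
  positive and negative. So facing particles cannot both outlive their meeting, nor can they have
  passed each other.\<close>

lemma alive_right_AL_excl:
  assumes "alive_right f x n" "alive_left f y m" "x \<le> y" "y \<le> x + 2 * int n" "y - 2 * int m \<le> x"
  shows False
  using assms(1)[unfolded alive_right_def, rule_format, of y] assms(2)[unfolded alive_left_def, rule_format, of x] assms(3-)
  by auto

text \<open>The right-hand side is the local collision rule, so bracket matching is what the
  automaton computes. Particles starting \<open>2 * n + 1\<close> apart are adjacent after
  \<open>n\<close> steps. At distance \<open>2 * n + 2\<close> one cell is left between them; if the
  particle from \<open>x + 1\<close> occupies it, that one takes the collision.\<close>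

lemma alive_right_step:
  assumes f: "\<And>z. f z \<in> {-1, 0, 1}"
  shows "alive_right f x (Suc n) \<longleftrightarrow> alive_right f x n \<and> \<not> alive_left f (x + 2 * int n + 1) n \<and>
           \<not> (alive_left f (x + 2 * int n + 2) n \<and> \<not> alive_right f (x + 1) n)"
    (is "_ \<longleftrightarrow> _ \<and> \<not> alive_left f ?y1 n \<and> \<not> (alive_left f ?y2 n \<and> _)")
proof
  assume R: "alive_right f x (Suc n)"
  then have Rj: "1 \<le> psum f x j" if "x \<le> j" "j \<le> ?y2" for j using that by (auto simp: alive_right_def)
  have fx: "f x = 1" using Rj[of x] f[of x] by (auto simp: psum_one)
  have "\<not> alive_left f ?y1 n"
  proof
    assume "alive_left f ?y1 n"
    then have "psum f (x + 1) ?y1 \<le> - 1" by (auto simp: alive_left_def)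
    then show False using Rj[of ?y1] psum_first[of x ?y1 f] fx by auto
  qed
  moreover have "alive_right f (x + 1) n" if L: "alive_left f ?y2 n"
  proof -
    have Li: "psum f i ?y2 \<le> - 1" if "x + 2 \<le> i" "i \<le> ?y2" for i
      using L that by (auto simp: alive_left_def)
    show ?thesis
      unfolding alive_right_def
    proof (rule ballI, rule ccontr)
      fix j assume j: "j \<in> {x + 1..x + 1 + 2 * int n}" and "\<not> 1 \<le> psum f (x + 1) j"
      then have "psum f x j \<le> 1" using psum_first[of x j f] fx by auto
      moreover have "psum f x ?y2 = psum f x j + psum f (j + 1) ?y2" using j by (intro psum_split) auto
      moreover have "1 \<le> psum f x ?y2" by (rule Rj) auto
      moreover have "psum f (j + 1) ?y2 \<le> - 1" using j by (intro Li) auto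
      ultimately show False by linarith
    qed
  qed
  ultimately show "alive_right f x n \<and> \<not> alive_left f ?y1 n \<and> \<not> (alive_left f ?y2 n \<and> \<not> alive_right f (x + 1) n)"
    using alive_right_mono[OF R] by auto
next
  assume A: "alive_right f x n \<and> \<not> alive_left f ?y1 n \<and> \<not> (alive_left f ?y2 n \<and> \<not> alive_right f (x + 1) n)"
  have Rj: "1 \<le> psum f x j" if "x \<le> j" "j \<le> x + 2 * int n" for j using that A by (auto simp: alive_right_def)
  have fx: "f x = 1" using Rj[of x] f[of x] by (auto simp: psum_one)
  have y1: "1 \<le> psum f x ?y1"
  proof (rule ccontr)
    assume neg: "\<not> 1 \<le> psum f x ?y1"
    \<comment> \<open>When all shorter sums from \<open>x\<close> are at least 1 and the sum up to
      \<open>?y1\<close> is at most 0, every sum that ends in \<open>?y1\<close> and starts beyond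
      \<open>x\<close> is at most -1.\<close>
    have "alive_left f ?y1 n"
      unfolding alive_left_def
    proof
      fix i assume i: "i \<in> {?y1 - 2 * int n..?y1}"
      then have "psum f x ?y1 = psum f x (i - 1) + psum f i ?y1" using psum_split[of x "i - 1" ?y1 f] by auto
      moreover have "1 \<le> psum f x (i - 1)" using i by (intro Rj) auto
      ultimately show "psum f i ?y1 \<le> - 1" using neg by linarith
    qed
    then show False using A by blast
  qed
  have "1 \<le> psum f x ?y2"
  proof (rule ccontr)
    assume neg: "\<not> 1 \<le> psum f x ?y2"
    have "alive_left f ?y2 n"
      unfolding alive_left_def
    proof
      fix i assume i: "i \<in> {?y2 - 2 * int n..?y2}"
      then have "psum f x ?y2 = psum f x (i - 1) + psum f i ?y2" using psum_split[of x "i - 1" ?y2 f] by auto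
      moreover have "1 \<le> psum f x (i - 1)"
      proof (cases "i - 1 = ?y1")
        case True
        then show ?thesis using y1 by (simp only:)
      next
        case False
        then show ?thesis using i by (intro Rj) auto
      qed
      ultimately show "psum f i ?y2 \<le> - 1" using neg by linarith
    qed
    \<comment> \<open>The particle in between is a reserve: it raises the sum up to
      \<open>?y1\<close> to at least 2, and the charge at \<open>?y2\<close> takes away at most
      1.\<close>
    then have "alive_right f (x + 1) n" using A by blast
    then have "1 \<le> psum f (x + 1) ?y1" by (auto simp: alive_right_def)
    moreover have "psum f x ?y2 = psum f x ?y1 + f ?y2"
      using psum_last[of x ?y2 f] by (simp add: add.commute[of 1] add.assoc)
    moreover have "psum f x ?y1 = 1 + psum f (x + 1) ?y1" using psum_first[of x ?y1 f] fx by simp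
    moreover have "-1 \<le> f ?y2" using f[of ?y2] by auto
    ultimately show False using neg by linarith
  qed
  with Rj y1 show "alive_right f x (Suc n)"
    unfolding alive_right_def
  proof (intro ballI)
    fix j assume "j \<in> {x..x + 2 * int (Suc n)}"
    then consider "j = ?y2" | "j = ?y1" | "x \<le> j" "j \<le> x + 2 * int n" by fastforce
    then show "1 \<le> psum f x j" using Rj y1 \<open>1 \<le> psum f x ?y2\<close> by cases auto
  qed
qed

lemma alive_left_step:
  assumes f: "\<And>z. f z \<in> {-1, 0, 1}"
  shows "alive_left f y (Suc n) \<longleftrightarrow> alive_left f y n \<and> \<not> alive_right f (y - 2 * int n - 1) n \<and>
           \<not> (alive_right f (y - 2 * int n - 2) n \<and> \<not> alive_left f (y - 1) n)"
proof -
  let ?g = "\<lambda>z. - f (0 - z)"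
  have g: "?g z \<in> {-1, 0, 1}" for z using f[of "0 - z"] by auto
  have gL: "alive_left ?g z n = alive_right f (- z) n" for z n using alive_left_reflect[of ?g z n 0] by simp
  have gR: "alive_right ?g (- z) n = alive_left f z n" for z n using alive_left_reflect[of f z n 0] by simp
  have "alive_right ?g (- y) (Suc n) \<longleftrightarrow> alive_right ?g (- y) n \<and> \<not> alive_left ?g (- y + 2 * int n + 1) n \<and>
           \<not> (alive_left ?g (- y + 2 * int n + 2) n \<and> \<not> alive_right ?g (- y + 1) n)"
    by (rule alive_right_step[OF g])
  moreover have "- y + 1 = - (y - 1)" "- (- y + 2 * int n + 1) = y - 2 * int n - 1"
    "- (- y + 2 * int n + 2) = y - 2 * int n - 2" by auto
  ultimately show ?thesis unfolding gL gR by (simp only: gR)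
qed

text \<open>The particle that first makes the left partial sums exceed \<open>K\<close> races to the origin against the
  one that does so on the right.\<close>

lemma race:
  assumes f: "\<And>z. f z \<in> {-1, 0, 1}" and K: "int M + 1 \<le> K"
    and l: "\<exists>t\<le>n. K < psum f (- int t) (-1)" and r: "\<exists>t\<le>n. K < - psum f 0 (int t)"
  shows "\<exists>t. M < t \<and> t \<le> n \<and>
    (alive_right f (- int t) t \<or> alive_left f (int t) t \<or> (alive_right f (- int t) (t - 1) \<and> \<not> alive_right f (- int t) t))"
proof -
  define a where "a t = psum f (- int t) (-1)" for t
  define b where "b t = - psum f 0 (int t)" for t
  define ta where "ta = (LEAST t. K < a t)"
  define tb where "tb = (LEAST t. K < b t)"
  have f1: "f z \<le> 1" "-1 \<le> f z" for z using f[of z] by auto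
  have ta: "K < a ta" "ta \<le> n"
    using l LeastI[of "\<lambda>t. K < a t"] Least_le[of "\<lambda>t. K < a t"] unfolding ta_def a_def
    by (blast, meson le_trans)
  have tb: "K < b tb" "tb \<le> n"
    using r LeastI[of "\<lambda>t. K < b t"] Least_le[of "\<lambda>t. K < b t"] unfolding tb_def b_def
    by (blast, meson le_trans)
  have la: "a s \<le> K" if "s < ta" for s using not_less_Least[of s "\<lambda>t. K < a t"] that
    by (simp add: ta_def)
  have lb: "b s \<le> K" if "s < tb" for s using not_less_Least[of s "\<lambda>t. K < b t"] that
    by (simp add: tb_def)
  \<comment> \<open>Exceeding \<open>K\<close> needs many cells, which delays the crossing beyond
    time \<open>M\<close>. The sum \<open>b\<close> has one cell more, the origin, and for it
    \<open>K\<close> has to be at least \<open>M + 1\<close>.\<close>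
  have "a ta \<le> int ta" unfolding a_def using psum_le_length[of f "- int ta" "-1"] f1 by simp
  then have Mta: "M < ta" using ta K by linarith
  have "b tb \<le> int tb + 1" unfolding b_def using psum_ge_length[of f 0 "int tb"] f1 by simp
  then have Mtb: "M < tb" using tb K by linarith
  show ?thesis
  proof (cases "ta \<le> tb")
    case True
    \<comment> \<open>Left of the origin positivity holds because \<open>ta\<close> is the first
      excess, right of it because no excess occurs before \<open>tb\<close>. In a tie
      \<open>ta = tb\<close> the sum up to \<open>ta\<close> is not controlled, so the particle may
      die in the very step that would bring it to the origin.\<close>
    have pre: "1 \<le> psum f (- int ta) j" if "- int ta \<le> j" "j < int ta" for j
    proof (cases "j \<le> -1")
      case True
      define s where "s = nat (- j - 1)"
      have s: "j = - int s - 1" "s < ta" using that True by (auto simp: s_def)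
      have "a ta = psum f (- int ta) j + a s"
        unfolding a_def using psum_split[of "- int ta" j "-1" f] that True s by simp
      then show ?thesis using ta la[OF s(2)] by linarith
    next
      case False
      then obtain s where s: "j = int s" using zero_le_imp_eq_int[of j] by auto
      have "psum f (- int ta) j = a ta - b s"
        unfolding a_def b_def using psum_split[of "- int ta" "-1" j f] False s by simp
      moreover have "s < tb" using s that True False \<open>ta \<le> tb\<close> by auto
      ultimately show ?thesis using ta lb[of s] by linarith
    qed
    have "alive_right f (- int ta) (ta - 1)"
      unfolding alive_right_def using pre Mta by auto
    then show ?thesis using Mta ta by blast
  next
    case False
    have "alive_left f (int tb) tb"
      unfolding alive_left_def
    proof
      fix i assume i: "i \<in> {int tb - 2 * int tb..int tb}"
      show "psum f i (int tb) \<le> - 1"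
      proof (cases "i \<le> 0")
        case True
        define s where "s = nat (- i)"
        have s: "i = - int s" "s \<le> tb" using i True by (auto simp: s_def)
        have "psum f i (int tb) = a s - b tb"
          unfolding a_def b_def using psum_split[of i "-1" "int tb" f] True s by simp
        then show ?thesis using tb la[of s] s False by simp
      next
        case F: False
        define s where "s = nat (i - 1)"
        have s: "i = int s + 1" "s < tb" using i F by (auto simp: s_def)
        have "- b tb = - b s + psum f i (int tb)"
          unfolding b_def using psum_split[of 0 "int s" "int tb" f] s by (simp add: add.commute)
        then show ?thesis using tb lb[OF s(2)] by linarith
      qed
    qed
    then show ?thesis using Mtb tb by blast
  qed
qed

section \<open>Random charges: survival and maxima of partial sums\<close>

locale charged_alphabet = finite_alphabet A for A :: "'b set" +
  fixes q :: "'b \<Rightarrow> int" and swap :: "'b \<Rightarrow> 'b" and pos neg :: 'b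
  assumes q_range: "q a \<in> {-1, 0, 1}"
    and swap_bij: "bij_betw swap A A"
    and q_swap: "a \<in> A \<Longrightarrow> q (swap a) = - q a"
    and pos: "pos \<in> A" "q pos = 1" and neg: "neg \<in> A" "q neg = - 1"
begin

abbreviation charge :: "(int \<Rightarrow> 'b) \<Rightarrow> int \<Rightarrow> int" where
  "charge c \<equiv> \<lambda>z. q (c z)"

lemma depends_psum: "depends_on {i..j} (\<lambda>c. P (psum (charge c) i j))"
  unfolding depends_on_def
proof (intro allI impI)
  fix c c' :: "int \<Rightarrow> 'b"
  assume "\<forall>z\<in>{i..j}. c z = c' z"
  then have "psum (charge c) i j = psum (charge c') i j" by (intro psum_cong) simp
  then show "P (psum (charge c) i j) = P (psum (charge c') i j)" by simp
qed

lemma loc_psum: "loc (\<lambda>c. P (psum (charge c) i j))"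
  by (rule depends_on_loc[OF _ depends_psum]) simp

lemma depends_alive_right: "depends_on {x..x + 2 * int n} (\<lambda>c. alive_right (charge c) x n)"
  unfolding depends_on_def
proof (intro allI impI)
  fix c c' :: "int \<Rightarrow> 'b"
  assume "\<forall>z\<in>{x..x + 2 * int n}. c z = c' z"
  then have "psum (charge c) x j = psum (charge c') x j" if "j \<in> {x..x + 2 * int n}" for j
    using that by (intro psum_cong) simp
  then show "alive_right (charge c) x n = alive_right (charge c') x n" unfolding alive_right_def by simp
qed

lemma depends_alive_left: "depends_on {y - 2 * int n..y} (\<lambda>c. alive_left (charge c) y n)"
  unfolding depends_on_def
proof (intro allI impI)
  fix c c' :: "int \<Rightarrow> 'b"
  assume "\<forall>z\<in>{y - 2 * int n..y}. c z = c' z"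
  then have "psum (charge c) i y = psum (charge c') i y" if "i \<in> {y - 2 * int n..y}" for i
    using that by (intro psum_cong) simp
  then show "alive_left (charge c) y n = alive_left (charge c') y n" unfolding alive_left_def by simp
qed

lemma loc_alive_right: "loc (\<lambda>c. alive_right (charge c) x n)"
  by (rule depends_on_loc[OF _ depends_alive_right]) simp

lemma loc_alive_left: "loc (\<lambda>c. alive_left (charge c) y n)"
  by (rule depends_on_loc[OF _ depends_alive_left]) simp

definition survival :: "nat \<Rightarrow> real" where
  "survival n = Pr (\<lambda>c. alive_right (charge c) 0 n)"

lemma Pr_alive_right: "Pr (\<lambda>c. alive_right (charge c) x n) = survival n"
proof -
  have gen: "alive_right (\<lambda>z. f (z + x)) 0 n = alive_right f x n" for f
  proof
    assume "alive_right (\<lambda>z. f (z + x)) 0 n"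
    then have *: "1 \<le> psum f (0 + x) (j + x)" if "j \<in> {0..0 + 2 * int n}" for j
      using that unfolding alive_right_def psum_shift by blast
    show "alive_right f x n" unfolding alive_right_def
    proof
      fix j assume "j \<in> {x..x + 2 * int n}"
      then show "1 \<le> psum f x j" using *[of "j - x"] by simp
    qed
  next
    assume "alive_right f x n"
    then show "alive_right (\<lambda>z. f (z + x)) 0 n"
      unfolding alive_right_def psum_shift by simp
  qed
  have "alive_right (\<lambda>z. q (c (z + x))) 0 n = alive_right (charge c) x n" for c :: "int \<Rightarrow> 'b"
    by (rule gen)
  then show ?thesis
    using Pr_shift[OF loc_alive_right[of 0 n], of x] unfolding survival_def by simp
qed

lemma Pr_reflect: "loc P \<Longrightarrow> Pr (\<lambda>c. P (\<lambda>z. swap (c (d - z)))) = Pr P"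
  by (rule Pr_comp[OF _ _ swap_bij]) (auto simp: inj_def)

lemma charge_reflect: "c \<in> configs A \<Longrightarrow> charge (\<lambda>z. swap (c (d - z))) = (\<lambda>z. - charge c (d - z))"
  using q_swap by (auto simp: configs_def)

lemma Pr_alive_left: "Pr (\<lambda>c. alive_left (charge c) y n) = survival n"
proof -
  have "Pr (\<lambda>c. alive_left (charge c) y n) = Pr (\<lambda>c. alive_right (charge (\<lambda>z. swap (c (y - z)))) 0 n)"
    by (rule Pr_cong) (simp add: charge_reflect alive_left_reflect[of _ y n y])
  also have "\<dots> = survival n"
    unfolding survival_def by (rule Pr_reflect[OF loc_alive_right])
  finally show ?thesis .
qed

lemma survival_nonneg: "0 \<le> survival n"
  by (simp add: survival_def Pr_nonneg)

lemma Pr_dies: "m \<le> n \<Longrightarrow> Pr (\<lambda>c. alive_right (charge c) x m \<and> \<not> alive_right (charge c) x n) = survival m - survival n"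
  by (subst Pr_diff[OF loc_alive_right loc_alive_right]) (auto simp: Pr_alive_right elim: alive_right_mono)

lemma Pr_dies_alive_left: "m \<le> n \<Longrightarrow> Pr (\<lambda>c. alive_left (charge c) x m \<and> \<not> alive_left (charge c) x n) = survival m - survival n"
  by (subst Pr_diff[OF loc_alive_left loc_alive_left]) (auto simp: Pr_alive_left elim: alive_left_mono)

lemma survival_antimono: "m \<le> n \<Longrightarrow> survival n \<le> survival m"
  using Pr_dies[of m n 0] Pr_nonneg[of "\<lambda>c. alive_right (charge c) 0 m \<and> \<not> alive_right (charge c) 0 n"] by linarith

text \<open>A right-moving and a left-moving particle facing each other cannot both survive for ever, but
  on disjoint windows their survival is independent.\<close>

lemma survival_tendsto_0: "survival \<longlonglongrightarrow> 0"
proof -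
  have "decseq survival" by (simp add: decseq_def survival_antimono)
  moreover have "bounded (range survival)"
    unfolding bounded_iff using Pr_le_1 survival_nonneg by (intro exI[of _ 1]) (auto simp: survival_def)
  ultimately obtain l where l: "survival \<longlonglongrightarrow> l"
    using survival_nonneg decseq_convergent[of survival 0] by blast
  have l0: "0 \<le> l" using survival_nonneg l by (meson LIMSEQ_le_const)
  have key: "survival n * survival n \<le> 2 * (survival n - l)" for n
  proof -
    \<comment> \<open>At this distance the two windows for \<open>n\<close> steps,
      \<open>{0..2 * n}\<close> and \<open>{2 * n + 1..4 * n + 1}\<close>, are disjoint. For
      \<open>m\<close> at least \<open>2 * n + 1\<close> each window contains the other starting
      point, so one of the two particles is dead.\<close>
    let ?y = "4 * int n + 1"
    have *: "survival n * survival n \<le> 2 * (survival n - survival m)" if m: "2 * n + 1 \<le> m" for m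
    proof -
      have "survival n * survival n = Pr (\<lambda>c. alive_right (charge c) 0 n \<and> alive_left (charge c) ?y n)"
        by (subst Pr_indep[OF _ depends_alive_right _ depends_alive_left]) (auto simp: Pr_alive_right Pr_alive_left)
      also have "\<dots> \<le> Pr (\<lambda>c. (alive_right (charge c) 0 n \<and> \<not> alive_right (charge c) 0 m) \<or>
                               (alive_left (charge c) ?y n \<and> \<not> alive_left (charge c) ?y m))"
      proof (rule Pr_mono)
        show "loc (\<lambda>c. (alive_right (charge c) 0 n \<and> \<not> alive_right (charge c) 0 m) \<or>
                       (alive_left (charge c) ?y n \<and> \<not> alive_left (charge c) ?y m))"
          by (intro loc_intros loc_alive_right loc_alive_left)
      next
        fix c assume "alive_right (charge c) 0 n \<and> alive_left (charge c) ?y n"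
        moreover have "\<not> (alive_right (charge c) 0 m \<and> alive_left (charge c) ?y m)"
          using alive_right_AL_excl[of "charge c" 0 m ?y m] m by auto
        ultimately show "(alive_right (charge c) 0 n \<and> \<not> alive_right (charge c) 0 m) \<or>
                         (alive_left (charge c) ?y n \<and> \<not> alive_left (charge c) ?y m)" by blast
      qed
      also have "\<dots> \<le> (survival n - survival m) + (survival n - survival m)"
        using Pr_disj_le[of "\<lambda>c. alive_right (charge c) 0 n \<and> \<not> alive_right (charge c) 0 m"
            "\<lambda>c. alive_left (charge c) ?y n \<and> \<not> alive_left (charge c) ?y m"] Pr_dies[of n m 0] Pr_dies_alive_left[of n m ?y] m
        by (simp add: loc_intros loc_alive_right loc_alive_left)
      finally show ?thesis by simp
    qed
    have "(\<lambda>m. 2 * (survival n - survival m)) \<longlonglongrightarrow> 2 * (survival n - l)" by (intro tendsto_intros l)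
    then show ?thesis by (rule LIMSEQ_le_const) (use * in blast)
  qed
  have "(\<lambda>n. 2 * (survival n - l)) \<longlonglongrightarrow> 2 * (l - l)" by (intro tendsto_intros l)
  moreover have "(\<lambda>n. survival n * survival n) \<longlonglongrightarrow> l * l" by (intro tendsto_intros l)
  ultimately have "l * l \<le> 2 * (l - l)" using key by (meson LIMSEQ_le)
  then have "l = 0" using l0 by (simp add: mult_le_0_iff)
  then show ?thesis using l by simp
qed

text \<open>If no left sum exceeds \<open>K\<close>, then \<open>K + 1\<close> left-moving particles
  inserted at the origin outweigh all charges to their left, and the rightmost of them survives. The
  insertion costs a constant factor, so a survival probability bounds the event. Surviving
  \<open>t\<close> steps concerns \<open>2 * t\<close> cells, hence \<open>n div 2\<close>.\<close>

lemma left_max_tendsto_0: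
  "(\<lambda>n. Pr (\<lambda>c. \<forall>t\<in>{..n}. psum (charge c) (- int t) (-1) \<le> int K)) \<longlonglongrightarrow> 0"
proof -
  let ?P = "\<lambda>n c. \<forall>t\<in>{..n}. psum (charge c) (- int t) (-1) \<le> int K"
  let ?\<sigma> = "\<lambda>z::int. if z < 0 then z else z + int K + 1"
  let ?C = "real (card A) ^ (K + 1)"
  have locP: "loc (?P n)" for n by (intro loc_intros loc_psum) auto
  have bound: "Pr (?P n) \<le> survival (n div 2) * ?C" for n
  proof -
    have "Pr (?P n) / ?C = Pr (\<lambda>c. ?P n (\<lambda>z. c (?\<sigma> z)) \<and> (\<forall>z\<in>{0..int K}. c z = neg))"
    proof -
      have "inj ?\<sigma>" by (auto simp: inj_def split: if_splits)
      moreover have "range ?\<sigma> \<inter> {0..int K} = {}" by (auto split: if_splits)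
      moreover have "bij_betw (\<lambda>x. x) A A" by (simp add: bij_betw_def)
      moreover have "card {0..int K} = K + 1" by simp
      ultimately show ?thesis
        using Pr_insert[OF locP, of ?\<sigma> "\<lambda>x. x" "{0..int K}" "\<lambda>_. neg" n] neg
        by (simp only: finite_atLeastAtMost_int Pi_I simp_thms if_True of_nat_power)
    qed
    also have "\<dots> \<le> Pr (\<lambda>c. alive_left (charge c) (int K) (n div 2))"
    proof (rule Pr_mono[OF loc_alive_left])
      fix c assume c: "?P n (\<lambda>z. c (?\<sigma> z)) \<and> (\<forall>z\<in>{0..int K}. c z = neg)"
      have L: "psum (charge c) i (int K) = - (int K - i + 1)" if "0 \<le> i" "i \<le> int K + 1" for i
      proof -
        have "psum (charge c) i (int K) = psum (\<lambda>_. - 1) i (int K)"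
          by (rule psum_cong) (use c that neg in auto)
        then show ?thesis using that by (simp add: psum_def)
      qed
      show "alive_left (charge c) (int K) (n div 2)"
        unfolding alive_left_def
      proof
        fix i assume i: "i \<in> {int K - 2 * int (n div 2)..int K}"
        show "psum (charge c) i (int K) \<le> - 1"
        proof (cases "i < 0")
          case True
          define t where "t = nat (- i)"
          have t: "i = - int t" "t \<le> n" using i True by (auto simp: t_def)
          have "psum (charge (\<lambda>z. c (?\<sigma> z))) (- int t) (-1) \<le> int K" using c t by auto
          also have "psum (charge (\<lambda>z. c (?\<sigma> z))) (- int t) (-1) = psum (charge c) (- int t) (-1)"
            by (rule psum_cong) auto
          finally show ?thesis
            using psum_split[of i "-1" "int K" "charge c"] L[of 0] t True by simp
        next
          case False
          then show ?thesis using L[of i] i by auto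
        qed
      qed
    qed
    also have "\<dots> = survival (n div 2)" by (rule Pr_alive_left)
    finally show ?thesis using fin_A A_ne by (simp add: divide_le_eq card_gt_0_iff)
  qed
  have "filterlim (\<lambda>n::nat. n div 2) at_top sequentially"
    unfolding filterlim_at_top eventually_sequentially
  proof
    fix Z :: nat
    show "\<exists>N. \<forall>n\<ge>N. Z \<le> n div 2" by (rule exI[of _ "2 * Z"]) auto
  qed
  from filterlim_compose[OF survival_tendsto_0 this]
  have "(\<lambda>n. survival (n div 2) * ?C) \<longlonglongrightarrow> 0 * ?C" by (intro tendsto_intros)
  then have lim: "(\<lambda>n. survival (n div 2) * ?C) \<longlonglongrightarrow> 0" by simp
  show ?thesis
    by (rule tendsto_sandwich[OF _ _ tendsto_const lim]) (use Pr_nonneg bound in auto)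
qed

text \<open>Reflection about -1/2 with reversed charges turns right sums into left sums; the empty
  left sum is trivially at most \<open>K\<close>.\<close>

lemma right_max_tendsto_0:
  "(\<lambda>n. Pr (\<lambda>c. \<forall>t\<in>{..n}. - psum (charge c) 0 (int t) \<le> int K)) \<longlonglongrightarrow> 0"
proof -
  have "Pr (\<lambda>c. \<forall>t\<in>{..n}. - psum (charge c) 0 (int t) \<le> int K) \<le>
    Pr (\<lambda>c. \<forall>t\<in>{..n}. psum (charge c) (- int t) (-1) \<le> int K)" for n
  proof -
    let ?P = "\<lambda>c. \<forall>t\<in>{..n}. - psum (charge c) 0 (int t) \<le> int K"
    have l: "loc ?P" by (intro loc_intros loc_psum[of "\<lambda>s. - s \<le> int K"]) auto
    have "Pr ?P = Pr (\<lambda>c. ?P (\<lambda>z. swap (c (-1 - z))))" by (rule Pr_reflect[OF l, symmetric])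
    also have "\<dots> \<le> Pr (\<lambda>c. \<forall>t\<in>{..n}. psum (charge c) (- int t) (-1) \<le> int K)"
    proof (rule Pr_mono)
      show "loc (\<lambda>c. \<forall>t\<in>{..n}. psum (charge c) (- int t) (-1) \<le> int K)"
        by (intro loc_intros loc_psum) auto
      fix c assume c: "c \<in> configs A" and P: "?P (\<lambda>z. swap (c (-1 - z)))"
      have *: "psum (charge c) (- 1 - int t) (-1) \<le> int K" if "t \<le> n" for t
        using P that unfolding charge_reflect[OF c] psum_reflect[of "charge c" "-1"] by simp
      show "\<forall>t\<in>{..n}. psum (charge c) (- int t) (-1) \<le> int K"
      proof
        fix t assume t: "t \<in> {..n}"
        show "psum (charge c) (- int t) (-1) \<le> int K"
        proof (cases t)
          case 0
          then show ?thesis by (simp add: psum_empty)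
        next
          case (Suc s)
          then show ?thesis using *[of s] t by (simp add: algebra_simps)
        qed
      qed
    qed
    finally show ?thesis .
  qed
  then show ?thesis
    by (intro tendsto_sandwich[OF _ _ tendsto_const left_max_tendsto_0[of K]]) (use Pr_nonneg in auto)
qed

end

section \<open>The cellular automaton\<close>

text \<open>Both kinds of particles carry a memory, so that \<open>mirror\<close> permutes the
  alphabet and the uniform measure is invariant under reflection with reversed charges.\<close>

datatype ('a, 's) cell =
  Letter 'a
| Defect
| is_R: Rgt (st: 's) (mem: "('s, 'a) edge set")
| is_L: Lft (st: 's) (mem: "('s, 'a) edge set")

datatype ('a, 's) action = Keep | Put "('a, 's) cell" | Write "('s, 'a) edge"

definition set_xor :: "'e set \<Rightarrow> 'e set \<Rightarrow> 'e set" where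
  "set_xor x y = (x - y) \<union> (y - x)"

definition drive :: "('a, 's) cell \<Rightarrow> ('s, 'a) edge set" where
  "drive c = (if is_R c then mem c else {})"

fun mirror :: "('a, 's) cell \<Rightarrow> ('a, 's) cell" where
  "mirror (Rgt s x) = Lft s x"
| "mirror (Lft s x) = Rgt s x"
| "mirror c = c"

lemma mirror_mirror: "mirror (mirror c) = c"
  by (cases c) auto

context presentation
begin

definition cells :: "('a, 's) cell set" where
  "cells = Letter ` Q \<union> {Defect} \<union> (\<lambda>(s, x). Rgt s x) ` (V \<times> Pow E) \<union> (\<lambda>(s, x). Lft s x) ` (V \<times> Pow E)"

text \<open>The memory is only a preference: the fallback edge keeps the particle on a path whatever
  it has been fed, and a singleton memory forces its edge exactly when the particle stands at the
  source.\<close>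

definition pick :: "'s \<Rightarrow> ('s, 'a) edge set \<Rightarrow> ('s, 'a) edge" where
  "pick s x = (if \<exists>e\<in>x. e \<in> E \<and> src e = s then SOME e. e \<in> x \<and> e \<in> E \<and> src e = s
               else SOME e. e \<in> E \<and> src e = s)"

definition prev :: "'s \<Rightarrow> ('s, 'a) edge" where
  "prev s = (SOME e. e \<in> E \<and> tgt e = s)"

text \<open>A \<open>Rgt\<close> cell moves right and writes behind it a path of the presentation, its memory \<open>mem\<close>
  telling which edges to prefer; in a block of adjacent \<open>Rgt\<close> cells each memory is
  xored at each step with the one to its right. A \<open>Lft\<close> cell moves left and writes a path backwards.
  Wherever the written paths need not fit together, a \<open>Defect\<close> is left until it gets overrun.\<close>

definition act :: "('a, 's) cell \<Rightarrow> ('a, 's) cell \<Rightarrow> ('a, 's) cell \<Rightarrow> ('a, 's) action" where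
  "act l c r =
    (if is_R l \<and> \<not> is_L c then
       if is_L r \<and> \<not> is_R c then Put Defect
       else Put (Rgt (tgt (pick (st l) (mem l))) (set_xor (mem l) (drive c)))
     else if is_L r \<and> \<not> is_R c then Put (Lft (src (prev (st r))) (mem r))
     else if is_R c then (if is_L l \<or> is_L r then Put Defect else Write (pick (st c) (mem c)))
     else if is_L c then (if is_R l then Put Defect else Write (prev (st c)))
     else Keep)"

definition step :: "('a, 's) cell \<Rightarrow> ('a, 's) cell \<Rightarrow> ('a, 's) cell \<Rightarrow> ('a, 's) cell" where
  "step l c r = (case act l c r of Keep \<Rightarrow> c | Put d \<Rightarrow> d | Write e \<Rightarrow> Letter (lab e))"

lemma finite_E: "finite E"
  using E_subset finite_V finite_Q by (meson finite_SigmaI finite_subset)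

lemma finite_cells: "finite cells"
  unfolding cells_def using finite_Q finite_V finite_E by auto

lemma out_edge: "s \<in> V \<Longrightarrow> \<exists>e. e \<in> E \<and> src e = s"
proof -
  assume "s \<in> V"
  then obtain es where es: "es \<noteq> []" "walk E s es s" using connected by blast
  then obtain e fs where "es = e # fs" by (cases es) auto
  then have "e \<in> E \<and> src e = s" using es by simp
  then show ?thesis by blast
qed

lemma in_edge: "s \<in> V \<Longrightarrow> \<exists>e. e \<in> E \<and> tgt e = s"
proof -
  assume "s \<in> V"
  then obtain es where es: "es \<noteq> []" "walk E s es s" using connected by blast
  then obtain fs e where "es = fs @ [e]" by (metis rev_exhaust)
  then have "e \<in> E \<and> tgt e = s" using es by (simp add: walk_append)
  then show ?thesis by blast
qed

lemma pick: assumes "s \<in> V" shows "pick s x \<in> E" "src (pick s x) = s"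
proof -
  have "pick s x \<in> E \<and> src (pick s x) = s"
  proof (cases "\<exists>e\<in>x. e \<in> E \<and> src e = s")
    case True
    then have "\<exists>e. e \<in> x \<and> e \<in> E \<and> src e = s" by blast
    from someI_ex[OF this] True show ?thesis by (simp only: pick_def if_True)
  next
    case False
    then show ?thesis using someI_ex[OF out_edge[OF assms]] by (simp only: pick_def if_False)
  qed
  then show "pick s x \<in> E" "src (pick s x) = s" by auto
qed

lemma pick_single: "e \<in> E \<Longrightarrow> pick (src e) {e} = e"
  unfolding pick_def by (auto intro!: some_equality)

lemma prev: assumes "s \<in> V" shows "prev s \<in> E" "tgt (prev s) = s"
  using someI_ex[OF in_edge[OF assms]] by (auto simp: prev_def)

lemma edge_V: "e \<in> E \<Longrightarrow> src e \<in> V" "e \<in> E \<Longrightarrow> tgt e \<in> V" "e \<in> E \<Longrightarrow> lab e \<in> Q"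
  using E_subset by (auto simp: mem_Times_iff dest!: subsetD)

lemma cells_iff [simp]:
  "Letter a \<in> cells \<longleftrightarrow> a \<in> Q" "Defect \<in> cells"
  "Rgt s x \<in> cells \<longleftrightarrow> s \<in> V \<and> x \<subseteq> E" "Lft s x \<in> cells \<longleftrightarrow> s \<in> V \<and> x \<subseteq> E"
  by (auto simp: cells_def)

lemma st_mem: "c \<in> cells \<Longrightarrow> is_R c \<or> is_L c \<Longrightarrow> st c \<in> V \<and> mem c \<subseteq> E"
  by (cases c) auto

lemma step_cells: "l \<in> cells \<Longrightarrow> c \<in> cells \<Longrightarrow> r \<in> cells \<Longrightarrow> step l c r \<in> cells"
  using st_mem[of l] st_mem[of c] st_mem[of r]
  by (auto simp: step_def act_def drive_def set_xor_def pick prev edge_V subset_iff)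

lemma is_R_step: "is_R (step l c r) \<longleftrightarrow> is_R l \<and> \<not> is_L c \<and> \<not> (is_L r \<and> \<not> is_R c)"
  by (auto simp: step_def act_def)

lemma is_L_step: "is_L (step l c r) \<longleftrightarrow> is_L r \<and> \<not> is_R c \<and> \<not> (is_R l \<and> \<not> is_L c)"
  by (cases c) (auto simp: step_def act_def)

end

text \<open>The automaton is to have the letters of \<open>Q\<close> themselves in its alphabet, so
  its symbols are identified with cells only through \<open>dec\<close>, and the argument is
  independent of the coding.\<close>

locale writer = presentation V E Q Lang for V :: "'s set" and E :: "('s, 'a) edge set" and Q Lang +
  fixes A :: "'b cellular_automaton" and dec :: "'b \<Rightarrow> ('a, 's) cell"
  assumes dec_bij: "bij_betw dec (alphabet A) cells"
    and radius: "radius A = 1"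
    and rule: "\<lbrakk>x \<in> alphabet A; y \<in> alphabet A; z \<in> alphabet A\<rbrakk> \<Longrightarrow>
      local_rule A [x, y, z] \<in> alphabet A \<and> dec (local_rule A [x, y, z]) = step (dec x) (dec y) (dec z)"
begin

abbreviation (input) "\<A> \<equiv> alphabet A"

definition enc :: "('a, 's) cell \<Rightarrow> 'b" where
  "enc = inv_into \<A> dec"

definition q :: "'b \<Rightarrow> int" where
  "q b = (if is_R (dec b) then 1 else if is_L (dec b) then -1 else 0)"

lemma enc: "x \<in> cells \<Longrightarrow> enc x \<in> \<A>" "x \<in> cells \<Longrightarrow> dec (enc x) = x"
  using dec_bij unfolding enc_def
  by (auto simp: bij_betw_def inv_into_into f_inv_into_f)

lemma enc_dec: "b \<in> \<A> \<Longrightarrow> enc (dec b) = b"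
  using dec_bij unfolding enc_def by (simp add: bij_betw_inv_into_left)

lemma dec: "b \<in> \<A> \<Longrightarrow> dec b \<in> cells"
  using dec_bij by (auto simp: bij_betw_def)

lemma mirror_cells: "c \<in> cells \<Longrightarrow> mirror c \<in> cells"
  by (cases c) auto

lemma obtain_vertex: obtains s where "s \<in> V"
  using V_nonempty by blast

sublocale charged_alphabet \<A> q "\<lambda>b. enc (mirror (dec b))"
  "enc (Rgt (SOME s. s \<in> V) {})" "enc (Lft (SOME s. s \<in> V) {})"
proof
  have s: "(SOME s. s \<in> V) \<in> V" using V_nonempty some_in_eq by blast
  show "finite \<A>" using dec_bij finite_cells bij_betw_finite by blast
  show "\<A> \<noteq> {}" using enc(1)[of Defect] by auto
  show "q a \<in> {-1, 0, 1}" for a by (simp add: q_def)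
  show "bij_betw (\<lambda>b. enc (mirror (dec b))) \<A> \<A>"
    by (rule bij_betw_byWitness[where f' = "\<lambda>b. enc (mirror (dec b))"])
      (auto simp: enc enc_dec dec mirror_cells mirror_mirror)
  show "q (enc (mirror (dec a))) = - q a" if "a \<in> \<A>" for a
    using enc(2)[OF mirror_cells[OF dec[OF that]]] by (cases "dec a") (auto simp: q_def)
  show "enc (Rgt (SOME s. s \<in> V) {}) \<in> \<A>" "q (enc (Rgt (SOME s. s \<in> V) {})) = 1"
    "enc (Lft (SOME s. s \<in> V) {}) \<in> \<A>" "q (enc (Lft (SOME s. s \<in> V) {})) = - 1"
    using s by (auto simp: enc q_def)
qed

definition cell_at :: "(int \<Rightarrow> 'b) \<Rightarrow> nat \<Rightarrow> int \<Rightarrow> ('a, 's) cell" where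
  "cell_at c n z = dec ((global_map A ^^ n) c z)"

text \<open>A letter does not show which edge was written, so \<open>trace\<close> remembers it; it is \<open>None\<close> on
  particles, on defects and on cells that no particle has visited.\<close>

primrec trace :: "(int \<Rightarrow> 'b) \<Rightarrow> nat \<Rightarrow> int \<Rightarrow> ('s, 'a) edge option" where
  "trace c 0 = (\<lambda>z. None)"
| "trace c (Suc n) = (\<lambda>z. case act (cell_at c n (z - 1)) (cell_at c n z) (cell_at c n (z + 1)) of
     Keep \<Rightarrow> trace c n z | Put d \<Rightarrow> None | Write e \<Rightarrow> Some e)"

lemma factor_radius: "factor c (z - 1) (z + 1) = [c (z - 1), c z, c (z + 1)]"
  using factor_append[of "z - 1" z "z + 1" c] factor_append[of z "z + 1" "z + 1" c]
  by (simp add: factor_def)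

lemma global_map_eq: "global_map A c z = local_rule A [c (z - 1), c z, c (z + 1)]"
  by (simp add: global_map_def radius factor_radius)

lemma cellular_automaton_A: "cellular_automaton A"
  unfolding cellular_automaton_def
proof (intro conjI ballI impI)
  show "finite \<A>" "\<A> \<noteq> {}" by (fact fin_A A_ne)+
  fix w assume w: "w \<in> lists \<A>" "length w = 2 * radius A + 1"
  then have "length w = 3" by (simp add: radius)
  then obtain x y z where "w = [x, y, z]" by (auto simp: length_Suc_conv eval_nat_numeral)
  then show "local_rule A w \<in> \<A>" using w rule by simp
qed

lemma orbit_configs: "c \<in> configs \<A> \<Longrightarrow> (global_map A ^^ n) c \<in> configs \<A>"
  by (induction n) (auto intro: global_map_configs[OF cellular_automaton_A])

lemma orbit_in: "c \<in> configs \<A> \<Longrightarrow> (global_map A ^^ n) c z \<in> \<A>"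
  using orbit_configs[of c n] by (auto simp: configs_def)

lemma cell_at_0: "cell_at c 0 z = dec (c z)"
  by (simp add: cell_at_def)

lemma cell_at_Suc: "c \<in> configs \<A> \<Longrightarrow> cell_at c (Suc n) z = step (cell_at c n (z - 1)) (cell_at c n z) (cell_at c n (z + 1))"
  using rule orbit_in by (simp add: cell_at_def global_map_eq)

lemma cell_at_cells: "c \<in> configs \<A> \<Longrightarrow> cell_at c n z \<in> cells"
  unfolding cell_at_def by (rule dec[OF orbit_in])

lemma charge_range: "charge c z \<in> {-1, 0, 1}"
  by (rule q_range)

text \<open>Each collision involves both kinds of particles, so the two equivalences are proved in
  one induction. A right-moving particle at \<open>z\<close> started at \<open>z - n\<close>, a
  left-moving one at \<open>z + n\<close>.\<close>

lemma alive_iff: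
  assumes c: "c \<in> configs \<A>"
  shows is_R_iff: "is_R (cell_at c n z) \<longleftrightarrow> alive_right (charge c) (z - int n) n"
    and is_L_iff: "is_L (cell_at c n z) \<longleftrightarrow> alive_left (charge c) (z + int n) n"
proof -
  have "\<forall>z. (is_R (cell_at c n z) \<longleftrightarrow> alive_right (charge c) (z - int n) n) \<and>
            (is_L (cell_at c n z) \<longleftrightarrow> alive_left (charge c) (z + int n) n)"
  proof (induction n)
    case 0
    have "is_R (dec (c z)) \<Longrightarrow> \<not> is_L (dec (c z))" for z by (cases "dec (c z)") auto
    then show ?case by (auto simp: cell_at_0 alive_right_def alive_left_def psum_one q_def)
  next
    case (Suc n)
    show ?case
    proof (intro allI conjI)
      fix z
      have e: "z - int (Suc n) = z - 1 - int n" "z - 1 - int n + 2 * int n + 1 = z + int n"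
        "z - 1 - int n + 2 * int n + 2 = z + 1 + int n" "z - 1 - int n + 1 = z - int n"
        "z + int (Suc n) = z + 1 + int n" "z + 1 + int n - 2 * int n - 1 = z - int n"
        "z + 1 + int n - 2 * int n - 2 = z - 1 - int n" "z + 1 + int n - 1 = z + int n"
        by auto
      show "is_R (cell_at c (Suc n) z) \<longleftrightarrow> alive_right (charge c) (z - int (Suc n)) (Suc n)"
        unfolding e(1) alive_right_step[of "charge c", OF charge_range[of c]] e(2-4) cell_at_Suc[OF c] is_R_step
        by (simp only: Suc)
      show "is_L (cell_at c (Suc n) z) \<longleftrightarrow> alive_left (charge c) (z + int (Suc n)) (Suc n)"
        unfolding e(5) alive_left_step[of "charge c", OF charge_range[of c]] e(6-8) cell_at_Suc[OF c] is_L_step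
        by (simp only: Suc)
    qed
  qed
  then show "is_R (cell_at c n z) \<longleftrightarrow> alive_right (charge c) (z - int n) n"
    and "is_L (cell_at c n z) \<longleftrightarrow> alive_left (charge c) (z + int n) n" by auto
qed

end

section \<open>Stray words vanish\<close>

context presentation
begin

lemma act_Write:
  assumes "act l c r = Write e"
  shows "\<not> is_R l" "\<not> is_L r"
    and "is_R c \<and> \<not> is_L l \<and> e = pick (st c) (mem c) \<or> is_L c \<and> e = prev (st c)"
  using assms by (cases c; auto simp: act_def split: if_splits)+

lemma act_Keep:
  assumes "act l c r = Keep"
  shows "\<not> is_R l" "\<not> is_L r" "\<not> is_R c" "\<not> is_L c"
  using assms by (cases c; auto simp: act_def split: if_splits)+

lemma step_R:
  assumes "is_R (step l c r)"
  shows "is_R l" "step l c r = Rgt (tgt (pick (st l) (mem l))) (set_xor (mem l) (drive c))"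
  using assms by (cases c; auto simp: step_def act_def split: if_splits)+

lemma step_L:
  assumes "is_L (step l c r)"
  shows "is_L r" "step l c r = Lft (src (prev (st r))) (mem r)"
  using assms by (cases c; auto simp: step_def act_def split: if_splits)+

lemma not_both: "\<not> (is_R c \<and> is_L c)"
  by (cases c) auto

lemma chain_walk:
  assumes "es \<noteq> []" "\<And>i. i < length es \<Longrightarrow> es ! i \<in> E"
    and "\<And>i. Suc i < length es \<Longrightarrow> tgt (es ! i) = src (es ! Suc i)"
  shows "\<exists>t. walk E (src (hd es)) es t"
  using assms
proof (induction es)
  case (Cons e es)
  show ?case
  proof (cases "es = []")
    case True
    then show ?thesis using Cons.prems(2)[of 0] by auto
  next
    case False
    have "\<exists>t. walk E (src (hd es)) es t"
      using False Cons.prems(2)[of "Suc _"] Cons.prems(3)[of "Suc _"] by (intro Cons.IH) auto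
    moreover have "tgt e = src (hd es)" using Cons.prems(3)[of 0] False by (simp add: hd_conv_nth)
    moreover have "e \<in> E" using Cons.prems(2)[of 0] by simp
    ultimately show ?thesis by simp
  qed
qed simp

end

context writer
begin

text \<open>For the induction the path property of neighbouring traces is not enough: the vertex of
  a particle must also fit the edge it has just left behind, since its next edge is attached there.
  Cells with trace \<open>None\<close> break the chain and impose nothing.\<close>

definition consistent :: "(int \<Rightarrow> 'b) \<Rightarrow> nat \<Rightarrow> bool" where
  "consistent c n \<longleftrightarrow>
    (\<forall>z e. trace c n z = Some e \<longrightarrow> e \<in> E \<and> cell_at c n z = Letter (lab e)) \<and>
    (\<forall>z e e'. trace c n z = Some e \<longrightarrow> trace c n (z + 1) = Some e' \<longrightarrow> tgt e = src e') \<and>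
    (\<forall>z e. trace c n z = Some e \<longrightarrow> is_R (cell_at c n (z + 1)) \<longrightarrow> tgt e = st (cell_at c n (z + 1))) \<and>
    (\<forall>z e. is_L (cell_at c n z) \<longrightarrow> trace c n (z + 1) = Some e \<longrightarrow> src e = st (cell_at c n z))"

lemma consistent:
  assumes c: "c \<in> configs \<A>"
  shows "consistent c n"
proof (induction n)
  case 0
  then show ?case by (simp add: consistent_def)
next
  case (Suc n)
  then have I1: "trace c n z = Some e \<Longrightarrow> e \<in> E \<and> cell_at c n z = Letter (lab e)"
    and I2: "trace c n z = Some e \<Longrightarrow> trace c n (z + 1) = Some e' \<Longrightarrow> tgt e = src e'"
    and I3: "trace c n z = Some e \<Longrightarrow> is_R (cell_at c n (z + 1)) \<Longrightarrow> tgt e = st (cell_at c n (z + 1))"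
    and I4: "is_L (cell_at c n z) \<Longrightarrow> trace c n (z + 1) = Some e \<Longrightarrow> src e = st (cell_at c n z)" for z e e'
    unfolding consistent_def by blast+
  have stV: "is_R (cell_at c n z) \<or> is_L (cell_at c n z) \<Longrightarrow> st (cell_at c n z) \<in> V" for z
    using st_mem[OF cell_at_cells[OF c]] by blast
  let ?a = "\<lambda>z. act (cell_at c n (z - 1)) (cell_at c n z) (cell_at c n (z + 1))"
  have HS: "?a z = Keep \<and> trace c n z = Some e \<or> ?a z = Write e" if "trace c (Suc n) z = Some e" for z e
    using that by (cases "?a z") auto
  have CS: "cell_at c (Suc n) z = step (cell_at c n (z - 1)) (cell_at c n z) (cell_at c n (z + 1))" for z
    by (rule cell_at_Suc[OF c])
  have z2: "z + 1 - 1 = z" for z :: int by simp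
  have "e \<in> E \<and> cell_at c (Suc n) z = Letter (lab e)" if "trace c (Suc n) z = Some e" for z e
    using HS[OF that]
  proof
    assume K: "?a z = Keep \<and> trace c n z = Some e"
    then have "cell_at c (Suc n) z = cell_at c n z" by (simp add: CS step_def)
    then show ?thesis using I1[of z e] K by simp
  next
    assume a: "?a z = Write e"
    then have "e \<in> E" using act_Write(3)[OF a] stV[of z] pick prev by auto
    then show ?thesis using a by (simp add: CS step_def)
  qed
  moreover have "tgt e = src e'" if e: "trace c (Suc n) z = Some e" and e': "trace c (Suc n) (z + 1) = Some e'"
    for z e e'
    using HS[OF e]
  proof
    assume K: "?a z = Keep \<and> trace c n z = Some e"
    note k = act_Keep[OF conjunct1[OF K]]
    show ?thesis using HS[OF e']
    proof
      assume "?a (z + 1) = Keep \<and> trace c n (z + 1) = Some e'"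
      then show ?thesis using K I2 by blast
    next
      assume W: "?a (z + 1) = Write e'"
      have "is_R (cell_at c n (z + 1)) \<and> e' = pick (st (cell_at c n (z + 1))) (mem (cell_at c n (z + 1)))"
        using act_Write(3)[OF W] k by blast
      then show ?thesis using I3[of z e] K pick(2)[OF stV[of "z + 1"]] by simp
    qed
  next
    assume W: "?a z = Write e"
    show ?thesis using HS[OF e']
    proof
      assume K: "?a (z + 1) = Keep \<and> trace c n (z + 1) = Some e'"
      have "\<not> is_R (cell_at c n z)" using act_Keep(1)[OF conjunct1[OF K]] unfolding z2 .
      then have "is_L (cell_at c n z) \<and> e = prev (st (cell_at c n z))" using act_Write(3)[OF W] by blast
      then show ?thesis using I4[of z e'] K prev(2)[OF stV[of z]] by simp
    next
      \<comment> \<open>Two neighbours are never written in the same step: their particles would be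
        parting from each other, and then the right one leaves a defect.\<close>
      assume W': "?a (z + 1) = Write e'"
      have "\<not> is_R (cell_at c n z)" using act_Write(1)[OF W'] unfolding z2 .
      moreover have "\<not> is_L (cell_at c n z)" using act_Write(3)[OF W'] act_Write(2)[OF W] unfolding z2 by blast
      ultimately show ?thesis using act_Write(3)[OF W] by blast
    qed
  qed
  moreover have "tgt e = st (cell_at c (Suc n) (z + 1))"
    if e: "trace c (Suc n) z = Some e" and R: "is_R (cell_at c (Suc n) (z + 1))" for z e
  proof -
    note r = step_R[OF R[unfolded CS], unfolded z2]
    have "?a z = Write e" using HS[OF e] act_Keep(3) r(1) by blast
    then have "e = pick (st (cell_at c n z)) (mem (cell_at c n z))" using act_Write(3) r(1) not_both by blast
    then show ?thesis unfolding CS z2 r(2) by simp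
  qed
  moreover have "src e = st (cell_at c (Suc n) z)"
    if L: "is_L (cell_at c (Suc n) z)" and e: "trace c (Suc n) (z + 1) = Some e" for z e
  proof -
    note l = step_L[OF L[unfolded CS]]
    have "?a (z + 1) = Write e" using HS[OF e] act_Keep(4) l(1) by blast
    then have "e = prev (st (cell_at c n (z + 1)))" using act_Write(3) l(1) not_both by blast
    then show ?thesis unfolding CS l(2) by simp
  qed
  ultimately show ?case unfolding consistent_def by blast
qed

lemma written_word:
  assumes c: "c \<in> configs \<A>" and H: "\<And>k. k < m \<Longrightarrow> trace c n (z + int k) \<noteq> None"
  shows "\<exists>v\<in>Lang. length v = m \<and> (\<forall>k<m. cell_at c n (z + int k) = Letter (v ! k))"
proof (cases "m = 0")
  case True
  obtain s where "s \<in> V" using obtain_vertex .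
  then have "[] \<in> Lang" using walk_label[of s "[]" s] by simp
  then show ?thesis using True by auto
next
  case False
  define es where "es = map (\<lambda>k. the (trace c n (z + int k))) [0..<m]"
  have es: "length es = m" "\<And>k. k < m \<Longrightarrow> trace c n (z + int k) = Some (es ! k)"
    using H by (auto simp: es_def)
  note cons = consistent[OF c, of n, unfolded consistent_def]
  have e: "es ! k \<in> E \<and> cell_at c n (z + int k) = Letter (lab (es ! k))" if "k < m" for k
    using cons es(2)[OF that] by blast
  have ch: "tgt (es ! k) = src (es ! Suc k)" if "Suc k < m" for k
  proof -
    have "trace c n (z + int k) = Some (es ! k)" "trace c n (z + int k + 1) = Some (es ! Suc k)"
      using es(2)[of k] es(2)[of "Suc k"] that by (auto simp: algebra_simps)
    then show ?thesis using cons by blast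
  qed
  have ne: "es \<noteq> []" using False es(1) by auto
  obtain t where t: "walk E (src (hd es)) es t"
    using chain_walk[OF ne] e ch es(1) by blast
  have "es ! 0 \<in> E" using e False by blast
  then have "src (hd es) \<in> V" using ne edge_V(1) by (simp add: hd_conv_nth)
  then have "map lab es \<in> Lang" using t by (rule walk_label)
  then show ?thesis using e es(1) by (intro bexI[of _ "map lab es"]) auto
qed

text \<open>A defect costs the life of a right-moving particle, at the cell itself or next to it.
  The other source, two particles parting from adjacent cells, occurs only at time 0: later they
  would have had to pass through each other. Hence the hypothesis on \<open>t\<close>.\<close>

lemma defect_created:
  assumes c: "c \<in> configs \<A>" and t: "1 \<le> t"
    and a: "act (cell_at c t (-1)) (cell_at c t 0) (cell_at c t 1) = Put Defect"
  shows "(alive_right (charge c) (-1 - int t) t \<and> \<not> alive_right (charge c) (-1 - int t) (Suc t)) \<or>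
         (alive_right (charge c) (- int t) t \<and> \<not> alive_right (charge c) (- int t) (Suc t))"
proof -
  have C0: "cell_at c (Suc t) 0 = Defect" using cell_at_Suc[OF c, of t 0] a by (simp add: step_def)
  have R1: "alive_right (charge c) (-1 - int t) (Suc t) \<longleftrightarrow> is_R (cell_at c (Suc t) 0)"
    using is_R_iff[OF c, of "Suc t" 0] by simp
  have R0: "alive_right (charge c) (-1 - int t) t \<longleftrightarrow> is_R (cell_at c t (-1))"
    using is_R_iff[OF c, of t "-1"] by simp
  show ?thesis
  proof (cases "is_R (cell_at c t (-1))")
    case True
    then show ?thesis using C0 R1 R0 by simp
  next
    case False
    then have R: "is_R (cell_at c t 0)" and L: "is_L (cell_at c t (-1)) \<or> is_L (cell_at c t 1)"
      using a by (auto simp: act_def split: if_splits)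
    have alive_right: "alive_right (charge c) (- int t) t" using R is_R_iff[OF c, of t 0] by simp
    have "\<not> is_L (cell_at c t (-1))"
    proof
      assume "is_L (cell_at c t (-1))"
      then have "alive_left (charge c) (-1 + int t) t" using is_L_iff[OF c, of t "-1"] by simp
      from alive_right_AL_excl[OF alive_right this] show False using t by simp
    qed
    then have "\<not> is_R (cell_at c (Suc t) 1)" using L cell_at_Suc[OF c, of t 1] is_R_step by simp
    then have "\<not> alive_right (charge c) (- int t) (Suc t)" using is_R_iff[OF c, of "Suc t" 1] by simp
    then show ?thesis using alive_right by blast
  qed
qed

text \<open>Once a particle has stood at the origin, every later step leaves there a particle or a
  traced letter unless it creates a defect.\<close>

lemma undefined_cases:
  assumes c: "c \<in> configs \<A>" and M: "1 \<le> M" "M < n" and H: "trace c n 0 = None"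
  shows "is_R (cell_at c n 0) \<or> is_L (cell_at c n 0) \<or>
    (\<forall>t. M < t \<and> t \<le> n \<longrightarrow> \<not> is_R (cell_at c t 0) \<and> \<not> is_L (cell_at c t 0)) \<or>
    (\<exists>t. M \<le> t \<and> t < n \<and> act (cell_at c t (-1)) (cell_at c t 0) (cell_at c t 1) = Put Defect)"
proof (rule ccontr)
  assume N: "\<not> ?thesis"
  let ?p = "\<lambda>t. is_R (cell_at c t 0) \<or> is_L (cell_at c t 0)"
  let ?a = "\<lambda>t. act (cell_at c t (-1)) (cell_at c t 0) (cell_at c t 1)"
  have np: "\<not> ?p n" and nd: "\<And>t. M \<le> t \<Longrightarrow> t < n \<Longrightarrow> ?a t \<noteq> Put Defect" using N by blast+
  obtain t0 where t0: "M < t0" "t0 \<le> n" "?p t0" using N by blast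
  have HS: "trace c (Suc t) 0 = (case ?a t of Keep \<Rightarrow> trace c t 0 | Put d \<Rightarrow> None | Write e \<Rightarrow> Some e)" for t
    by simp
  have CS: "cell_at c (Suc t) 0 = (case ?a t of Keep \<Rightarrow> cell_at c t 0 | Put d \<Rightarrow> d | Write e \<Rightarrow> Letter (lab e))" for t
    using cell_at_Suc[OF c, of t 0] by (simp add: step_def)
  have pd: "is_R d \<or> is_L d \<or> d = Defect" if "?a t = Put d" for d t
    using that by (auto simp: act_def split: if_splits)
  have "?p t \<or> trace c t 0 \<noteq> None" if "t0 \<le> t" "t \<le> n" for t
    using that
  proof (induction t rule: dec_induct)
    case base
    then show ?case using t0 by blast
  next
    case (step t)
    then have IH: "?p t \<or> trace c t 0 \<noteq> None" by simp
    have d: "?a t \<noteq> Put Defect" using nd step t0 by simp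
    show ?case
    proof (cases "?a t")
      case Keep
      then have "\<not> ?p t" using act_Keep by blast
      then show ?thesis using IH Keep HS[of t] by simp
    next
      case (Put x)
      then have "is_R x \<or> is_L x" using pd d by blast
      then show ?thesis using CS[of t] Put by simp
    next
      case (Write x)
      then show ?thesis using HS[of t] by simp
    qed
  qed
  from this[of n] show False using np H t0 by blast
qed

text \<open>The possible reasons for an untraced origin, expressed by the initial charges alone.
  \<open>M\<close> separates early collisions, whose traces a later visit erases, from late ones,
  which are rare.\<close>

definition unsettled :: "nat \<Rightarrow> nat \<Rightarrow> (int \<Rightarrow> 'b) \<Rightarrow> bool" where
  "unsettled M n c \<longleftrightarrow>
    alive_right (charge c) (- int n) n \<or> alive_left (charge c) (int n) n \<or>
    (\<forall>t\<in>{..n}. psum (charge c) (- int t) (-1) \<le> int (M + 1)) \<or>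
    (\<forall>t\<in>{..n}. - psum (charge c) 0 (int t) \<le> int (M + 1)) \<or>
    (\<exists>t\<in>{M..<n}. alive_right (charge c) (-1 - int t) t \<and> \<not> alive_right (charge c) (-1 - int t) (Suc t)) \<or>
    (\<exists>t\<in>{M..<n}. alive_right (charge c) (- int t) t \<and> \<not> alive_right (charge c) (- int t) (Suc t))"

lemma undefined_unsettled:
  assumes c: "c \<in> configs \<A>" and M: "1 \<le> M" "M < n" and H: "trace c n 0 = None"
  shows "unsettled M n c"
  using undefined_cases[OF assms]
proof (elim disjE)
  assume "is_R (cell_at c n 0)"
  then show ?thesis using is_R_iff[OF c, of n 0] by (simp add: unsettled_def)
next
  assume "is_L (cell_at c n 0)"
  then show ?thesis using is_L_iff[OF c, of n 0] by (simp add: unsettled_def)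
next
  assume N: "\<forall>t. M < t \<and> t \<le> n \<longrightarrow> \<not> is_R (cell_at c t 0) \<and> \<not> is_L (cell_at c t 0)"
  show ?thesis
  proof (rule ccontr)
    assume U: "\<not> unsettled M n c"
    then have "\<exists>t\<le>n. int (M + 1) < psum (charge c) (- int t) (-1)"
      "\<exists>t\<le>n. int (M + 1) < - psum (charge c) 0 (int t)"
      unfolding unsettled_def by (meson atMost_iff not_le)+
    from race[of "charge c", OF charge_range[of c] _ this, of M] obtain t where t: "M < t" "t \<le> n" and
      d: "alive_right (charge c) (- int t) t \<or> alive_left (charge c) (int t) t \<or>
        (alive_right (charge c) (- int t) (t - 1) \<and> \<not> alive_right (charge c) (- int t) t)" by auto
    have "\<not> alive_right (charge c) (- int t) t" "\<not> alive_left (charge c) (int t) t"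
      using N t is_R_iff[OF c, of t 0] is_L_iff[OF c, of t 0] by auto
    \<comment> \<open>What remains is the third outcome of the race: the particle dies when about to
      enter the origin, which is itself a late collision.\<close>
    with d have "alive_right (charge c) (- int t) (t - 1)" "\<not> alive_right (charge c) (- int t) t" by auto
    moreover have "t - 1 \<in> {M..<n}" "- int t = -1 - int (t - 1)" "t = Suc (t - 1)" using t by auto
    ultimately have "\<exists>t\<in>{M..<n}. alive_right (charge c) (-1 - int t) t \<and> \<not> alive_right (charge c) (-1 - int t) (Suc t)"
      by metis
    then show False using U unfolding unsettled_def by blast
  qed
next
  assume "\<exists>t. M \<le> t \<and> t < n \<and> act (cell_at c t (-1)) (cell_at c t 0) (cell_at c t 1) = Put Defect"
  then obtain t where t: "M \<le> t" "t < n" "act (cell_at c t (-1)) (cell_at c t 0) (cell_at c t 1) = Put Defect" by blast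
  with defect_created[OF c _ t(3)] M show ?thesis unfolding unsettled_def by fastforce
qed

lemma loc_unsettled: "loc (unsettled M n)"
  unfolding unsettled_def
  by (intro loc_disj loc_ball loc_bex loc_conj loc_not loc_alive_right loc_alive_left loc_psum loc_psum[of "\<lambda>s. - s \<le> int (M + 1)"])
    auto

text \<open>By shift invariance a right-moving particle dies at a given place in step
  \<open>t + 1\<close> with probability \<open>survival t - survival (Suc t)\<close>. The sum over
  \<open>t\<close> telescopes, so infinitely many opportunities for late collisions cost no more
  than \<open>survival M\<close>.\<close>

lemma Pr_unsettled:
  assumes "M \<le> n"
  shows "Pr (unsettled M n) \<le> 2 * survival n + 2 * survival M +
    Pr (\<lambda>c. \<forall>t\<in>{..n}. psum (charge c) (- int t) (-1) \<le> int (M + 1)) +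
    Pr (\<lambda>c. \<forall>t\<in>{..n}. - psum (charge c) 0 (int t) \<le> int (M + 1))"
proof -
  have tele: "(\<Sum>t\<in>{M..<n}. survival t - survival (Suc t)) = survival M - survival n"
    using sum_Suc_diff'[OF assms, of "\<lambda>t. - survival t"] by simp
  have D: "Pr (\<lambda>c. \<exists>t\<in>{M..<n}. alive_right (charge c) (d - int t) t \<and> \<not> alive_right (charge c) (d - int t) (Suc t))
      \<le> survival M - survival n" for d
    using Pr_bex_le[of "{M..<n}" "\<lambda>t c. alive_right (charge c) (d - int t) t \<and> \<not> alive_right (charge c) (d - int t) (Suc t)"]
    by (simp add: loc_conj loc_not loc_alive_right Pr_dies tele)
  let ?L = "\<lambda>c. \<forall>t\<in>{..n}. psum (charge c) (- int t) (-1) \<le> int (M + 1)"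
  let ?R = "\<lambda>c. \<forall>t\<in>{..n}. - psum (charge c) 0 (int t) \<le> int (M + 1)"
  let ?D = "\<lambda>d c. \<exists>t\<in>{M..<n}. alive_right (charge c) (d - int t) t \<and> \<not> alive_right (charge c) (d - int t) (Suc t)"
  have l: "loc ?L" "loc ?R" "loc (?D d)" for d
    by (intro loc_ball loc_bex loc_conj loc_not loc_alive_right loc_psum loc_psum[of "\<lambda>s. - s \<le> int (M + 1)"]; simp)+
  have "Pr (unsettled M n) = Pr (\<lambda>c. alive_right (charge c) (- int n) n \<or> alive_left (charge c) (int n) n \<or>
      ?L c \<or> ?R c \<or> ?D (-1) c \<or> ?D 0 c)"
    by (rule Pr_cong) (simp add: unsettled_def)
  also have "\<dots> \<le> Pr (\<lambda>c. alive_right (charge c) (- int n) n) + (Pr (\<lambda>c. alive_left (charge c) (int n) n) +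
      (Pr ?L + (Pr ?R + (Pr (?D (-1)) + Pr (?D 0)))))"
    by (intro order_trans[OF Pr_disj_le] add_left_mono loc_disj l loc_alive_right loc_alive_left order_refl)
  also have "\<dots> \<le> 2 * survival n + 2 * survival M + Pr ?L + Pr ?R"
    using D[of "-1"] D[of 0] survival_nonneg[of n] unfolding Pr_alive_right Pr_alive_left by linarith
  finally show ?thesis .
qed

text \<open>\<open>M\<close> is fixed first, making late collisions rare; only then is
  \<open>n\<close> taken large enough for the sums on both sides to exceed
  \<open>M + 1\<close>.\<close>

lemma unsettled_small:
  assumes "0 < \<epsilon>"
  shows "\<exists>M N. 1 \<le> M \<and> M < N \<and> (\<forall>n\<ge>N. Pr (unsettled M n) < \<epsilon>)"
proof -
  have "eventually (\<lambda>n. survival n < \<epsilon> / 8) sequentially"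
    using order_tendstoD(2)[OF survival_tendsto_0, of "\<epsilon> / 8"] assms by simp
  then obtain M0 where M0: "\<And>n. M0 \<le> n \<Longrightarrow> survival n < \<epsilon> / 8"
    by (auto simp: eventually_sequentially)
  define M where "M = max M0 1"
  have "eventually (\<lambda>n. Pr (\<lambda>c. \<forall>t\<in>{..n}. psum (charge c) (- int t) (-1) \<le> int (M + 1)) < \<epsilon> / 4) sequentially"
    using order_tendstoD(2)[OF left_max_tendsto_0[of "M + 1"], of "\<epsilon> / 4"] assms by simp
  moreover have "eventually (\<lambda>n. Pr (\<lambda>c. \<forall>t\<in>{..n}. - psum (charge c) 0 (int t) \<le> int (M + 1)) < \<epsilon> / 4) sequentially"
    using order_tendstoD(2)[OF right_max_tendsto_0[of "M + 1"], of "\<epsilon> / 4"] assms by simp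
  ultimately have "eventually (\<lambda>n. Pr (\<lambda>c. \<forall>t\<in>{..n}. psum (charge c) (- int t) (-1) \<le> int (M + 1)) < \<epsilon> / 4 \<and>
      Pr (\<lambda>c. \<forall>t\<in>{..n}. - psum (charge c) 0 (int t) \<le> int (M + 1)) < \<epsilon> / 4) sequentially"
    by (rule eventually_conj)
  then obtain N0 where N0: "\<And>n. N0 \<le> n \<Longrightarrow>
      Pr (\<lambda>c. \<forall>t\<in>{..n}. psum (charge c) (- int t) (-1) \<le> int (M + 1)) < \<epsilon> / 4 \<and>
      Pr (\<lambda>c. \<forall>t\<in>{..n}. - psum (charge c) 0 (int t) \<le> int (M + 1)) < \<epsilon> / 4"
    by (auto simp: eventually_sequentially)
  have "Pr (unsettled M n) < \<epsilon>" if "max N0 (M + 1) \<le> n" for n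
  proof -
    have n: "N0 \<le> n" "M \<le> n" using that by auto
    have "survival n < \<epsilon> / 8" "survival M < \<epsilon> / 8" using M0 n by (auto simp: M_def)
    then show ?thesis using Pr_unsettled[OF n(2)] N0[OF n(1)] by linarith
  qed
  then show ?thesis by (intro exI[of _ M] exI[of _ "max N0 (M + 1)"]) (auto simp: M_def)
qed

end

section \<open>Every word of the language persists\<close>

text \<open>The forward difference over the field with two elements. If member \<open>i\<close> of a
  train holds the \<open>i\<close>-th difference of a sequence, adding the memory of member
  \<open>i + 1\<close> advances it by one term.\<close>

definition delta :: "(nat \<Rightarrow> 'e set) \<Rightarrow> nat \<Rightarrow> 'e set" where
  "delta y t = set_xor (y (Suc t)) (y t)"

lemma set_xor_cancel: "set_xor x (set_xor y x) = y"
  by (auto simp: set_xor_def)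

text \<open>With \<open>S\<close> the shift of sequences,
  \<open>(S + 1) ^ (2 ^ j) = S ^ (2 ^ j) + 1\<close> in characteristic two.\<close>

lemma delta_power:
  "(delta ^^ (2 ^ j)) y t = set_xor (y (t + 2 ^ j)) (y t)"
proof (induction j arbitrary: y t)
  case 0
  then show ?case by (simp add: delta_def)
next
  case (Suc j)
  have "(delta ^^ (2 ^ Suc j)) y = (delta ^^ (2 ^ j)) ((delta ^^ (2 ^ j)) y)"
    by (simp add: mult_2 funpow_add)
  then have "(delta ^^ (2 ^ Suc j)) y t =
      set_xor (set_xor (y (t + 2 ^ j + 2 ^ j)) (y (t + 2 ^ j))) (set_xor (y (t + 2 ^ j)) (y t))"
    by (simp add: Suc)
  also have "\<dots> = set_xor (y (t + 2 ^ Suc j)) (y t)"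
    by (auto simp: set_xor_def mult_2 add.assoc)
  finally show ?case .
qed

lemma delta_subset: "(\<And>t. y t \<subseteq> B) \<Longrightarrow> (delta ^^ i) y t \<subseteq> B"
proof (induction i arbitrary: t)
  case (Suc i)
  then have "(delta ^^ i) y t \<subseteq> B" "(delta ^^ i) y (Suc t) \<subseteq> B" by blast+
  moreover have "(delta ^^ Suc i) y t = set_xor ((delta ^^ i) y (Suc t)) ((delta ^^ i) y t)"
    by (simp only: funpow.simps o_apply delta_def)
  ultimately show ?case by (auto simp: set_xor_def)
qed simp

section \<open>Runs steered by a list of preferences\<close>

context presentation
begin

primrec run :: "'s \<Rightarrow> ('s, 'a) edge set list \<Rightarrow> ('s, 'a) edge list" where
  "run s [] = []"
| "run s (x # xs) = pick s x # run (tgt (pick s x)) xs"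

primrec run_end :: "'s \<Rightarrow> ('s, 'a) edge set list \<Rightarrow> 's" where
  "run_end s [] = s"
| "run_end s (x # xs) = run_end (tgt (pick s x)) xs"

lemma run_append: "run s (xs @ ys) = run s xs @ run (run_end s xs) ys"
  by (induction xs arbitrary: s) auto

lemma length_run: "length (run s xs) = length xs"
  by (induction xs arbitrary: s) auto

lemma run_end_V: "s \<in> V \<Longrightarrow> run_end s xs \<in> V"
  by (induction xs arbitrary: s) (auto simp: pick edge_V)

lemma run_walk: "walk E s es t \<Longrightarrow> run s (map (\<lambda>e. {e}) es) = es"
proof (induction es arbitrary: s)
  case (Cons e es)
  then have "pick s {e} = e" using pick_single[of e] by auto
  then show ?case using Cons by simp
qed simp

lemma walk_edges: "walk E s es t \<Longrightarrow> set es \<subseteq> E"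
  by (induction es arbitrary: s) auto

text \<open>Concatenating connecting paths, one start vertex after the other, gives a preference list
  along which every run passes through a given word.\<close>

lemma universal_list:
  assumes u: "u \<in> L"
  shows "\<exists>bs. set bs \<subseteq> Pow E \<and> (\<forall>s\<in>V. \<exists>p r. map lab (run s bs) = p @ u @ r)"
proof -
  have "\<exists>bs. set bs \<subseteq> Pow E \<and> (\<forall>s\<in>T. \<exists>p r. map lab (run s bs) = p @ u @ r)" if "finite T" "T \<subseteq> V" for T
    using that
  proof (induction T rule: finite_induct)
    case empty
    then show ?case by (intro exI[of _ "[]"]) auto
  next
    case (insert s T)
    then obtain bs where bs: "set bs \<subseteq> Pow E" "\<And>s. s \<in> T \<Longrightarrow> \<exists>p r. map lab (run s bs) = p @ u @ r"
      by auto
    obtain s1 es t where es: "s1 \<in> V" "walk E s1 es t" "map lab es = u" using label_walk[OF u] by blast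
    have "run_end s bs \<in> V" using insert.prems run_end_V by blast
    then obtain fs where fs: "walk E (run_end s bs) fs s1" using connected es(1) by blast
    let ?cs = "map (\<lambda>e. {e}) (fs @ es)"
    have w: "walk E (run_end s bs) (fs @ es) t" using fs es(2) by (auto simp: walk_append)
    have "run s (bs @ ?cs) = run s bs @ fs @ es"
      unfolding run_append run_walk[OF w] ..
    then have "\<exists>p r. map lab (run s (bs @ ?cs)) = p @ u @ r"
      using es(3) by (intro exI[of _ "map lab (run s bs @ fs)"] exI[of _ "[]"]) simp
    moreover have "\<exists>p r. map lab (run s' (bs @ ?cs)) = p @ u @ r" if s': "s' \<in> T" for s'
    proof -
      obtain p r where "map lab (run s' bs) = p @ u @ r" using bs(2)[OF s'] by blast
      then show ?thesis unfolding run_append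
        by (intro exI[of _ p] exI[of _ "r @ map lab (run (run_end s' bs) ?cs)"]) simp
    qed
    moreover have "set (bs @ ?cs) \<subseteq> Pow E" using bs(1) walk_edges[OF w] by auto
    ultimately show ?case by blast
  qed
  from this[OF finite_V] show ?thesis by simp
qed

text \<open>Empty preferences at the end merely prolong each run, so the list can be padded to a
  power of two, as the difference operator requires.\<close>

lemma universal_list_power2:
  assumes u: "u \<in> L"
  shows "\<exists>bs j. set bs \<subseteq> Pow E \<and> length bs = 2 ^ j \<and> (\<forall>s\<in>V. \<exists>p r. map lab (run s bs) = p @ u @ r)"
proof -
  obtain bs where bs: "set bs \<subseteq> Pow E" "\<And>s. s \<in> V \<Longrightarrow> \<exists>p r. map lab (run s bs) = p @ u @ r"
    using universal_list[OF u] by blast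
  let ?cs = "replicate (2 ^ length bs - length bs) {}"
  have len: "length (bs @ ?cs) = 2 ^ length bs" using less_exp[of "length bs"] by simp
  have "\<exists>p r. map lab (run s (bs @ ?cs)) = p @ u @ r" if s: "s \<in> V" for s
  proof -
    obtain p r where "map lab (run s bs) = p @ u @ r" using bs(2)[OF s] by blast
    then show ?thesis unfolding run_append
      by (intro exI[of _ p] exI[of _ "r @ map lab (run (run_end s bs) ?cs)"]) simp
  qed
  moreover have "set (bs @ ?cs) \<subseteq> Pow E" using bs(1) by auto
  ultimately show ?thesis using len by blast
qed

end

section \<open>The starting point of the last particle to reach the origin\<close>

context charged_alphabet
begin

text \<open>Up to time \<open>N\<close> nothing reaches the origin after the right-moving particle starting at \<open>-k\<close>, so
  particles inserted right behind it are the last ones to cross.\<close>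

definition peak :: "nat \<Rightarrow> nat \<Rightarrow> (int \<Rightarrow> 'b) \<Rightarrow> bool" where
  "peak N k c \<longleftrightarrow>
    (\<forall>s\<in>{..<k}. psum (charge c) (- int s) (-1) < psum (charge c) (- int k) (-1)) \<and>
    (\<forall>s\<in>{k<..N}. psum (charge c) (- int s) (-1) \<le> psum (charge c) (- int k) (-1)) \<and>
    (\<forall>s\<in>{..N}. - psum (charge c) 0 (int s - 1) \<le> psum (charge c) (- int k) (-1))"

lemma loc_psum2: "loc (\<lambda>c. P (psum (charge c) i j) (psum (charge c) i' j'))"
proof (rule depends_on_loc)
  show "finite ({i..j} \<union> {i'..j'})" by simp
  have "psum (charge c) i j = psum (charge c') i j \<and> psum (charge c) i' j' = psum (charge c') i' j'"
    if "\<forall>z\<in>{i..j} \<union> {i'..j'}. c z = c' z" for c c' :: "int \<Rightarrow> 'b"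
    using that by (auto intro!: psum_cong)
  then show "depends_on ({i..j} \<union> {i'..j'}) (\<lambda>c. P (psum (charge c) i j) (psum (charge c) i' j'))"
    unfolding depends_on_def by metis
qed

lemma loc_peak: "loc (peak N k)"
  unfolding peak_def
  by (intro loc_conj loc_ball loc_psum2[of "\<lambda>x y. x < y"] loc_psum2[of "\<lambda>x y. x \<le> y"]
      loc_psum2[of "\<lambda>x y. - x \<le> y"]) simp_all

text \<open>Either the maximum of the left sums is at least that of the right sums, or conversely.
  Reflection exchanges the two events, so each has probability at least 1/2, ties being counted
  twice. The right sums stop at \<open>s - 1\<close> so that both sides sum over \<open>s\<close>
  cells.\<close>

lemma Pr_peak: "1 / 2 \<le> Pr (\<lambda>c. \<exists>k\<in>{..N}. peak N k c)"
proof -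
  let ?a = "\<lambda>c s. psum (charge c) (- int s) (-1)" and ?b = "\<lambda>c s. - psum (charge c) 0 (int s - 1)"
  let ?P = "\<lambda>c. \<exists>k\<in>{..N}. \<forall>s\<in>{..N}. ?b c s \<le> ?a c k"
  let ?R = "\<lambda>c. \<exists>k\<in>{..N}. \<forall>s\<in>{..N}. ?a c s \<le> ?b c k"
  have locP: "loc ?P" by (intro loc_bex loc_ball loc_psum2[of "\<lambda>x y. - x \<le> y"]) simp_all
  have locR: "loc ?R" by (intro loc_bex loc_ball loc_psum2[of "\<lambda>x y. x \<le> - y"]) simp_all
  have "Pr ?R = Pr (\<lambda>c. ?P (\<lambda>z. swap (c (-1 - z))))"
  proof (rule Pr_cong)
    fix c assume c: "c \<in> configs A"
    have "?b (\<lambda>z. swap (c (-1 - z))) s = ?a c s" "?a (\<lambda>z. swap (c (-1 - z))) s = ?b c s" for s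
      unfolding charge_reflect[OF c] psum_reflect[of "charge c" "-1"] by simp_all
    then show "?R c = ?P (\<lambda>z. swap (c (-1 - z)))" by simp
  qed
  also have "\<dots> = Pr ?P" by (rule Pr_reflect[OF locP])
  finally have eq: "Pr ?R = Pr ?P" .
  have max: "\<exists>k\<le>N. \<forall>s\<le>N. g s \<le> g k" for g :: "nat \<Rightarrow> int"
  proof -
    have "finite (g ` {..N})" "g ` {..N} \<noteq> {}" by auto
    then have "Max (g ` {..N}) \<in> g ` {..N}" by (rule Max_in)
    then obtain k where "k \<le> N" "g k = Max (g ` {..N})" by (metis atMost_iff imageE)
    then show ?thesis by (intro exI[of _ k]) simp
  qed
  have "1 = Pr (\<lambda>c. True)" by (simp add: Pr_const)
  also have "\<dots> \<le> Pr (\<lambda>c. ?P c \<or> ?R c)"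
  proof (rule Pr_mono)
    show "loc (\<lambda>c. ?P c \<or> ?R c)" by (intro loc_disj locP locR)
    fix c :: "int \<Rightarrow> 'b"
    obtain k where k: "k \<le> N" "\<And>s. s \<le> N \<Longrightarrow> ?a c s \<le> ?a c k" using max[of "?a c"] by blast
    obtain l where l: "l \<le> N" "\<And>s. s \<le> N \<Longrightarrow> ?b c s \<le> ?b c l" using max[of "?b c"] by blast
    show "?P c \<or> ?R c"
    proof (cases "?b c l \<le> ?a c k")
      case True
      then have "\<forall>s\<in>{..N}. ?b c s \<le> ?a c k" using l(2) by force
      then show ?thesis using k(1) by blast
    next
      case False
      then have "\<forall>s\<in>{..N}. ?a c s \<le> ?b c l" using k(2) by force
      then show ?thesis using l(1) by blast
    qed
  qed
  also have "\<dots> \<le> Pr ?P + Pr ?R" by (rule Pr_disj_le[OF locP locR])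
  finally have "1 / 2 \<le> Pr ?P" using eq by simp
  also have "\<dots> \<le> Pr (\<lambda>c. \<exists>k\<in>{..N}. peak N k c)"
  proof (rule Pr_mono)
    show "loc (\<lambda>c. \<exists>k\<in>{..N}. peak N k c)" by (intro loc_bex loc_peak) simp
    fix c assume "?P c"
    then obtain k0 where k0: "k0 \<le> N" "\<And>s. s \<le> N \<Longrightarrow> ?b c s \<le> ?a c k0" by auto
    obtain k1 where k1: "k1 \<le> N" "\<And>s. s \<le> N \<Longrightarrow> ?a c s \<le> ?a c k1" using max[of "?a c"] by blast
    define k where "k = (LEAST k. ?a c k = ?a c k1)"
    have k: "?a c k = ?a c k1" unfolding k_def by (rule LeastI[of _ k1]) simp
    have kN: "k \<le> N" using Least_le[of "\<lambda>k. ?a c k = ?a c k1" k1] k1(1) unfolding k_def by simp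
    have "?a c s < ?a c k" if "s < k" for s
      using not_less_Least[of s "\<lambda>k. ?a c k = ?a c k1"] that k1(2)[of s] kN k
      unfolding k_def[symmetric] by force
    moreover have "?b c s \<le> ?a c k" if "s \<le> N" for s
      using k0(2)[OF that] k1(2)[OF k0(1)] k by simp
    ultimately have "peak N k c" unfolding peak_def using k1(2) k by auto
    then show "\<exists>k\<in>{..N}. peak N k c" using kN by auto
  qed
  finally show ?thesis .
qed

end

context writer
begin

definition filler :: 'b where
  "filler = enc (Letter (lab (SOME e. e \<in> E)))"

definition vertex :: 's where
  "vertex = (SOME s. s \<in> V)"

definition period :: "('s, 'a) edge set list \<Rightarrow> nat \<Rightarrow> ('s, 'a) edge set" where
  "period bs t = bs ! (t mod length bs)"

text \<open>Just behind the particle at \<open>-k\<close> a train of \<open>m\<close> adjacent right-moving particles is inserted, whose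
  memories are the iterated differences of the sequence that its last member is to receive; these
  vanish after \<open>m\<close> steps as \<open>m\<close> is a power of two. The remaining inserted cells only provide room.\<close>

definition room :: "nat \<Rightarrow> nat \<Rightarrow> int \<Rightarrow> int" where
  "room m k z = (if z < - int k then z - 3 * int m - 1 else if z < 0 then z else z + 8 * int m)"

text \<open>On the left stand \<open>2 * m\<close> fillers, the \<open>m\<close> members, and one
  filler in front of them. Inside \<open>{0..<2 * m}\<close>, the events up to time
  \<open>N + 3 * m + 1\<close> depend on cells from \<open>- N - 3 * m - 1\<close> to
  \<open>N + 5 * m\<close>; blocks of lengths \<open>3 * m + 1\<close> and \<open>8 * m\<close> push
  the range controlled by \<open>peak\<close> out at least that far.\<close>

definition inserted :: "nat \<Rightarrow> nat \<Rightarrow> int set" where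
  "inserted m k = {- int k - 3 * int m - 1..- int k - 1} \<union> {0..8 * int m - 1}"

definition plan :: "('s, 'a) edge set list \<Rightarrow> nat \<Rightarrow> int \<Rightarrow> 'b" where
  "plan bs k z = (if - int k - int (length bs) - 1 \<le> z \<and> z \<le> - int k - 2
     then enc (Rgt vertex ((delta ^^ nat (z + int k + int (length bs) + 1)) (period bs) 0)) else filler)"

definition planted :: "('s, 'a) edge set list \<Rightarrow> nat \<Rightarrow> nat \<Rightarrow> (int \<Rightarrow> 'b) \<Rightarrow> bool" where
  "planted bs N k c \<longleftrightarrow> peak N k (\<lambda>z. c (room (length bs) k z)) \<and>
     (\<forall>z\<in>inserted (length bs) k. c z = plan bs k z)"

lemma vertex: "vertex \<in> V"
  unfolding vertex_def using V_nonempty some_in_eq by blast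

lemma filler: "filler \<in> \<A>" "dec filler = Letter (lab (SOME e. e \<in> E))" "q filler = 0"
proof -
  have "\<exists>e. e \<in> E" using out_edge[OF vertex] by blast
  then have "(SOME e. e \<in> E) \<in> E" by (rule someI_ex)
  then have "Letter (lab (SOME e. e \<in> E)) \<in> cells" using edge_V(3) by simp
  from enc[OF this] show "filler \<in> \<A>" "dec filler = Letter (lab (SOME e. e \<in> E))" "q filler = 0"
    by (simp_all add: filler_def q_def)
qed

lemma period_subset:
  assumes "set bs \<subseteq> Pow E" "bs \<noteq> []"
  shows "period bs t \<subseteq> E"
proof -
  have "bs ! (t mod length bs) \<in> set bs" using assms(2) by (intro nth_mem) simp
  then show ?thesis using assms(1) by (auto simp: period_def)
qed

lemma train_cell:
  assumes "set bs \<subseteq> Pow E" "bs \<noteq> []"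
  shows "Rgt vertex ((delta ^^ i) (period bs) 0) \<in> cells"
  using vertex delta_subset[OF period_subset[OF assms]] by simp

lemma plan_in: "set bs \<subseteq> Pow E \<Longrightarrow> bs \<noteq> [] \<Longrightarrow> plan bs k z \<in> \<A>"
  unfolding plan_def using filler(1) enc(1)[OF train_cell] by simp

end

section \<open>Survival of a planted train and the word it writes\<close>

locale train = writer V E Q Lang A dec
  for V :: "'s set" and E :: "('s, 'a) edge set" and Q Lang
    and A :: "'b cellular_automaton" and dec :: "'b \<Rightarrow> ('a, 's) cell" +
  fixes bs :: "('s, 'a) edge set list" and m j N k :: nat and c :: "int \<Rightarrow> 'b"
  assumes bs: "set bs \<subseteq> Pow E" and m: "length bs = m" "m = 2 ^ j" and kN: "k \<le> N"
    and c: "c \<in> configs \<A>" and planted: "planted bs N k c"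
begin

abbreviation f :: "int \<Rightarrow> int" where "f \<equiv> charge c"

abbreviation f0 :: "int \<Rightarrow> int" where "f0 \<equiv> charge (\<lambda>z. c (room m k z))"

abbreviation tail :: int where "tail \<equiv> - int k - int m - 1"

lemma m_pos: "1 \<le> m" and bs_ne: "bs \<noteq> []"
  using m by (auto simp flip: length_greater_0_conv)

lemma plan_eq: "z \<in> inserted m k \<Longrightarrow> c z = plan bs k z"
  using planted m(1) by (simp add: planted_def)

lemma peak_m: "peak N k (\<lambda>z. c (room m k z))"
  using planted m(1) by (simp add: planted_def)

lemma train_init:
  assumes "i < m"
  shows "dec (c (tail + int i)) = Rgt vertex ((delta ^^ i) (period bs) 0)"
proof -
  have "c (tail + int i) = plan bs k (tail + int i)"
    using assms by (intro plan_eq) (auto simp: inserted_def)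
  also have "\<dots> = enc (Rgt vertex ((delta ^^ i) (period bs) 0))"
    using assms m(1) by (simp add: plan_def)
  finally show ?thesis using enc(2)[OF train_cell[OF bs bs_ne]] by simp
qed

lemma f_train: "tail \<le> z \<Longrightarrow> z \<le> - int k - 2 \<Longrightarrow> f z = 1"
  using train_init[of "nat (z - tail)"] by (simp add: q_def)

lemma f_filler:
  assumes "z \<in> inserted m k" "z < tail \<or> - int k - 2 < z"
  shows "f z = 0"
  using plan_eq[OF assms(1)] assms(2) m(1) filler(3) by (auto simp: plan_def)

lemma psum_old_mid: "- int k \<le> i \<Longrightarrow> j' \<le> -1 \<Longrightarrow> psum f i j' = psum f0 i j'"
  by (rule psum_cong) (auto simp: room_def)

lemma psum_old_right: "0 \<le> i \<Longrightarrow> psum f (i + 8 * int m) (j' + 8 * int m) = psum f0 i j'"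
  unfolding psum_shift[symmetric, of f] by (rule psum_cong) (auto simp: room_def)

lemma psum_old_left:
  assumes "j' < - int k"
  shows "psum f (i + (- 3 * int m - 1)) (j' + (- 3 * int m - 1)) = psum f0 i j'"
  unfolding psum_shift[symmetric, of f] by (rule psum_cong) (use assms in \<open>auto simp: room_def algebra_simps\<close>)

lemma psum_fill: "(\<And>z. i \<le> z \<Longrightarrow> z \<le> j' \<Longrightarrow> z \<in> inserted m k \<and> (z < tail \<or> - int k - 2 < z)) \<Longrightarrow> psum f i j' = 0"
  unfolding psum_def by (rule sum.neutral) (use f_filler in auto)

lemma peakD:
  "s < k \<Longrightarrow> psum f0 (- int s) (-1) < psum f0 (- int k) (-1)"
  "k < s \<Longrightarrow> s \<le> N \<Longrightarrow> psum f0 (- int s) (-1) \<le> psum f0 (- int k) (-1)"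
  "s \<le> N \<Longrightarrow> - psum f0 0 (int s - 1) \<le> psum f0 (- int k) (-1)"
  using peak_m unfolding peak_def by auto

lemma peak0: "0 \<le> psum f0 (- int k) (-1)"
  using peakD(1)[of 0] by (cases "k = 0") (simp_all add: psum_empty)

text \<open>As \<open>-k\<close> maximises the left sums and dominates the right ones, every
  left-moving particle ahead of the train within range is cancelled by a right-moving one also ahead
  of it.\<close>

lemma psum_right_nonneg:
  assumes "- int k - 1 \<le> j'" "j' \<le> 8 * int m + int N - 1"
  shows "0 \<le> psum f (- int k - 1) j'"
proof -
  have "psum f (- int k - 1) (- int k - 1) = 0"
    using m_pos by (intro psum_fill) (auto simp: inserted_def)
  then have e: "psum f (- int k - 1) j' = psum f (- int k) j'"
    using psum_split[of "- int k - 1" "- int k - 1" j' f] assms by simp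
  consider "j' \<le> -1" | "0 \<le> j'" "j' < 8 * int m" | "8 * int m \<le> j'" by linarith
  then show ?thesis
  proof cases
    case 1
    define s where "s = nat (- j' - 1)"
    have s: "j' = - int s - 1" "s \<le> k" using 1 assms(1) by (auto simp: s_def)
    have "psum f0 (- int s) (-1) \<le> psum f0 (- int k) (-1)"
      using peakD(1)[of s] s(2) by (cases "s = k") simp_all
    moreover have "psum f0 (- int k) (-1) = psum f0 (- int k) j' + psum f0 (- int s) (-1)"
      using psum_split[of "- int k" j' "-1" f0] assms(1) 1 s by simp
    ultimately show ?thesis unfolding e using psum_old_mid[of "- int k" j'] 1 by simp
  next
    case 2
    have "psum f 0 j' = 0" using 2 by (intro psum_fill) (auto simp: inserted_def)
    then show ?thesis unfolding e
      using psum_split[of "- int k" "-1" j' f] 2 peak0 psum_old_mid[of "- int k" "-1"] by simp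
  next
    case 3
    have "psum f 0 (8 * int m - 1) = 0" by (intro psum_fill) (auto simp: inserted_def)
    then have "psum f (- int k) j' = psum f0 (- int k) (-1) + psum f (8 * int m) j'"
      using psum_split[of "- int k" "-1" j' f] psum_split[of 0 "8 * int m - 1" j' f] 3
        psum_old_mid[of "- int k" "-1"] by simp
    moreover define s where "s = nat (j' - 8 * int m + 1)"
    have s: "j' = (int s - 1) + 8 * int m" "s \<le> N" using 3 assms(2) by (auto simp: s_def)
    moreover have "- psum f0 0 (int s - 1) \<le> psum f0 (- int k) (-1)"
      using peakD(3) s(2) by blast
    ultimately show ?thesis unfolding e using psum_old_right[of 0 "int s - 1"] by simp
  qed
qed

lemma psum_train:
  assumes "tail \<le> x" "x \<le> - int k - 2" "x \<le> j'" "j' \<le> 8 * int m + int N - 1"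
  shows "1 \<le> psum f x j'"
proof (cases "j' \<le> - int k - 2")
  case True
  have "psum f x j' = psum (\<lambda>_. 1) x j'" using assms True by (intro psum_cong f_train) auto
  then show ?thesis using assms(3) by (simp add: psum_def)
next
  case False
  have "psum f x (- int k - 2) = psum (\<lambda>_. 1) x (- int k - 2)" using assms by (intro psum_cong f_train) auto
  then have "1 \<le> psum f x (- int k - 2)" using assms(2) by (simp add: psum_def)
  moreover have "psum f x j' = psum f x (- int k - 2) + psum f (- int k - 2 + 1) j'"
    using False assms by (intro psum_split) auto
  moreover have e: "- int k - 2 + 1 = - int k - 1" by simp
  moreover have "0 \<le> psum f (- int k - 1) j'"
    by (rule psum_right_nonneg) (use False assms(4) in auto)
  ultimately show ?thesis unfolding e by linarith
qed

text \<open>Again by maximality of \<open>-k\<close>, now seen from further left: a right-moving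
  particle behind the train is cancelled by a left-moving one that also starts behind the train, so
  none follows it.\<close>

lemma psum_behind:
  assumes "- int N - 3 * int m - 1 \<le> x" "x < tail"
  shows "psum f x (tail - 1) \<le> 0"
proof (cases "- int k - 3 * int m - 1 \<le> x")
  case True
  then have "psum f x (tail - 1) = 0" by (intro psum_fill) (auto simp: inserted_def)
  then show ?thesis by simp
next
  case False
  let ?y = "- int k - 3 * int m - 2"
  define s where "s = nat (- x - 3 * int m - 1)"
  have s: "x = - int s + (- 3 * int m - 1)" "k < s" "s \<le> N" using assms(1) False by (auto simp: s_def)
  have "psum f (?y + 1) (tail - 1) = 0" using m_pos by (intro psum_fill) (auto simp: inserted_def)
  then have "psum f x (tail - 1) = psum f x ?y"
    using psum_split[of x ?y "tail - 1" f] False m_pos by simp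
  also have "\<dots> = psum f0 (- int s) (- int k - 1)"
  proof -
    have y: "?y = - int k - 1 + (- 3 * int m - 1)" by simp
    show ?thesis unfolding y s(1) by (rule psum_old_left) simp
  qed
  also have "\<dots> \<le> 0"
  proof -
    have "psum f0 (- int s) (-1) \<le> psum f0 (- int k) (-1)"
      using peakD(2) s(2,3) by blast
    then show ?thesis using psum_split[of "- int s" "- int k - 1" "-1" f0] s(2) by simp
  qed
  finally show ?thesis .
qed

text \<open>\<open>k + 3 m + 1\<close> is the time at which the last member of the train leaves \<open>{0..<2 m}\<close>.\<close>

lemma train_alive:
  assumes "i < m" "t \<le> k + 3 * m + 1"
  shows "is_R (cell_at c t (tail + int i + int t))"
proof -
  have "alive_right f (tail + int i) t"
    unfolding alive_right_def
    by (rule ballI, rule psum_train) (use assms kN m_pos in auto)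
  then show ?thesis using is_R_iff[OF c, of t "tail + int i + int t"] by simp
qed

text \<open>This is the purpose of the filler at \<open>-k - 1\<close>: the front member always
  receives the empty drive.\<close>

lemma ahead_dead: "\<not> is_R (cell_at c t (tail + int m + int t))"
proof
  assume "is_R (cell_at c t (tail + int m + int t))"
  then have "alive_right f (tail + int m) t" using is_R_iff[OF c, of t "tail + int m + int t"] by simp
  then have "1 \<le> psum f (tail + int m) (tail + int m)" by (auto simp: alive_right_def)
  moreover have "f (tail + int m) = 0" by (rule f_filler) (use m_pos in \<open>auto simp: inserted_def\<close>)
  ultimately show False by (simp add: psum_one)
qed

text \<open>For \<open>m\<close> a power of two, the \<open>m\<close>-th difference of an
  \<open>m\<close>-periodic sequence is the xor of each term with itself. The empty drive of the
  front member is therefore exactly what the scheme demands.\<close>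

lemma train_end: "(delta ^^ m) (period bs) t = {}"
proof -
  have "(t + m) mod m = t mod m" by simp
  then show ?thesis using delta_power[of j "period bs" t] m by (simp add: period_def set_xor_def)
qed

lemma step_train:
  assumes "i < m" "t \<le> k + 3 * m"
  shows "cell_at c (Suc t) (tail + int i + int (Suc t)) =
    Rgt (tgt (pick (st (cell_at c t (tail + int i + int t))) (mem (cell_at c t (tail + int i + int t)))))
      (set_xor (mem (cell_at c t (tail + int i + int t))) (drive (cell_at c t (tail + int (Suc i) + int t))))"
proof -
  let ?z = "tail + int i + int (Suc t)"
  have z: "?z - 1 = tail + int i + int t" "?z = tail + int (Suc i) + int t" by auto
  have R: "is_R (step (cell_at c t (?z - 1)) (cell_at c t ?z) (cell_at c t (?z + 1)))"
    using train_alive[OF assms(1), of "Suc t"] assms(2) unfolding cell_at_Suc[OF c] by simp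
  have "cell_at c t (?z - 1) = cell_at c t (tail + int i + int t)" by (rule arg_cong[OF z(1)])
  moreover have "cell_at c t ?z = cell_at c t (tail + int (Suc i) + int t)" by (rule arg_cong[OF z(2)])
  moreover have "cell_at c (Suc t) ?z = step (cell_at c t (?z - 1)) (cell_at c t ?z) (cell_at c t (?z + 1))" by (rule cell_at_Suc[OF c])
  ultimately show ?thesis using step_R(2)[OF R] by (simp only:)
qed

lemma train_mem:
  assumes "t \<le> k + 3 * m + 1" "i < m"
  shows "mem (cell_at c t (tail + int i + int t)) = (delta ^^ i) (period bs) t"
  using assms
proof (induction t arbitrary: i)
  case 0
  then show ?case using train_init[of i] by (simp add: cell_at_0)
next
  case (Suc t)
  have dr: "drive (cell_at c t (tail + int (Suc i) + int t)) = (delta ^^ Suc i) (period bs) t"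
  proof (cases "Suc i = m")
    case True
    have "drive (cell_at c t (tail + int (Suc i) + int t)) = {}"
      unfolding True using ahead_dead[of t] by (simp only: drive_def if_False)
    moreover have "(delta ^^ Suc i) (period bs) t = {}" unfolding True by (rule train_end)
    ultimately show ?thesis by simp
  next
    case False
    then have "Suc i < m" using Suc.prems by simp
    then show ?thesis
      using Suc.IH[of "Suc i"] train_alive[of "Suc i" t] Suc.prems(1)
      by (simp only: drive_def if_True)
  qed
  have "mem (cell_at c (Suc t) (tail + int i + int (Suc t))) =
      set_xor ((delta ^^ i) (period bs) t) ((delta ^^ Suc i) (period bs) t)"
    using step_train[of i t] Suc.IH[of i] Suc.prems dr by simp
  also have "(delta ^^ Suc i) (period bs) t =
      set_xor ((delta ^^ i) (period bs) (Suc t)) ((delta ^^ i) (period bs) t)"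
    by (simp only: funpow.simps o_apply delta_def)
  finally show ?case by (simp only: set_xor_cancel)
qed

definition state :: "nat \<Rightarrow> 's" where
  "state t = st (cell_at c t (tail + int t))"

lemma state_V: "t \<le> k + 3 * m + 1 \<Longrightarrow> state t \<in> V"
  using train_alive[of 0 t] m_pos st_mem[OF cell_at_cells[OF c]] unfolding state_def by simp

lemma state_Suc: "t \<le> k + 3 * m \<Longrightarrow> state (Suc t) = tgt (pick (state t) (period bs t))"
  using step_train[of 0 t] train_mem[of t 0] m_pos unfolding state_def by simp

lemma run_state:
  assumes "t + length xs \<le> k + 3 * m + 1" "\<And>i. i < length xs \<Longrightarrow> xs ! i = period bs (t + i)"
    and "i < length xs"
  shows "run (state t) xs ! i = pick (state (t + i)) (period bs (t + i))"
  using assms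
proof (induction xs arbitrary: t i)
  case (Cons x xs)
  have x: "x = period bs t" using Cons.prems(2)[of 0] by simp
  have s: "state (Suc t) = tgt (pick (state t) x)" using state_Suc[of t] Cons.prems(1) x by simp
  show ?case
  proof (cases i)
    case 0
    then show ?thesis using x by simp
  next
    case (Suc i')
    have "run (state (Suc t)) xs ! i' = pick (state (Suc t + i')) (period bs (Suc t + i'))"
      using Cons.prems Cons.prems(2)[of "Suc _"] Suc by (intro Cons.IH) auto
    then show ?thesis using s Suc by simp
  qed
qed simp

text \<open>The survival of the last member into the next step excludes a left-moving particle
  ahead, one just behind would already have met it, and no right-moving particle follows; so it
  leaves a letter and not a defect.\<close>

lemma written:
  assumes z: "0 \<le> z" "z < 2 * int m" and t: "int t = z - tail"
  shows "cell_at c (Suc t) z = Letter (lab (pick (state t) (period bs t)))"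
proof -
  have tk: "t \<le> k + 3 * m" using z t by simp
  have zt: "z = tail + int 0 + int t" using t by simp
  have R: "is_R (cell_at c t z)" unfolding zt by (rule train_alive) (use tk m_pos in auto)
  have "\<not> is_L (cell_at c t (z + 1))"
  proof -
    have "is_R (cell_at c (Suc t) (tail + int 0 + int (Suc t)))" by (rule train_alive) (use tk m_pos in auto)
    also have "tail + int 0 + int (Suc t) = z + 1" using t by simp
    finally show ?thesis using R not_both is_R_step[of "cell_at c t z" "cell_at c t (z + 1)" "cell_at c t (z + 1 + 1)"]
      unfolding cell_at_Suc[OF c] by auto
  qed
  moreover have "\<not> is_L (cell_at c t (z - 1))"
  proof
    assume "is_L (cell_at c t (z - 1))"
    then have "alive_left f (z - 1 + int t) t" using is_L_iff[OF c] by blast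
    moreover have "alive_right f (z - int t) t" using R is_R_iff[OF c] by blast
    moreover have "z - int t = tail" using t by simp
    ultimately show False using alive_right_AL_excl[of f "z - int t" t "z - 1 + int t" t] t m_pos z by simp
  qed
  moreover have "\<not> is_R (cell_at c t (z - 1))"
  proof
    assume "is_R (cell_at c t (z - 1))"
    then have "alive_right f (z - 1 - int t) t" using is_R_iff[OF c] by blast
    moreover have "z - 1 - int t = tail - 1" using t by simp
    ultimately have "alive_right f (tail - 1) t" by (simp only:)
    then have "1 \<le> psum f (tail - 1) (tail - 1)" by (auto simp: alive_right_def)
    then show False using psum_behind[of "tail - 1"] kN m_pos by simp
  qed
  ultimately have "act (cell_at c t (z - 1)) (cell_at c t z) (cell_at c t (z + 1)) =
      Write (pick (st (cell_at c t z)) (mem (cell_at c t z)))"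
    using R by (simp add: act_def)
  moreover have "st (cell_at c t z) = state t" "mem (cell_at c t z) = period bs t"
    using train_mem[of t 0] tk m_pos zt by (auto simp: state_def)
  ultimately show ?thesis unfolding cell_at_Suc[OF c] by (simp add: step_def)
qed

text \<open>A right-moving visitor would need a positive sum behind the train, and a left-moving one
  would have had to pass through the train.\<close>

lemma stays:
  assumes z: "0 \<le> z" "z < 2 * int m" and t: "z - tail < int t" "t < N + 3 * m + 1"
    and l: "cell_at c t z = Letter a"
  shows "cell_at c (Suc t) z = Letter a"
proof -
  have "\<not> is_R (cell_at c t (z - 1))"
  proof
    assume "is_R (cell_at c t (z - 1))"
    then have "alive_right f (z - 1 - int t) t" using is_R_iff[OF c] by blast
    then have "1 \<le> psum f (z - 1 - int t) (tail - 1)"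
      unfolding alive_right_def by (rule bspec) (use z t m_pos in auto)
    moreover have "psum f (z - 1 - int t) (tail - 1) \<le> 0" by (rule psum_behind) (use z t in auto)
    ultimately show False by simp
  qed
  moreover have "\<not> is_L (cell_at c t (z + 1))"
  proof
    assume "is_L (cell_at c t (z + 1))"
    then have "alive_left f (z + 1 + int t) t" using is_L_iff[OF c] by blast
    then have "psum f tail (z + 1 + int t) \<le> - 1"
      unfolding alive_left_def by (rule bspec) (use z t m_pos in auto)
    moreover have "1 \<le> psum f tail (z + 1 + int t)" by (rule psum_train) (use z t m_pos in auto)
    ultimately show False by simp
  qed
  ultimately show ?thesis using l unfolding cell_at_Suc[OF c] by (simp add: step_def act_def)
qed

lemma final_letter:
  assumes z: "0 \<le> z" "z < 2 * int m" and t: "int t = z - tail" and T: "t < T" "T \<le> N + 3 * m + 1"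
  shows "cell_at c T z = Letter (lab (pick (state t) (period bs t)))"
proof -
  have "Suc t \<le> T" using T by simp
  then show ?thesis using T(2)
  proof (induction T rule: dec_induct)
    case base
    show ?case by (rule written[OF z t])
  next
    case (step T)
    then show ?case using stays[OF z, of T] t by simp
  qed
qed

lemma word_appears:
  assumes u: "\<And>s. s \<in> V \<Longrightarrow> \<exists>p r. map lab (run s bs) = p @ u @ r"
  shows "\<exists>z\<in>{..<2 * m}. \<forall>i<length u. cell_at c (N + 3 * m + 1) (int z + int i) = Letter (u ! i)"
proof -
  \<comment> \<open>In natural numbers this is \<open>-(k + 1)\<close> modulo \<open>m\<close>: the
    last member leaves \<open>z0\<close> at a time \<open>\<tau>\<close> divisible by
    \<open>m\<close>, hence when \<open>bs\<close> begins anew. The block of \<open>m\<close> cells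
    starting at \<open>z0\<close> lies in \<open>{0..<2 * m}\<close>.\<close>
  define z0 where "z0 = (m - 1) * (k + 1) mod m"
  define \<tau> where "\<tau> = z0 + (k + 1) + m"
  have z0: "z0 < m" using m_pos by (simp add: z0_def)
  have "(m - 1) * (k + 1) + (k + 1) = m * (k + 1)"
    using m_pos by (cases m) simp_all
  then have "(z0 + (k + 1)) mod m = 0"
    unfolding z0_def by (simp only: mod_add_left_eq) simp
  then have \<tau>0: "\<tau> mod m = 0" by (simp only: \<tau>_def mod_add_self2)
  have per: "period bs (\<tau> + i) = bs ! i" if "i < m" for i
  proof -
    have "(\<tau> + i) mod m = (\<tau> mod m + i) mod m" by (simp only: mod_add_left_eq)
    then show ?thesis using \<tau>0 that m(1) by (simp add: period_def)
  qed
  have letter: "cell_at c (N + 3 * m + 1) (int z0 + int i) = Letter (map lab (run (state \<tau>) bs) ! i)"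
    if i: "i < m" for i
  proof -
    have "run (state \<tau>) bs ! i = pick (state (\<tau> + i)) (period bs (\<tau> + i))"
      by (rule run_state) (use i per m(1) z0 in \<open>auto simp: \<tau>_def\<close>)
    moreover have "cell_at c (N + 3 * m + 1) (int z0 + int i) =
        Letter (lab (pick (state (\<tau> + i)) (period bs (\<tau> + i))))"
      by (rule final_letter) (use i z0 kN in \<open>auto simp: \<tau>_def\<close>)
    ultimately show ?thesis using i m(1) by (simp add: length_run)
  qed
  have "state \<tau> \<in> V" by (rule state_V) (use z0 in \<open>auto simp: \<tau>_def\<close>)
  then obtain p r where pr: "map lab (run (state \<tau>) bs) = p @ u @ r" using u by blast
  from arg_cong[OF this, of length] have len: "length p + length u + length r = m"
    by (simp add: length_run m(1))
  show ?thesis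
  proof (intro bexI[of _ "z0 + length p"] allI impI)
    fix i assume i: "i < length u"
    then have "length p + i < m" using len by simp
    from letter[OF this] i show "cell_at c (N + 3 * m + 1) (int (z0 + length p) + int i) = Letter (u ! i)"
      by (simp add: pr nth_append add.assoc)
  qed (use z0 len in simp)
qed

end

section \<open>Words of the language stay frequent, all others vanish\<close>

context writer
begin

lemma finite_inserted: "finite (inserted m k)"
  by (simp add: inserted_def)

lemma card_inserted: "card (inserted m k) = 11 * m + 1"
  unfolding inserted_def by (subst card_Un_disjoint) auto

lemma loc_planted: "loc (planted bs N k)"
proof -
  have "loc (\<lambda>c. c z = a)" for z and a :: 'b
    by (rule depends_on_loc[of "{z}"]) (auto simp: depends_on_def)
  then show ?thesis
    unfolding planted_def
    using loc_comp[OF loc_peak, of N k "\<lambda>x. x"]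
    by (intro loc_conj loc_ball finite_inserted)
qed

lemma Pr_planted:
  assumes "set bs \<subseteq> Pow E" "bs \<noteq> []"
  shows "Pr (planted bs N k) = Pr (peak N k) / card \<A> ^ (11 * length bs + 1)"
proof -
  have 1: "inj (room (length bs) k)" by (auto simp: inj_def room_def split: if_splits)
  have 2: "bij_betw (\<lambda>x. x) \<A> \<A>" by (simp add: bij_betw_def)
  have 3: "range (room (length bs) k) \<inter> inserted (length bs) k = {}"
    by (auto simp: room_def inserted_def split: if_splits)
  have 4: "plan bs k \<in> inserted (length bs) k \<rightarrow> \<A>" using plan_in[OF assms] by blast
  from Pr_insert[OF loc_peak 1 2 finite_inserted 3 4] show ?thesis
    unfolding card_inserted planted_def .
qed

text \<open>Trains far apart contradict each other because nothing right-moving may survive behind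
  the nearer one; otherwise the front filler of one would be a member of the other. Disjointness
  lets the probabilities for all \<open>k\<close> be added, although their number grows with
  \<open>N\<close>.\<close>

lemma planted_disjoint:
  assumes bs: "set bs \<subseteq> Pow E" "length bs = 2 ^ j" and c: "c \<in> configs \<A>"
    and k: "k < k'" "k' \<le> N" and p: "planted bs N k c" "planted bs N k' c"
  shows False
proof -
  let ?m = "length bs"
  interpret T: train V E Q Lang A dec bs ?m j N k c
    by unfold_locales (use assms in auto)
  interpret T': train V E Q Lang A dec bs ?m j N k' c
    by unfold_locales (use assms in auto)
  show False
  proof (cases "k + ?m \<le> k'")
    case True
    let ?x = "- int k' - 2"
    have "1 \<le> psum (charge c) ?x (- int k - int ?m - 1 - 1)"
      by (rule T'.psum_train) (use True T.m_pos in auto)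
    moreover have "psum (charge c) ?x (- int k - int ?m - 1 - 1) \<le> 0"
      by (rule T.psum_behind) (use True k T.m_pos in auto)
    ultimately show False by simp
  next
    case False
    have "charge c (- int k' - 1) = 0" by (rule T'.f_filler) (use T.m_pos in \<open>auto simp: inserted_def\<close>)
    moreover have "charge c (- int k' - 1) = 1" by (rule T.f_train) (use False k in auto)
    ultimately show False by simp
  qed
qed

lemma orbit_Suc: "(global_map A ^^ Suc n) c z = local_rule A
    [(global_map A ^^ n) c (z - 1), (global_map A ^^ n) c z, (global_map A ^^ n) c (z + 1)]"
  by (simp only: funpow.simps o_apply global_map_eq)

lemma orbit_local:
  "(\<And>y. z - int n \<le> y \<Longrightarrow> y \<le> z + int n \<Longrightarrow> c y = c' y) \<Longrightarrow>
    (global_map A ^^ n) c z = (global_map A ^^ n) c' z"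
proof (induction n arbitrary: z)
  case (Suc n)
  have "(global_map A ^^ n) c y = (global_map A ^^ n) c' y" if "y \<in> {z - 1, z, z + 1}" for y
    by (rule Suc.IH, rule Suc.prems) (use that in auto)
  then show ?case unfolding orbit_Suc by simp
qed simp

lemma orbit_shift: "(global_map A ^^ n) (\<lambda>y. c (y + d)) z = (global_map A ^^ n) c (z + d)"
proof (induction n arbitrary: z)
  case (Suc n)
  then show ?case unfolding orbit_Suc by (simp add: algebra_simps)
qed simp

lemma cell_at_shift: "cell_at (\<lambda>y. c (y + d)) n z = cell_at c n (z + d)"
  unfolding cell_at_def orbit_shift ..

lemma trace_shift: "trace (\<lambda>y. c (y + d)) n z = trace c n (z + d)"
  by (induction n arbitrary: z) (simp_all add: cell_at_shift algebra_simps split: action.split)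

definition appears :: "'a list \<Rightarrow> nat \<Rightarrow> int \<Rightarrow> (int \<Rightarrow> 'b) \<Rightarrow> bool" where
  "appears u n z c \<longleftrightarrow> (\<forall>i\<in>{..<length u}. cell_at c n (z + int i) = Letter (u ! i))"

lemma loc_appears: "loc (appears u n z)"
  unfolding appears_def
proof (rule loc_ball)
  fix i
  let ?z = "z + int i"
  show "loc (\<lambda>c. cell_at c n ?z = Letter (u ! i))"
  proof (rule depends_on_loc)
    show "finite {?z - int n..?z + int n}" by simp
    have "cell_at c n ?z = cell_at c' n ?z" if "\<forall>y\<in>{?z - int n..?z + int n}. c y = c' y" for c c'
      unfolding cell_at_def using that by (intro arg_cong[where f = dec] orbit_local) simp
    then show "depends_on {?z - int n..?z + int n} (\<lambda>c. cell_at c n ?z = Letter (u ! i))"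
      unfolding depends_on_def by metis
  qed
qed simp

lemma Pr_appears: "Pr (appears u n z) = Pr (appears u n 0)"
proof -
  have e: "appears u n z = (\<lambda>c. appears u n 0 (\<lambda>y. c (y + z)))"
    by (rule ext) (simp add: appears_def cell_at_shift add.commute)
  show ?thesis using Pr_shift[OF loc_appears, of u n 0 z] unfolding e .
qed

text \<open>The bound \<open>1 / (4 * m * K)\<close> consists of 1/2 for the existence of a peak,
  \<open>1 / K\<close> for inserting the train, and \<open>1 / (2 * m)\<close> for the unknown
  position of the word.\<close>

lemma appears_bounded_below:
  assumes u: "u \<in> Lang"
  shows "\<exists>\<epsilon>>0. \<exists>n0. \<forall>n\<ge>n0. \<epsilon> \<le> Pr (appears u n 0)"
proof -
  obtain bs j where bs: "set bs \<subseteq> Pow E" "length bs = 2 ^ j"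
    and univ: "\<And>s. s \<in> V \<Longrightarrow> \<exists>p r. map lab (run s bs) = p @ u @ r"
    using universal_list_power2[OF u] by blast
  define m where "m = length bs"
  have m: "1 \<le> m" and ne: "bs \<noteq> []" using bs(2) by (auto simp: m_def simp flip: length_greater_0_conv)
  define K where "K = real (card \<A>) ^ (11 * m + 1)"
  have K: "0 < K" using fin_A A_ne by (simp add: K_def card_gt_0_iff)
  have low: "1 / (4 * m * K) \<le> Pr (appears u (N + 3 * m + 1) 0)" for N
  proof -
    let ?n = "N + 3 * m + 1"
    have "1 / 2 / K \<le> Pr (\<lambda>c. \<exists>k\<in>{..N}. peak N k c) / K"
      using Pr_peak[of N] K by (intro divide_right_mono) auto
    also have "\<dots> \<le> (\<Sum>k\<in>{..N}. Pr (peak N k)) / K"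
      using Pr_bex_le[of "{..N}" "peak N"] loc_peak K by (intro divide_right_mono) auto
    also have "\<dots> = (\<Sum>k\<in>{..N}. Pr (planted bs N k))"
      unfolding sum_divide_distrib Pr_planted[OF bs(1) ne] K_def m_def by simp
    also have "\<dots> = Pr (\<lambda>c. \<exists>k\<in>{..N}. planted bs N k c)"
    proof (rule Pr_bex_disjoint[symmetric])
      fix k k' c assume "k \<in> {..N}" "k' \<in> {..N}" "k \<noteq> k'" "c \<in> configs \<A>"
        "planted bs N k c" "planted bs N k' c"
      then show False
        using planted_disjoint[OF bs, of c k k' N] planted_disjoint[OF bs, of c k' k N]
        by (cases "k < k'") auto
    qed (simp_all add: loc_planted)
    also have "\<dots> \<le> Pr (\<lambda>c. \<exists>z\<in>{..<2 * m}. appears u ?n (int z) c)"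
    proof (rule Pr_mono)
      show "loc (\<lambda>c. \<exists>z\<in>{..<2 * m}. appears u ?n (int z) c)"
        by (intro loc_bex loc_appears) simp
      fix c assume c: "c \<in> configs \<A>" and "\<exists>k\<in>{..N}. planted bs N k c"
      then obtain k where k: "k \<le> N" "planted bs N k c" by auto
      interpret T: train V E Q Lang A dec bs m j N k c
        by unfold_locales (use bs c k in \<open>auto simp: m_def\<close>)
      show "\<exists>z\<in>{..<2 * m}. appears u ?n (int z) c"
        using T.word_appears[OF univ] unfolding appears_def by auto
    qed
    also have "\<dots> \<le> (\<Sum>z\<in>{..<2 * m}. Pr (appears u ?n (int z)))"
      by (rule Pr_bex_le) (simp_all add: loc_appears)
    also have "\<dots> = (\<Sum>z\<in>{..<2 * m}. Pr (appears u ?n 0))"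
      by (rule sum.cong[OF refl Pr_appears])
    finally show ?thesis using K m by (simp add: field_simps)
  qed
  show ?thesis
  proof (intro exI[of _ "1 / (4 * m * K)"] conjI exI[of _ "3 * m + 1"] allI impI)
    show "0 < 1 / (4 * m * K)" using K m by simp
    fix n assume "3 * m + 1 \<le> n"
    then have "n = (n - (3 * m + 1)) + 3 * m + 1" by simp
    then show "1 / (4 * m * K) \<le> Pr (appears u n 0)" using low by metis
  qed
qed

text \<open>If every cell under \<open>u\<close> were traced, \<open>u\<close> would code a word of
  \<open>Lang\<close>. So one of its cells is untraced, and a union bound over the fixed length of
  \<open>u\<close> suffices.\<close>

lemma stray_word_vanishes:
  assumes u: "u \<in> lists \<A>" "u \<notin> map (\<lambda>a. enc (Letter a)) ` Lang"
  shows "(\<lambda>n. Pr (\<lambda>c. \<forall>i<length u. (global_map A ^^ n) c (int i) = u ! i)) \<longlonglongrightarrow> 0"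
proof (rule LIMSEQ_I)
  fix r :: real assume r: "0 < r"
  let ?l = "length u"
  let ?P = "\<lambda>n c. \<forall>i<?l. (global_map A ^^ n) c (int i) = u ! i"
  define \<epsilon> where "\<epsilon> = r / (?l + 1)"
  have \<epsilon>: "0 < \<epsilon>" using r by (simp add: \<epsilon>_def)
  obtain M N where MN: "1 \<le> M" "M < N" "\<And>n. N \<le> n \<Longrightarrow> Pr (unsettled M n) < \<epsilon>"
    using unsettled_small[OF \<epsilon>] by blast
  have "Pr (?P n) < r" if n: "N \<le> n" for n
  proof -
    let ?U = "\<lambda>i c. unsettled M n (\<lambda>y. c (y + int i))"
    have locU: "loc (?U i)" for i by (rule loc_shift[OF loc_unsettled])
    have "Pr (?P n) \<le> Pr (\<lambda>c. \<exists>i\<in>{..<?l}. ?U i c)"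
    proof (rule Pr_mono)
      show "loc (\<lambda>c. \<exists>i\<in>{..<?l}. ?U i c)" by (intro loc_bex locU) simp
      fix c assume c: "c \<in> configs \<A>" and P: "?P n c"
      show "\<exists>i\<in>{..<?l}. ?U i c"
      proof (rule ccontr)
        assume N: "\<not> (\<exists>i\<in>{..<?l}. ?U i c)"
        have "trace c n (0 + int i) \<noteq> None" if i: "i < ?l" for i
        proof
          assume "trace c n (0 + int i) = None"
          then have "trace (\<lambda>y. c (y + int i)) n 0 = None" by (simp add: trace_shift)
          moreover have "(\<lambda>y. c (y + int i)) \<in> configs \<A>" using c by (auto simp: configs_def)
          ultimately have "?U i c" using undefined_unsettled MN(1,2) n by simp
          then show False using N i by blast
        qed
        from written_word[OF c this] obtain v where v: "v \<in> Lang" "length v = ?l"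
          and "\<forall>k<?l. cell_at c n (0 + int k) = Letter (v ! k)" by blast
        then have "dec (u ! i) = Letter (v ! i)" if "i < ?l" for i
          using P that by (simp add: cell_at_def)
        then have "u ! i = enc (Letter (v ! i))" if "i < ?l" for i
          using enc_dec[of "u ! i"] that u(1) by (metis in_listsD nth_mem)
        then have "u = map (\<lambda>a. enc (Letter a)) v" using v(2) by (intro nth_equalityI) auto
        then show False using u(2) v(1) by blast
      qed
    qed
    also have "\<dots> \<le> (\<Sum>i\<in>{..<?l}. Pr (?U i))" by (rule Pr_bex_le) (simp_all add: locU)
    also have "\<dots> = ?l * Pr (unsettled M n)" using Pr_shift[OF loc_unsettled] by simp
    also have "\<dots> \<le> ?l * \<epsilon>" using MN(3)[OF n] by (intro mult_left_mono) auto
    also have "\<dots> < r" using r by (simp add: \<epsilon>_def field_simps)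
    finally show ?thesis .
  qed
  then show "\<exists>no. \<forall>n\<ge>no. norm (Pr (?P n) - 0) < r"
    using Pr_nonneg by (intro exI[of _ N]) (simp add: abs_of_nonneg)
qed

lemma persistent_set_eq: "persistent_set A = map (\<lambda>a. enc (Letter a)) ` Lang"
proof -
  have meas: "measure (bernoulli \<A>) ((global_map A ^^ n) -` cylinder \<A> u 0 \<inter> configs \<A>) =
    Pr (\<lambda>c. \<forall>i<length u. (global_map A ^^ n) c (int i) = u ! i)" for u n
  proof -
    have "factor c 0 (0 + int (length u) - 1) = u \<longleftrightarrow> (\<forall>i<length u. c (int i) = u ! i)" for c :: "int \<Rightarrow> 'b"
      using factor_eq_iff[of u c 0] by auto
    then have "(global_map A ^^ n) -` cylinder \<A> u 0 \<inter> configs \<A> =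
        {c \<in> configs \<A>. \<forall>i<length u. (global_map A ^^ n) c (int i) = u ! i}"
      using orbit_configs by (auto simp: cylinder_def)
    then show ?thesis unfolding Pr_def by simp
  qed
  have LQ: "set v \<subseteq> Q" if v: "v \<in> Lang" for v
  proof -
    obtain s es t where "walk E s es t" "map lab es = v" using label_walk[OF v] by blast
    then show ?thesis using walk_edges edge_V(3) by fastforce
  qed
  show ?thesis
  proof (intro set_eqI iffI)
    fix u assume "u \<in> persistent_set A"
    then show "u \<in> map (\<lambda>a. enc (Letter a)) ` Lang"
      using stray_word_vanishes[of u] unfolding persistent_set_def meas by blast
  next
    fix u assume "u \<in> map (\<lambda>a. enc (Letter a)) ` Lang"
    then obtain v where v: "v \<in> Lang" and u: "u = map (\<lambda>a. enc (Letter a)) v" by blast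
    have uA: "u \<in> lists \<A>" using LQ[OF v] by (auto simp: u subset_iff intro!: enc(1))
    obtain \<epsilon> n0 where \<epsilon>: "0 < \<epsilon>" "\<And>n. n0 \<le> n \<Longrightarrow> \<epsilon> \<le> Pr (appears v n 0)"
      using appears_bounded_below[OF v] by blast
    have "Pr (appears v n 0) = Pr (\<lambda>c. \<forall>i<length u. (global_map A ^^ n) c (int i) = u ! i)" for n
    proof (rule Pr_cong)
      fix c assume c: "c \<in> configs \<A>"
      have "dec x = Letter a \<longleftrightarrow> x = enc (Letter a)" if "x \<in> \<A>" "a \<in> Q" for x a
        using that enc enc_dec by (metis cells_iff(1))
      moreover have "v ! i \<in> Q" if "i < length v" for i using LQ[OF v] that by (meson nth_mem subsetD)
      ultimately show "appears v n 0 c = (\<forall>i<length u. (global_map A ^^ n) c (int i) = u ! i)"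
        using orbit_in[OF c] by (auto simp: appears_def cell_at_def u)
    qed
    with \<epsilon>(2) have low: "\<And>n. n0 \<le> n \<Longrightarrow>
        \<epsilon> \<le> Pr (\<lambda>c. \<forall>i<length u. (global_map A ^^ n) c (int i) = u ! i)" by simp
    have "\<not> (\<lambda>n. Pr (\<lambda>c. \<forall>i<length u. (global_map A ^^ n) c (int i) = u ! i)) \<longlonglongrightarrow> 0"
    proof
      assume "(\<lambda>n. Pr (\<lambda>c. \<forall>i<length u. (global_map A ^^ n) c (int i) = u ! i)) \<longlonglongrightarrow> 0"
      then have "\<epsilon> \<le> 0" by (rule LIMSEQ_le_const) (use low in blast)
      then show False using \<epsilon>(1) by simp
    qed
    then show "u \<in> persistent_set A" using uA unfolding persistent_set_def meas by blast
  qed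
qed

end

section \<open>Coding the cells, and the theorem\<close>

lemma (in presentation) writer_exists:
  "\<exists>(A :: ('a + nat) cellular_automaton) dec. writer V E Q L A dec \<and>
     (\<forall>a\<in>Q. Inl a \<in> alphabet A \<and> dec (Inl a) = Letter a)"
proof -
  obtain h :: "('a, 's) cell \<Rightarrow> nat" where h: "inj_on h cells"
    using finite_imp_inj_to_nat_seg[OF finite_cells] by blast
  \<comment> \<open>Letters become the elements of \<open>Q\<close> themselves; the finitely many
    other cells are numbered.\<close>
  define code where "code x = (case x of Letter a \<Rightarrow> Inl a | _ \<Rightarrow> Inr (h x))" for x :: "('a, 's) cell"
  have inj: "inj_on code cells"
    using h by (auto simp: inj_on_def code_def split: cell.splits)
  define dec where "dec = inv_into cells code"
  define A where "A = \<lparr>alphabet = code ` cells, radius = 1,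
    local_rule = (\<lambda>w. code (step (dec (w ! 0)) (dec (w ! 1)) (dec (w ! 2))))\<rparr>"
  have dec: "dec (code x) = x" if "x \<in> cells" for x
    using inj that by (simp add: dec_def)
  have "writer V E Q L A dec"
  proof
    show "bij_betw dec (alphabet A) cells"
      using inj by (simp add: A_def dec_def bij_betw_inv_into inj_on_imp_bij_betw)
    show "radius A = 1" by (simp add: A_def)
    fix x y z assume "x \<in> alphabet A" "y \<in> alphabet A" "z \<in> alphabet A"
    then have "step (dec x) (dec y) (dec z) \<in> cells"
      using step_cells dec by (auto simp: A_def)
    then show "local_rule A [x, y, z] \<in> alphabet A \<and>
        dec (local_rule A [x, y, z]) = step (dec x) (dec y) (dec z)"
      using dec by (auto simp: A_def)
  qed
  moreover have "Inl a \<in> alphabet A \<and> dec (Inl a) = Letter a" if "a \<in> Q" for a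
  proof -
    have 1: "Letter a \<in> cells" and 2: "Inl a = code (Letter a)" using that by (simp_all add: code_def)
    show ?thesis unfolding 2 dec[OF 1] using 1 by (simp add: A_def)
  qed
  ultimately show ?thesis by blast
qed

theorem mainTheorem2:
  fixes Q :: "'a set" and \<Sigma> :: "(int \<Rightarrow> 'a) set"
  assumes "finite Q"
    and "sofic Q \<Sigma>"
    and "transitive_subshift \<Sigma>"
    and "\<Sigma> \<noteq> {}"
  shows "\<exists>A :: ('a + nat) cellular_automaton.
           cellular_automaton A \<and> Inl ` Q \<subseteq> alphabet A \<and>
           mu_limit_set A = (\<lambda>c. Inl \<circ> c) ` \<Sigma>"
proof -
  obtain V :: "'a list set set" and E where "presentation V E Q (language \<Sigma>)"
    using sofic_presentation[OF assms] by blast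
  then interpret presentation V E Q "language \<Sigma>" .
  obtain A :: "('a + nat) cellular_automaton" and dec where
    w: "writer V E Q (language \<Sigma>) A dec" and
    Inl: "\<And>a. a \<in> Q \<Longrightarrow> Inl a \<in> alphabet A" "\<And>a. a \<in> Q \<Longrightarrow> dec (Inl a) = Letter a"
    using writer_exists by blast
  interpret W: writer V E Q "language \<Sigma>" A dec by (rule w)
  obtain F where S: "\<Sigma> = avoiding Q F" using assms(2) by (auto simp: sofic_def)
  have conf: "\<Sigma> \<subseteq> configs Q" by (auto simp: S avoiding_def)
  have enc: "W.enc (Letter a) = Inl a" if "a \<in> Q" for a
    using W.enc_dec[OF Inl(1)[OF that]] Inl(2)[OF that] by simp
  have LQ: "set u \<subseteq> Q" if "u \<in> language \<Sigma>" for u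
  proof -
    from that obtain c i where c: "c \<in> \<Sigma>" "\<forall>k<length u. c (i + int k) = u ! k"
      unfolding language_iff by blast
    have "c z \<in> Q" for z using conf c(1) by (auto simp: configs_def PiE_iff)
    then show ?thesis using c(2) by (auto simp: in_set_conv_nth) metis
  qed
  have P: "persistent_set A = map Inl ` language \<Sigma>"
    unfolding W.persistent_set_eq
  proof (rule image_cong[OF refl])
    fix u assume "u \<in> language \<Sigma>"
    then show "map (\<lambda>a. W.enc (Letter a)) u = map Inl u" using LQ enc by (auto simp: subset_iff)
  qed
  have "mu_limit_set A = (\<lambda>c. Inl \<circ> c) ` \<Sigma>"
  proof (intro set_eqI iffI)
    fix d assume d: "d \<in> mu_limit_set A"
    have fac: "factor d i j \<in> map Inl ` language \<Sigma>" for i j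
      using d factor_in_language[of d "{d}" i j] unfolding mu_limit_set_def P by blast
    have "\<exists>a. d z = Inl a" for z using fac[of z z] by (auto simp: factor_def)
    then obtain c where c: "\<And>z. d z = Inl (c z)" by metis
    have fc: "factor c i j \<in> language \<Sigma>" for i j
    proof -
      have "factor d i j = map Inl (factor c i j)" using c by (simp add: factor_def)
      then show ?thesis using fac[of i j] by (auto simp: inj_map_eq_map)
    qed
    have "c z \<in> Q" for z using LQ[OF fc[of z z]] by (simp add: factor_def)
    moreover have "language {c} \<inter> F = {}"
    proof -
      \<comment> \<open>All factors of \<open>c\<close> lie in the language, so none is forbidden;
        the description by forbidden words is what makes this local information suffice for
        membership.\<close>
      have "language {c} \<subseteq> language \<Sigma>" using fc by (auto simp: language_def[of "{c}"]) metis
      moreover have "language \<Sigma> \<inter> F = {}" unfolding S avoiding_def language_def by blast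
      ultimately show ?thesis by blast
    qed
    ultimately have "c \<in> \<Sigma>" by (simp add: S avoiding_def configs_def PiE_iff)
    moreover have "d = Inl \<circ> c" using c by auto
    ultimately show "d \<in> (\<lambda>c. Inl \<circ> c) ` \<Sigma>" by blast
  next
    fix d :: "int \<Rightarrow> 'a + nat" assume "d \<in> (\<lambda>c. Inl \<circ> c) ` \<Sigma>"
    then obtain c where c: "c \<in> \<Sigma>" "d = Inl \<circ> c" by blast
    have "c z \<in> Q" for z using conf c(1) by (auto simp: configs_def PiE_iff)
    then have "d \<in> configs (alphabet A)" using Inl(1) c(2) by (auto simp: configs_def)
    moreover have "language {d} \<subseteq> map Inl ` language \<Sigma>"
    proof
      fix u assume "u \<in> language {d}"
      then obtain i j where "u = factor d i j" by (auto simp: language_def)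
      then have "u = map Inl (factor c i j)" using c(2) by (simp add: factor_def)
      then show "u \<in> map Inl ` language \<Sigma>" using factor_in_language[OF c(1)] by blast
    qed
    ultimately show "d \<in> mu_limit_set A" unfolding mu_limit_set_def P by blast
  qed
  then show ?thesis using W.cellular_automaton_A Inl(1) by blast
qed

end
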